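(* Let $\varepsilon,\mu:\Omega\to\mathbb{R}^{3\times 3}$ be matrix fields with bounded measurable entries such that $\varepsilon(x)$ and $\mu(x)$ are symmetric for all $x\in\Omega$, and such that there exist constants $\varepsilon_*>0$ and $\mu_*>0$ with $\varepsilon(x)\xi\cdot\xi\ge\varepsilon_*|\xi|^2$ and $\mu(x)\xi\cdot\xi\ge\mu_*|\xi|^2$ for all $x\in\Omega$ and all $\xi\in\mathbb{R}^3$. Let $j(x,t,\xi)=j_0(x,t)+j_1(x,t,\xi)$ for $(x,t,\xi)\in Q_T\times\mathbb{R}^3$, where $j_0\in L^2(Q_T)^3$ and $j_1:Q_T\times\mathbb{R}^3\to\mathbb{R}^3$ is a Carath\'eodory function such that, for some constant $c_1>0$, $|j_1(x,t,\xi)|\le c_1|\xi|$ for all $(x,t,\xi)\in Q_T\times\mathbb{R}^3$. Let $(e_0,h_0)\in L^2(\Omega)^3\times L^2(\Omega)^3$. Then for every weak solution $(e,h)\in L^2(Q_T)^3\times L^2(Q_T)^3$ of the Maxwell problem with data $(\varepsilon,\mu,j,e_0,h_0)$ there exist representatives $\hat e,\hat h\in C([0,T];H)$ in the equivalence classes $e,h\in L^2(0,T;H)$, respectively, that satisfy the initial conditions $$\hat e(0)=e_0,\qquad \hat h(0)=h_0\qquad\text{in }H.$$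
   Context: Setting and notation. $\Omega\subset\mathbb{R}^3$ is an open set, $0<T<+\infty$, $Q_T=\Omega\times\,]0,T[$. $H:=L^2(\Omega)^3$ with scalar product $(u,v)_H=\int_\Omega u\cdot v\,dx$. $V$ is the space of all $u\in L^2(\Omega)^3$ whose distributional curl is represented by a field in $L^2(\Omega)^3$, i.e. there is $F=:\operatorname{curl}u\in L^2(\Omega)^3$ with $\int_\Omega u\cdot\operatorname{curl}\varphi\,dx=\int_\Omega F\cdot\varphi\,dx$ for all $\varphi\in C_c^\infty(\Omega)^3$; it is a Hilbert space with scalar product $(u,v)_V=\int_\Omega(u\cdot v+\operatorname{curl}u\cdot\operatorname{curl}v)\,dx$. $V_0$ is the closed subspace $V_0:=\{u\in V:\int_\Omega(\operatorname{curl}u)\cdot\psi\,dx=\int_\Omega u\cdot\operatorname{curl}\psi\,dx\text{ for all }\psi\in V\}$. $L^2(Q_T)^3$ is identified with the Bochner space $L^2(0,T;H)$ via $u\mapsto(t\mapsto u(\cdot,t))$. Carath\'eodory function: $(x,t)\mapsto j_1(x,t,\xi)$ is measurable in $Q_T$ for all $\xi\in\mathbb{R}^3$, and $\xi\mapsto j_1(x,t,\xi)$ is continuous on $\mathbb{R}^3$ for a.e. $(x,t)\in Q_T$. For $u\in L^2(Q_T)^3$, $j(u)$ denotes the field $(x,t)\mapsto j(x,t,u(x,t))$, which lies in $L^2(Q_T)^3$. Weak solution: $(e,h)\in L^2(Q_T)^3\times L^2(Q_T)^3$ is a weak solution of the Maxwell problem with data $(\varepsilon,\mu,j,e_0,h_0)$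 (that is, of $\partial_t(\varepsilon e)=\operatorname{curl}h-j$, $\partial_t(\mu h)=-\operatorname{curl}e$ in $Q_T$, $n\times e=0$ on $\partial\Omega\times\,]0,T[$, $e=e_0$, $h=h_0$ at $t=0$) if $$-\int_{Q_T}(\varepsilon e)\cdot\partial_t\Phi\,dx\,dt+\int_{Q_T}\big(-h\cdot\operatorname{curl}\Phi+j(e)\cdot\Phi\big)\,dx\,dt=\int_\Omega(\varepsilon e_0)(x)\cdot\Phi(x,0)\,dx$$ for all $\Phi\in L^2(0,T;V_0)$ with $\partial_t\Phi\in L^2(Q_T)^3$ and $\Phi(\cdot,T)=0$ a.e. in $\Omega$, and $$-\int_{Q_T}(\mu h)\cdot\partial_t\Psi\,dx\,dt+\int_{Q_T}e\cdot\operatorname{curl}\Psi\,dx\,dt=\int_\Omega(\mu h_0)(x)\cdot\Psi(x,0)\,dx$$ for all $\Psi\in L^2(0,T;V)$ with $\partial_t\Psi\in L^2(Q_T)^3$ and $\Psi(\cdot,T)=0$ a.e. in $\Omega$. (Values of $\Phi,\Psi$ at $t=0,T$ are those of the representatives in $C([0,T];H)$.) *)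

theory Defs
  imports "HOL-Analysis.Analysis"
begin

text \<open>
  Elements of \<open>L\<^sup>2\<close> are handled as functions, with equality almost everywhere written out where
  it is meant.  A field on \<open>\<Omega>\<close> is a total function on \<open>real^3\<close>; its values
  outside \<open>\<Omega>\<close> are irrelevant.  A field on \<open>Q\<^sub>T\<close> takes a pair \<open>(x, t)\<close>.
\<close>

definition L2 :: "'a measure \<Rightarrow> ('a \<Rightarrow> real^3) set" where
  "L2 M = {u \<in> borel_measurable M. integrable M (\<lambda>x. (norm (u x))\<^sup>2)}"

definition L2_inner :: "'a measure \<Rightarrow> ('a \<Rightarrow> real^3) \<Rightarrow> ('a \<Rightarrow> real^3) \<Rightarrow> real" where
  "L2_inner M u v = (\<integral>x. u x \<bullet> v x \<partial>M)"

definition L2_norm :: "'a measure \<Rightarrow> ('a \<Rightarrow> real^3) \<Rightarrow> real" where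
  "L2_norm M u = sqrt (L2_inner M u u)"

definition QT :: "(real^3) set \<Rightarrow> real \<Rightarrow> ((real^3) \<times> real) set" where
  "QT \<Omega> T = \<Omega> \<times> {0<..<T}"

text \<open>Class \<open>C\<^sup>k\<close> on the whole space, by recursion on partial derivatives.\<close>

fun Ck :: "nat \<Rightarrow> ('a::euclidean_space \<Rightarrow> 'b::real_normed_vector) \<Rightarrow> bool" where
  "Ck 0 f \<longleftrightarrow> continuous_on UNIV f"
| "Ck (Suc k) f \<longleftrightarrow> f differentiable_on UNIV \<and>
     (\<forall>b\<in>Basis. Ck k (\<lambda>x. frechet_derivative f (at x) b))"

text \<open>\<open>C\<^sub>c\<^sup>\<infinity>(S)\<^sup>3\<close>, each element being extended by zero outside \<open>S\<close>.\<close>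

definition test_fields :: "'a::euclidean_space set \<Rightarrow> ('a \<Rightarrow> real^3) set" where
  "test_fields S = {\<phi>. (\<forall>k. Ck k \<phi>) \<and>
     compact (closure {x. \<phi> x \<noteq> 0}) \<and> closure {x. \<phi> x \<noteq> 0} \<subseteq> S}"

definition partial :: "3 \<Rightarrow> (real^3 \<Rightarrow> real^3) \<Rightarrow> real^3 \<Rightarrow> real^3" where
  "partial i \<phi> x = frechet_derivative \<phi> (at x) (axis i 1)"

definition curl :: "(real^3 \<Rightarrow> real^3) \<Rightarrow> real^3 \<Rightarrow> real^3" where
  "curl \<phi> x = vector
     [partial 2 \<phi> x $ 3 - partial 3 \<phi> x $ 2,
      partial 3 \<phi> x $ 1 - partial 1 \<phi> x $ 3,
      partial 1 \<phi> x $ 2 - partial 2 \<phi> x $ 1]"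

definition has_weak_curl :: "(real^3) set \<Rightarrow> (real^3 \<Rightarrow> real^3) \<Rightarrow> (real^3 \<Rightarrow> real^3) \<Rightarrow> bool" where
  "has_weak_curl \<Omega> u F \<longleftrightarrow> F \<in> L2 (lebesgue_on \<Omega>) \<and>
     (\<forall>\<phi>\<in>test_fields \<Omega>.
        (\<integral>x. u x \<bullet> curl \<phi> x \<partial>lebesgue_on \<Omega>) = (\<integral>x. F x \<bullet> \<phi> x \<partial>lebesgue_on \<Omega>))"

definition V :: "(real^3) set \<Rightarrow> (real^3 \<Rightarrow> real^3) set" where
  "V \<Omega> = {u \<in> L2 (lebesgue_on \<Omega>). \<exists>F. has_weak_curl \<Omega> u F}"

text \<open>Meaningful only on \<^term>\<open>V \<Omega>\<close>, where it is determined up to a null set.\<close>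

definition weak_curl :: "(real^3) set \<Rightarrow> (real^3 \<Rightarrow> real^3) \<Rightarrow> real^3 \<Rightarrow> real^3" where
  "weak_curl \<Omega> u = (SOME F. has_weak_curl \<Omega> u F)"

definition V_inner :: "(real^3) set \<Rightarrow> (real^3 \<Rightarrow> real^3) \<Rightarrow> (real^3 \<Rightarrow> real^3) \<Rightarrow> real" where
  "V_inner \<Omega> u v =
     (\<integral>x. u x \<bullet> v x + weak_curl \<Omega> u x \<bullet> weak_curl \<Omega> v x \<partial>lebesgue_on \<Omega>)"

definition V_norm :: "(real^3) set \<Rightarrow> (real^3 \<Rightarrow> real^3) \<Rightarrow> real" where
  "V_norm \<Omega> u = sqrt (V_inner \<Omega> u u)"

definition V0 :: "(real^3) set \<Rightarrow> (real^3 \<Rightarrow> real^3) set" where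
  "V0 \<Omega> = {u \<in> V \<Omega>. \<forall>\<psi>\<in>V \<Omega>.
     (\<integral>x. weak_curl \<Omega> u x \<bullet> \<psi> x \<partial>lebesgue_on \<Omega>)
       = (\<integral>x. u x \<bullet> weak_curl \<Omega> \<psi> x \<partial>lebesgue_on \<Omega>)}"

definition simple_curve :: "real \<Rightarrow> (real^3 \<Rightarrow> real^3) set \<Rightarrow> (real \<Rightarrow> real^3 \<Rightarrow> real^3) \<Rightarrow> bool" where
  "simple_curve T W s \<longleftrightarrow> finite (s ` {0<..<T}) \<and> s ` {0<..<T} \<subseteq> W \<and>
     (\<forall>w. {t\<in>{0<..<T}. s t = w} \<in> sets lebesgue)"

text \<open>
  The Bochner space \<open>L\<^sup>2(0,T;W)\<close> for a space \<open>W\<close> of fields with (semi)norm \<open>N\<close>: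
  strongly measurable, i.e. almost everywhere a limit of simple functions, with
  square-integrable norm.
\<close>

definition bochner_L2 ::
  "real \<Rightarrow> (real^3 \<Rightarrow> real^3) set \<Rightarrow> ((real^3 \<Rightarrow> real^3) \<Rightarrow> real) \<Rightarrow> (real \<Rightarrow> real^3 \<Rightarrow> real^3) set" where
  "bochner_L2 T W N = {u.
     (AE t in lebesgue_on {0<..<T}. u t \<in> W) \<and>
     (\<exists>s. (\<forall>n::nat. simple_curve T W (s n)) \<and>
          (AE t in lebesgue_on {0<..<T}. (\<lambda>n. N (\<lambda>x. s n t x - u t x)) \<longlonglongrightarrow> 0)) \<and>
     integrable (lebesgue_on {0<..<T}) (\<lambda>t. (N (u t))\<^sup>2)}"

definition C_H :: "(real^3) set \<Rightarrow> real \<Rightarrow> (real \<Rightarrow> real^3 \<Rightarrow> real^3) set" where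
  "C_H \<Omega> T = {u.
     (\<forall>t\<in>{0..T}. u t \<in> L2 (lebesgue_on \<Omega>)) \<and>
     (\<forall>t\<in>{0..T}.
        ((\<lambda>s. L2_norm (lebesgue_on \<Omega>) (\<lambda>x. u s x - u t x)) \<longlongrightarrow> 0) (at t within {0..T}))}"

text \<open>
  \<open>w\<close> lies in the class in \<open>L\<^sup>2(0,T;H)\<close> that is identified with \<open>u \<in> L\<^sup>2(Q\<^sub>T)\<^sup>3\<close>.
\<close>

definition represents ::
  "(real^3) set \<Rightarrow> real \<Rightarrow> (real \<Rightarrow> real^3 \<Rightarrow> real^3) \<Rightarrow> ((real^3) \<times> real \<Rightarrow> real^3) \<Rightarrow> bool" where
  "represents \<Omega> T w u \<longleftrightarrow>
     (AE t in lebesgue_on {0<..<T}. AE x in lebesgue_on \<Omega>. w t x = u (x, t))"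

definition has_time_derivative ::
  "(real^3) set \<Rightarrow> real \<Rightarrow> ((real^3) \<times> real \<Rightarrow> real^3) \<Rightarrow> ((real^3) \<times> real \<Rightarrow> real^3) \<Rightarrow> bool" where
  "has_time_derivative \<Omega> T u u' \<longleftrightarrow> u' \<in> L2 (lebesgue_on (QT \<Omega> T)) \<and>
     (\<forall>\<eta>\<in>test_fields (QT \<Omega> T).
        (\<integral>z. u z \<bullet> frechet_derivative \<eta> (at z) (0, 1) \<partial>lebesgue_on (QT \<Omega> T))
          = - (\<integral>z. u' z \<bullet> \<eta> z \<partial>lebesgue_on (QT \<Omega> T)))"

text \<open>
  \<open>\<Phi> \<in> L\<^sup>2(0,T;W)\<close> with \<open>\<partial>\<^sub>t\<Phi> \<in> L\<^sup>2(Q\<^sub>T)\<^sup>3\<close> and \<open>\<Phi>(T) = 0\<close>, where \<open>W\<close> is \<open>V\<close> or \<open>V\<^sub>0\<close>.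
  The remaining arguments are determined by \<open>\<Phi>\<close> up to null sets: \<open>D\<close> is \<open>\<partial>\<^sub>t\<Phi>\<close>, \<open>C\<close> is
  the element of \<open>L\<^sup>2(Q\<^sub>T)\<^sup>3\<close> identified with \<open>t \<mapsto> curl \<Phi>(t)\<close>, and \<open>P\<close> is the
  representative of \<open>\<Phi>\<close> in \<open>C([0,T];H)\<close>.
\<close>

definition admissible ::
  "(real^3) set \<Rightarrow> real \<Rightarrow> (real^3 \<Rightarrow> real^3) set \<Rightarrow> ((real^3) \<times> real \<Rightarrow> real^3) \<Rightarrow>
   ((real^3) \<times> real \<Rightarrow> real^3) \<Rightarrow> ((real^3) \<times> real \<Rightarrow> real^3) \<Rightarrow> (real \<Rightarrow> real^3 \<Rightarrow> real^3) \<Rightarrow> bool" where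
  "admissible \<Omega> T W \<Phi> D C P \<longleftrightarrow>
     \<Phi> \<in> L2 (lebesgue_on (QT \<Omega> T)) \<and>
     (\<lambda>t x. \<Phi> (x, t)) \<in> bochner_L2 T W (V_norm \<Omega>) \<and>
     has_time_derivative \<Omega> T \<Phi> D \<and>
     C \<in> L2 (lebesgue_on (QT \<Omega> T)) \<and>
     represents \<Omega> T (\<lambda>t. weak_curl \<Omega> (\<lambda>x. \<Phi> (x, t))) C \<and>
     P \<in> C_H \<Omega> T \<and> represents \<Omega> T P \<Phi> \<and>
     (AE x in lebesgue_on \<Omega>. P T x = 0)"

definition weak_solution ::
  "(real^3) set \<Rightarrow> real \<Rightarrow> (real^3 \<Rightarrow> real^3^3) \<Rightarrow> (real^3 \<Rightarrow> real^3^3) \<Rightarrow>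
   ((real^3) \<times> real \<Rightarrow> real^3 \<Rightarrow> real^3) \<Rightarrow> (real^3 \<Rightarrow> real^3) \<Rightarrow> (real^3 \<Rightarrow> real^3) \<Rightarrow>
   ((real^3) \<times> real \<Rightarrow> real^3) \<Rightarrow> ((real^3) \<times> real \<Rightarrow> real^3) \<Rightarrow> bool" where
  "weak_solution \<Omega> T \<epsilon> \<mu> j e\<^sub>0 h\<^sub>0 e h \<longleftrightarrow>
     e \<in> L2 (lebesgue_on (QT \<Omega> T)) \<and> h \<in> L2 (lebesgue_on (QT \<Omega> T)) \<and>
     (\<forall>\<Phi> D C P. admissible \<Omega> T (V0 \<Omega>) \<Phi> D C P \<longrightarrow>
        - (\<integral>z. (\<epsilon> (fst z) *v e z) \<bullet> D z \<partial>lebesgue_on (QT \<Omega> T))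
        + (\<integral>z. - (h z \<bullet> C z) + j z (e z) \<bullet> \<Phi> z \<partial>lebesgue_on (QT \<Omega> T))
        = (\<integral>x. (\<epsilon> x *v e\<^sub>0 x) \<bullet> P 0 x \<partial>lebesgue_on \<Omega>)) \<and>
     (\<forall>\<Psi> D C P. admissible \<Omega> T (V \<Omega>) \<Psi> D C P \<longrightarrow>
        - (\<integral>z. (\<mu> (fst z) *v h z) \<bullet> D z \<partial>lebesgue_on (QT \<Omega> T))
        + (\<integral>z. e z \<bullet> C z \<partial>lebesgue_on (QT \<Omega> T))
        = (\<integral>x. (\<mu> x *v h\<^sub>0 x) \<bullet> P 0 x \<partial>lebesgue_on \<Omega>))"

definition bounded_measurable_entries :: "(real^3) set \<Rightarrow> (real^3 \<Rightarrow> real^3^3) \<Rightarrow> bool" where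
  "bounded_measurable_entries \<Omega> A \<longleftrightarrow>
     (\<forall>i k. (\<lambda>x. A x $ i $ k) \<in> borel_measurable (lebesgue_on \<Omega>) \<and>
            bounded ((\<lambda>x. A x $ i $ k) ` \<Omega>))"

definition caratheodory ::
  "(real^3) set \<Rightarrow> real \<Rightarrow> ((real^3) \<times> real \<Rightarrow> real^3 \<Rightarrow> real^3) \<Rightarrow> bool" where
  "caratheodory \<Omega> T f \<longleftrightarrow>
     (\<forall>\<xi>. (\<lambda>z. f z \<xi>) \<in> borel_measurable (lebesgue_on (QT \<Omega> T))) \<and>
     (AE z in lebesgue_on (QT \<Omega> T). continuous_on UNIV (f z))"

end

theory Submission
  imports Defs
begin

text \<open>
  Write the system as \<open>M u' = A u - f\<close> for \<open>u = (e, h)\<close>, where \<open>M = (\<epsilon>, \<mu>)\<close> is symmetric and positive and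
  \<open>A (e, h) = (curl h, - curl e)\<close>, with \<open>e\<close> in \<open>V\<^sub>0\<close>, is skew-symmetric.  The energy \<open>(M u, u)\<close> of a
  differentiable solution then changes only through the current \<open>f\<close>.  A weak solution need not be
  differentiable in time, but its averages in time are, and they solve the averaged system.

  Both equations are tested with products \<open>\<phi>(x) \<eta>(t)\<close> only.  They involve the unknowns through
  the pairings \<open>e\<^sub>\<eta>(x) = \<integral> \<eta>(s) e(x, s) ds\<close>, and likewise \<open>h\<^sub>\<eta>\<close> and \<open>J\<^sub>\<eta>\<close> for the field \<open>J = j(e)\<close>.
  Suppose that \<open>\<eta>\<close> vanishes at \<open>0\<close> and \<open>T\<close>.  The second equation says that \<open>e\<^sub>\<eta>\<close> has the weak curl
  \<open>\<mu> h\<^bsub>\<eta>'\<^esub>\<close> and, since it holds for every field in \<open>V\<close>, that \<open>e\<^sub>\<eta>\<close> lies in \<open>V\<^sub>0\<close>.  So \<open>e\<^sub>\<eta>\<close> may be inserted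
  into the first equation, and the curl terms combine to the balance law
  \<open>(\<epsilon> e\<^bsub>\<eta>'\<^esub>, e\<^sub>\<eta>) + (\<mu> h\<^bsub>\<eta>'\<^esub>, h\<^sub>\<eta>) = (J\<^sub>\<eta>, e\<^sub>\<eta>)\<close>.

  Let \<open>\<eta>(s) = \<theta>(s - t)\<close> be a translated kernel.  The balance law expresses the derivative in \<open>t\<close> of
  the energy of \<open>(e\<^sub>\<eta>, h\<^sub>\<eta>)\<close> by \<open>(J\<^sub>\<eta>, e\<^sub>\<eta>)\<close>, so the supremum of this energy over an interval is bounded by
  the norms in \<open>L\<^sup>2\<close> of space-time of the mollifications of \<open>e\<close>, \<open>h\<close>, \<open>J\<close> with \<open>\<theta>\<close> (\<open>energy_estimate\<close>).
  For the difference \<open>\<theta>\<close> of two kernels of an approximate identity these norms are small, because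
  mollifications converge in \<open>L\<^sup>2\<close> (\<open>mollify_converges\<close>).  Hence the mollified fields form a uniform
  Cauchy sequence of continuous curves in \<open>H\<close>, and their limit is the continuous representative
  (\<open>continuous_representative\<close>).  Kernels that look forward in time serve on \<open>[0, 2T/3]\<close>,
  kernels that look backward on \<open>[T/3, T]\<close>, and a partition of unity joins the two
  (\<open>continuous_solution\<close>).

  For the initial values the weak equations are tested with \<open>\<phi>(x) \<eta>\<^sub>n(t)\<close>, where \<open>\<eta>\<^sub>n\<close> falls from \<open>1\<close> to
  \<open>0\<close> within a short time and \<open>- \<eta>\<^sub>n'\<close> is the forward kernel.  The first term is then the forward
  mollification at time \<open>0\<close>, the right-hand side contains the initial datum, and the other terms tend
  to \<open>0\<close>.  As test fields are dense (\<open>L2_orthogonal_test_fields\<close>), the representatives take the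
  prescribed initial values (\<open>initial_value\<close>).
\<close>


section \<open>Square-integrable fields\<close>

lemma L2D: "u \<in> L2 M \<Longrightarrow> u \<in> borel_measurable M" "u \<in> L2 M \<Longrightarrow> integrable M (\<lambda>x. (norm (u x))\<^sup>2)"
  by (auto simp: L2_def)

lemma L2_bound:
  assumes "u \<in> borel_measurable M" "integrable M g" "AE x in M. (norm (u x))\<^sup>2 \<le> g x"
  shows "u \<in> L2 M"
proof -
  have "integrable M (\<lambda>x. (norm (u x))\<^sup>2)"
    by (rule Bochner_Integration.integrable_bound[OF assms(2)])
      (use assms in \<open>auto elim!: eventually_mono\<close>)
  with assms show ?thesis by (simp add: L2_def)
qed

lemma norm_add_sq_le: "(norm (a + b :: 'a::real_normed_vector))\<^sup>2 \<le> 2 * (norm a)\<^sup>2 + 2 * (norm b)\<^sup>2"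
proof -
  have "(norm (a + b))\<^sup>2 \<le> (norm a + norm b)\<^sup>2"
    by (simp add: norm_triangle_ineq power_mono)
  also have "\<dots> \<le> 2 * (norm a)\<^sup>2 + 2 * (norm b)\<^sup>2"
    using sum_squares_bound[of "norm a" "norm b"] by (simp add: power2_sum)
  finally show ?thesis .
qed

lemma L2_add: "u \<in> L2 M \<Longrightarrow> v \<in> L2 M \<Longrightarrow> (\<lambda>x. u x + v x) \<in> L2 M"
  by (rule L2_bound[where g="\<lambda>x. 2 * (norm (u x))\<^sup>2 + 2 * (norm (v x))\<^sup>2"])
    (auto simp: L2_def norm_add_sq_le)

lemma L2_scaleR: "u \<in> L2 M \<Longrightarrow> (\<lambda>x. c *\<^sub>R u x) \<in> L2 M"
  by (auto simp: L2_def power_mult_distrib)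

lemma L2_diff: "u \<in> L2 M \<Longrightarrow> v \<in> L2 M \<Longrightarrow> (\<lambda>x. u x - v x) \<in> L2 M"
  using L2_add[of u M "\<lambda>x. (-1) *\<^sub>R v x"] L2_scaleR[of v M "-1"] by simp

lemma L2_zero: "(\<lambda>x. 0) \<in> L2 M"
  by (simp add: L2_def)

lemma L2_inner_integrable:
  assumes "u \<in> L2 M" "v \<in> L2 M"
  shows "integrable M (\<lambda>x. u x \<bullet> v x)"
proof (rule Bochner_Integration.integrable_bound)
  show "integrable M (\<lambda>x. (norm (u x))\<^sup>2 + (norm (v x))\<^sup>2)"
    using assms by (auto simp: L2_def)
  show "AE x in M. norm (u x \<bullet> v x) \<le> norm ((norm (u x))\<^sup>2 + (norm (v x))\<^sup>2)"
  proof (rule AE_I2)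
    fix x
    have "\<bar>u x \<bullet> v x\<bar> \<le> norm (u x) * norm (v x)" by (rule Cauchy_Schwarz_ineq2)
    also have "\<dots> \<le> (norm (u x))\<^sup>2 + (norm (v x))\<^sup>2"
      using sum_squares_bound[of "norm (u x)" "norm (v x)"] zero_le_power2[of "norm (u x)"] zero_le_power2[of "norm (v x)"]
      by linarith
    finally show "norm (u x \<bullet> v x) \<le> norm ((norm (u x))\<^sup>2 + (norm (v x))\<^sup>2)" by simp
  qed
qed (use assms in \<open>auto simp: L2_def\<close>)

lemma L2_inner_add_left:
  "u \<in> L2 M \<Longrightarrow> v \<in> L2 M \<Longrightarrow> w \<in> L2 M \<Longrightarrow>
    L2_inner M (\<lambda>x. u x + v x) w = L2_inner M u w + L2_inner M v w"
  by (simp add: L2_inner_def inner_add_left L2_inner_integrable)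

lemma L2_inner_diff_left:
  "u \<in> L2 M \<Longrightarrow> v \<in> L2 M \<Longrightarrow> w \<in> L2 M \<Longrightarrow>
    L2_inner M (\<lambda>x. u x - v x) w = L2_inner M u w - L2_inner M v w"
  by (simp add: L2_inner_def inner_diff_left L2_inner_integrable)

lemma L2_inner_scaleR_left: "L2_inner M (\<lambda>x. c *\<^sub>R u x) w = c * L2_inner M u w"
  by (simp add: L2_inner_def)

lemma L2_inner_commute: "L2_inner M u v = L2_inner M v u"
  by (simp add: L2_inner_def inner_commute)

lemma L2_inner_cong_AE:
  assumes "u \<in> L2 M" "u' \<in> L2 M" "v \<in> L2 M" "v' \<in> L2 M"
    and "AE x in M. u x = u' x" "AE x in M. v x = v' x"
  shows "L2_inner M u v = L2_inner M u' v'"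
  unfolding L2_inner_def
  by (rule integral_cong_AE) (use assms in \<open>auto simp: L2_def\<close>)

lemma L2_inner_self: "L2_inner M u u = (\<integral>x. (norm (u x))\<^sup>2 \<partial>M)"
  by (simp add: L2_inner_def power2_norm_eq_inner)

lemma L2_norm_nonneg [simp]: "0 \<le> L2_norm M u"
  by (simp add: L2_norm_def L2_inner_self)

lemma L2_norm_sq: "(L2_norm M u)\<^sup>2 = (\<integral>x. (norm (u x))\<^sup>2 \<partial>M)"
  by (simp add: L2_norm_def L2_inner_self)

lemma L2_norm_cong_AE:
  assumes "u \<in> L2 M" "u' \<in> L2 M" and "AE x in M. u x = u' x"
  shows "L2_norm M u = L2_norm M u'"
  unfolding L2_norm_def using L2_inner_cong_AE[of u M u' u u'] assms by simp

lemma L2_norm_scaleR: "L2_norm M (\<lambda>x. c *\<^sub>R u x) = \<bar>c\<bar> * L2_norm M u"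
  unfolding L2_norm_def L2_inner_self by (simp add: power_mult_distrib real_sqrt_mult)

lemma L2_norm_minus_commute: "L2_norm M (\<lambda>x. u x - v x) = L2_norm M (\<lambda>x. v x - u x)"
  unfolding L2_norm_def L2_inner_self by (simp add: norm_minus_commute)

lemma L2_Cauchy_Schwarz:
  assumes u: "u \<in> L2 M" and v: "v \<in> L2 M"
  shows "\<bar>L2_inner M u v\<bar> \<le> L2_norm M u * L2_norm M v"
proof -
  let ?a = "L2_inner M u u" and ?b = "L2_inner M u v" and ?c = "L2_inner M v v"
  have quad: "0 \<le> ?a - 2 * t * ?b + t\<^sup>2 * ?c" for t
  proof -
    have "0 \<le> (\<integral>x. (norm (u x - t *\<^sub>R v x))\<^sup>2 \<partial>M)" by simp
    also have "\<dots> = (\<integral>x. u x \<bullet> u x - (2 * t) * (u x \<bullet> v x) + t\<^sup>2 * (v x \<bullet> v x) \<partial>M)"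
      unfolding power2_norm_eq_inner inner_diff_left inner_diff_right
      by (simp add: inner_commute power2_eq_square algebra_simps)
    also have "\<dots> = ?a - 2 * t * ?b + t\<^sup>2 * ?c"
      using L2_inner_integrable[OF u u] L2_inner_integrable[OF u v] L2_inner_integrable[OF v v]
      by (simp add: L2_inner_def)
    finally show ?thesis .
  qed
  have nn: "0 \<le> ?a" "0 \<le> ?c" by (simp_all add: L2_inner_self)
  have "?b\<^sup>2 \<le> ?a * ?c"
  proof (cases "?c = 0")
    case True
    have "?b = 0"
    proof (rule ccontr)
      assume "?b \<noteq> 0"
      with quad[of "(?a + 1) / (2 * ?b)"] True show False by (simp add: field_simps)
    qed
    with nn True show ?thesis by simp
  next
    case False
    with nn have "0 < ?c" by simp
    with quad[of "?b / ?c"] show ?thesis by (simp add: field_simps power2_eq_square)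
  qed
  then have "sqrt (?b\<^sup>2) \<le> sqrt (?a * ?c)" by (rule real_sqrt_le_mono)
  then show ?thesis by (simp add: L2_norm_def real_sqrt_mult)
qed

lemma L2_norm_triangle:
  assumes u: "u \<in> L2 M" and v: "v \<in> L2 M"
  shows "L2_norm M (\<lambda>x. u x + v x) \<le> L2_norm M u + L2_norm M v"
proof (rule power2_le_imp_le)
  have "(L2_norm M (\<lambda>x. u x + v x))\<^sup>2 = (\<integral>x. (norm (u x))\<^sup>2 + 2 * (u x \<bullet> v x) + (norm (v x))\<^sup>2 \<partial>M)"
    unfolding L2_norm_sq by (simp add: power2_norm_eq_inner inner_add inner_commute algebra_simps)
  also have "\<dots> = (L2_norm M u)\<^sup>2 + 2 * L2_inner M u v + (L2_norm M v)\<^sup>2"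
    using assms L2_inner_integrable[OF assms] by (simp add: L2_norm_sq L2_inner_def L2_def)
  also have "\<dots> \<le> (L2_norm M u)\<^sup>2 + 2 * (L2_norm M u * L2_norm M v) + (L2_norm M v)\<^sup>2"
    using L2_Cauchy_Schwarz[OF assms] by linarith
  also have "\<dots> = (L2_norm M u + L2_norm M v)\<^sup>2" by (simp add: power2_sum)
  finally show "(L2_norm M (\<lambda>x. u x + v x))\<^sup>2 \<le> (L2_norm M u + L2_norm M v)\<^sup>2" .
qed simp

lemma L2_norm_triangle_diff:
  assumes u: "u \<in> L2 M" and v: "v \<in> L2 M" and w: "w \<in> L2 M"
  shows "L2_norm M (\<lambda>x. u x - w x) \<le> L2_norm M (\<lambda>x. u x - v x) + L2_norm M (\<lambda>x. v x - w x)"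
  using L2_norm_triangle[OF L2_diff[OF u v] L2_diff[OF v w]] by simp

lemma L2_norm_le_add_diff:
  assumes u: "u \<in> L2 M" and v: "v \<in> L2 M"
  shows "L2_norm M u \<le> L2_norm M v + L2_norm M (\<lambda>x. u x - v x)"
  using L2_norm_triangle[OF v L2_diff[OF u v]] by simp

lemma nn_integral_eq_L2_norm:
  assumes "u \<in> L2 M"
  shows "(\<integral>\<^sup>+x. ennreal ((norm (u x))\<^sup>2) \<partial>M) = ennreal ((L2_norm M u)\<^sup>2)"
  using assms by (simp add: L2_norm_sq L2_def nn_integral_eq_integral)

lemma L2_norm_le_of_nn_integral:
  assumes u: "u \<in> borel_measurable M" and le: "(\<integral>\<^sup>+x. ennreal ((norm (u x))\<^sup>2) \<partial>M) \<le> ennreal c" and c: "0 \<le> c"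
  shows "u \<in> L2 M" "(L2_norm M u)\<^sup>2 \<le> c"
proof -
  have "integrable M (\<lambda>x. (norm (u x))\<^sup>2)"
    by (rule integrableI_bounded) (use u le in \<open>auto intro: order.strict_trans1\<close>)
  then show "u \<in> L2 M" using u by (simp add: L2_def)
  from nn_integral_eq_L2_norm[OF this] le show "(L2_norm M u)\<^sup>2 \<le> c" using c by simp
qed

section \<open>Completeness\<close>

text \<open>
  This map carries square-integrable fields to integrable ones, and the two inequalities below bound
  it and its inverse.  Continuity of translation and completeness pass along it from \<open>L\<^sup>1\<close> to \<open>L\<^sup>2\<close>.
\<close>

definition sq_map :: "'a::real_inner \<Rightarrow> 'a" where "sq_map v = norm v *\<^sub>R v"

lemma norm_sq_map [simp]: "norm (sq_map v) = (norm v)\<^sup>2"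
  by (simp add: sq_map_def power2_eq_square)

lemma sq_map_measurable [measurable]: "sq_map \<in> borel_measurable (borel :: 'a::{euclidean_space} measure)"
  unfolding sq_map_def by measurable

text \<open>
  Strong monotonicity of the gradient of \<open>v \<mapsto> |v|\<^sup>3 / 3\<close>: the inner product of
  \<open>sq_map v - sq_map w\<close> with \<open>v - w\<close> is at least \<open>(|v| + |w|) / 2\<close> times \<open>|v - w|\<^sup>2\<close>, and
  \<open>|v| + |w| \<ge> |v - w|\<close>.
\<close>

lemma norm_diff_sq_le_sq_map: "(norm (v - w))\<^sup>2 \<le> 2 * norm (sq_map v - sq_map w)"
proof (cases "v = w")
  case False
  let ?a = "norm v" and ?b = "norm w" and ?p = "v \<bullet> w"
  have "(sq_map v - sq_map w) \<bullet> (v - w) = ?a^3 + ?b^3 - (?a + ?b) * ?p"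
    by (simp add: sq_map_def inner_diff inner_commute power2_norm_eq_inner[symmetric] power2_eq_square power3_eq_cube algebra_simps)

  also have "\<dots> = (?a + ?b) / 2 * (norm (v - w))\<^sup>2 + (?a + ?b) / 2 * (?a - ?b)\<^sup>2"
    by (simp add: power2_norm_eq_inner inner_diff inner_commute)
      (simp add: power2_norm_eq_inner[symmetric] power2_eq_square power3_eq_cube field_simps)
  finally have "(?a + ?b) / 2 * (norm (v - w))\<^sup>2 \<le> (sq_map v - sq_map w) \<bullet> (v - w)" by simp
  also have "\<dots> \<le> norm (sq_map v - sq_map w) * norm (v - w)" by (rule norm_cauchy_schwarz)
  finally have "(?a + ?b) / 2 * (norm (v - w))\<^sup>2 \<le> norm (sq_map v - sq_map w) * norm (v - w)" .
  then have "((?a + ?b) * norm (v - w)) * norm (v - w) \<le> (2 * norm (sq_map v - sq_map w)) * norm (v - w)"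
    by (simp add: power2_eq_square algebra_simps)
  then have "(?a + ?b) * norm (v - w) \<le> 2 * norm (sq_map v - sq_map w)"
    using False by (simp only: mult_le_cancel_right) auto
  moreover have "norm (v - w) * norm (v - w) \<le> (?a + ?b) * norm (v - w)"
    by (intro mult_right_mono norm_triangle_ineq4) auto
  ultimately show ?thesis by (simp add: power2_eq_square)
qed simp

lemma norm_sq_map_diff_le: "norm (sq_map v - sq_map w) \<le> (norm v + norm w) * norm (v - w)"
proof -
  have "sq_map v - sq_map w = norm v *\<^sub>R (v - w) + (norm v - norm w) *\<^sub>R w"
    by (simp add: sq_map_def algebra_simps)
  also have "norm \<dots> \<le> norm v * norm (v - w) + \<bar>norm v - norm w\<bar> * norm w"
    by (rule order_trans[OF norm_triangle_ineq]) simp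
  also have "\<dots> \<le> norm v * norm (v - w) + norm (v - w) * norm w"
    by (intro add_left_mono mult_right_mono norm_triangle_ineq3) auto
  finally show ?thesis by (simp add: algebra_simps)
qed

lemma integrable_sq_map: "u \<in> L2 M \<Longrightarrow> integrable M (\<lambda>x. sq_map (u x))"
  by (rule Bochner_Integration.integrable_bound[where f="\<lambda>x. (norm (u x))\<^sup>2"]) (auto simp: L2_def)

lemma L2_real_product:
  assumes "u \<in> L2 M" "v \<in> L2 M"
  shows "integrable M (\<lambda>x. norm (u x) * norm (v x))"
    and "(\<integral>x. norm (u x) * norm (v x) \<partial>M) \<le> L2_norm M u * L2_norm M v"
proof -
  \<comment> \<open>apply the vector-valued inequality to the fields pointing in a fixed direction\<close>
  let ?b = "axis 1 1 :: real^3"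
  have U: "(\<lambda>x. norm (u x) *\<^sub>R ?b) \<in> L2 M" "(\<lambda>x. norm (v x) *\<^sub>R ?b) \<in> L2 M"
    using assms by (auto simp: L2_def)
  have b: "?b \<bullet> ?b = 1" by (simp add: inner_axis_axis)
  show "integrable M (\<lambda>x. norm (u x) * norm (v x))"
    using L2_inner_integrable[OF U] by (simp add: b mult.commute)
  have "L2_norm M (\<lambda>x. norm (u x) *\<^sub>R ?b) = L2_norm M u" "L2_norm M (\<lambda>x. norm (v x) *\<^sub>R ?b) = L2_norm M v"
    unfolding L2_norm_def L2_inner_self by simp_all
  with L2_Cauchy_Schwarz[OF U] show "(\<integral>x. norm (u x) * norm (v x) \<partial>M) \<le> L2_norm M u * L2_norm M v"
    by (simp add: L2_inner_def b mult.commute)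
qed

text \<open>
  By \<open>sq_map\<close> the sequence becomes a Cauchy sequence in \<open>L\<^sup>1\<close>, which has a subsequence that converges
  almost everywhere; Fatou's lemma shows that its limit is the limit in \<open>L\<^sup>2\<close>.
\<close>

lemma L2_complete:
  fixes u :: "nat \<Rightarrow> 'a \<Rightarrow> real^3"
  assumes u: "\<And>n. u n \<in> L2 M"
    and Cauchy: "\<And>e. e > 0 \<Longrightarrow> \<exists>N. \<forall>m\<ge>N. \<forall>n\<ge>N. L2_norm M (\<lambda>x. u m x - u n x) < e"
  obtains w where "w \<in> L2 M" "(\<lambda>n. L2_norm M (\<lambda>x. u n x - w x)) \<longlonglongrightarrow> 0"
proof -
  have [measurable]: "u n \<in> borel_measurable M" for n using u by (auto simp: L2_def)
  obtain N1 where N1: "\<And>m n. m \<ge> N1 \<Longrightarrow> n \<ge> N1 \<Longrightarrow> L2_norm M (\<lambda>x. u m x - u n x) < 1"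
    using Cauchy[of 1] by auto
  define B where "B = L2_norm M (u N1) + 1"
  have B: "L2_norm M (u n) \<le> B" if "n \<ge> N1" for n
    using L2_norm_le_add_diff[OF u u, of n N1] N1[OF that order_refl] by (simp add: B_def)
  have Bpos: "B > 0" by (simp add: B_def add_nonneg_pos)
  have "\<exists>N. \<forall>i\<ge>N. \<forall>j\<ge>N. (LINT x|M. norm (sq_map (u i x) - sq_map (u j x))) < e" if "e > 0" for e
  proof -
    obtain N where N: "\<And>m n. m \<ge> N \<Longrightarrow> n \<ge> N \<Longrightarrow> L2_norm M (\<lambda>x. u m x - u n x) < e / (2 * B)"
      using Cauchy[of "e / (2 * B)"] \<open>e > 0\<close> Bpos by auto
    have "(LINT x|M. norm (sq_map (u i x) - sq_map (u j x))) < e" if ij: "i \<ge> max N N1" "j \<ge> max N N1" for i j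
    proof -
      let ?d = "\<lambda>x. u i x - u j x"
      have d: "?d \<in> L2 M" by (intro L2_diff u)
      have "(LINT x|M. norm (sq_map (u i x) - sq_map (u j x)))
          \<le> (LINT x|M. norm (u i x) * norm (?d x) + norm (u j x) * norm (?d x))"
        by (intro integral_mono integrable_norm Bochner_Integration.integrable_diff integrable_sq_map u
            Bochner_Integration.integrable_add L2_real_product d order_trans[OF norm_sq_map_diff_le])
          (simp add: algebra_simps)
      also have "\<dots> \<le> L2_norm M (u i) * L2_norm M ?d + L2_norm M (u j) * L2_norm M ?d"
        using L2_real_product[OF u d, of i] L2_real_product[OF u d, of j] by simp
      also have "\<dots> \<le> B * L2_norm M ?d + B * L2_norm M ?d"
        using B[of i] B[of j] ij by (intro add_mono mult_right_mono) auto
      also have "\<dots> < e" using N[of i j] ij Bpos by (simp add: field_simps)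
      finally show ?thesis .
    qed
    then show ?thesis by blast
  qed
  from cauchy_L1_AE_cauchy_subseq[OF integrable_sq_map[OF u] this]
  obtain r where r: "strict_mono r" and AE: "AE x in M. Cauchy (\<lambda>i. sq_map (u (r i) x))" by blast
  define w where "w x = lim (\<lambda>i. u (r i) x)" for x
  have w_meas [measurable]: "w \<in> borel_measurable M" unfolding w_def by measurable
  have lim: "AE x in M. (\<lambda>i. u (r i) x) \<longlonglongrightarrow> w x"
    using AE
  proof eventually_elim
    case (elim x)
    have "Cauchy (\<lambda>i. u (r i) x)"
    proof (rule CauchyI)
      fix e :: real assume "e > 0"
      then obtain N where "\<And>m n. m \<ge> N \<Longrightarrow> n \<ge> N \<Longrightarrow> norm (sq_map (u (r m) x) - sq_map (u (r n) x)) < e\<^sup>2 / 2"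
        using CauchyD[OF elim, of "e\<^sup>2 / 2"] by auto
      then have "(norm (u (r m) x - u (r n) x))\<^sup>2 < e\<^sup>2" if "m \<ge> N" "n \<ge> N" for m n
        using norm_diff_sq_le_sq_map[of "u (r m) x" "u (r n) x"] that by fastforce
      then have "norm (u (r m) x - u (r n) x) < e" if "m \<ge> N" "n \<ge> N" for m n
        using \<open>e > 0\<close> that by (meson less_imp_le power2_less_imp_less)
      then show "\<exists>N. \<forall>m\<ge>N. \<forall>n\<ge>N. norm (u (r m) x - u (r n) x) < e" by blast
    qed
    then show ?case unfolding w_def by (simp add: Cauchy_convergent_iff convergent_LIMSEQ_iff)
  qed
  have key: "(\<integral>\<^sup>+x. ennreal ((norm (u n x - w x))\<^sup>2) \<partial>M) \<le> ennreal (e\<^sup>2)"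
    if e: "e > 0" and N: "\<And>i. i \<ge> N \<Longrightarrow> L2_norm M (\<lambda>x. u n x - u i x) < e" for n N and e :: real
  proof -
    have "(\<integral>\<^sup>+x. ennreal ((norm (u n x - w x))\<^sup>2) \<partial>M)
        = (\<integral>\<^sup>+x. liminf (\<lambda>i. ennreal ((norm (u n x - u (r i) x))\<^sup>2)) \<partial>M)"
    proof (rule nn_integral_cong_AE, use lim in eventually_elim)
      case (elim x)
      have "(\<lambda>i. ennreal ((norm (u n x - u (r i) x))\<^sup>2)) \<longlonglongrightarrow> ennreal ((norm (u n x - w x))\<^sup>2)"
        by (intro tendsto_intros tendsto_ennrealI elim)
      from lim_imp_Liminf[OF sequentially_bot this] show ?case by simp
    qed
    also have "\<dots> \<le> liminf (\<lambda>i. \<integral>\<^sup>+x. ennreal ((norm (u n x - u (r i) x))\<^sup>2) \<partial>M)"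
      by (rule nn_integral_liminf) measurable
    also have "\<dots> \<le> liminf (\<lambda>i. ennreal (e\<^sup>2))"
    proof (intro Liminf_mono eventually_sequentiallyI[of N])
      fix i assume "N \<le> i"
      then have "r i \<ge> N" using strict_mono_imp_increasing[OF r, of i] by linarith
      then have "(L2_norm M (\<lambda>x. u n x - u (r i) x))\<^sup>2 \<le> e\<^sup>2"
        using N[of "r i"] by (intro power_mono) auto
      then show "(\<integral>\<^sup>+x. ennreal ((norm (u n x - u (r i) x))\<^sup>2) \<partial>M) \<le> ennreal (e\<^sup>2)"
        by (subst nn_integral_eq_L2_norm) (auto intro: L2_diff u ennreal_leI)
    qed
    finally show ?thesis by (simp add: Liminf_const)
  qed
  have diff: "\<exists>N. \<forall>n\<ge>N. (\<lambda>x. u n x - w x) \<in> L2 M \<and> L2_norm M (\<lambda>x. u n x - w x) \<le> e" if "e > 0" for e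
  proof -
    obtain N where N: "\<And>m n. m \<ge> N \<Longrightarrow> n \<ge> N \<Longrightarrow> L2_norm M (\<lambda>x. u m x - u n x) < e"
      using Cauchy[OF \<open>e > 0\<close>] by auto
    have "(\<lambda>x. u n x - w x) \<in> L2 M \<and> L2_norm M (\<lambda>x. u n x - w x) \<le> e" if "n \<ge> N" for n
    proof -
      have k: "(\<integral>\<^sup>+x. ennreal ((norm (u n x - w x))\<^sup>2) \<partial>M) \<le> ennreal (e\<^sup>2)"
        by (rule key[OF \<open>e > 0\<close>, of N]) (use N that in auto)
      from L2_norm_le_of_nn_integral[OF _ this] show ?thesis
        using \<open>e > 0\<close> by (auto intro: power2_le_imp_le)
    qed
    then show ?thesis by blast
  qed
  from diff[of 1] obtain n where "(\<lambda>x. u n x - w x) \<in> L2 M" by auto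
  from L2_diff[OF u[of n] this] have w: "w \<in> L2 M" by simp
  have "(\<lambda>n. L2_norm M (\<lambda>x. u n x - w x)) \<longlonglongrightarrow> 0"
  proof (rule LIMSEQ_I)
    fix e :: real assume "e > 0"
    with diff[of "e/2"] obtain N where "\<forall>n\<ge>N. L2_norm M (\<lambda>x. u n x - w x) \<le> e / 2" by auto
    with \<open>e > 0\<close> show "\<exists>N. \<forall>n\<ge>N. norm (L2_norm M (\<lambda>x. u n x - w x) - 0) < e"
      by (intro exI[of _ N]) (auto intro: order.strict_trans1)
  qed
  with w that show ?thesis by blast
qed

section \<open>Continuity of translation\<close>

lemma nn_integral_translate:
  fixes h :: "'a::euclidean_space"
  assumes [measurable]: "f \<in> borel_measurable borel"
  shows "(\<integral>\<^sup>+z. f (z + h) \<partial>lborel) = (\<integral>\<^sup>+z. f z \<partial>lborel)"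
proof -
  have "(\<integral>\<^sup>+z. f z \<partial>lborel) = (\<integral>\<^sup>+z. f z \<partial>distr lborel borel ((+) h))"
    by (simp add: lborel_distr_plus)
  also have "\<dots> = (\<integral>\<^sup>+z. f (z + h) \<partial>lborel)"
    by (subst nn_integral_distr) (simp_all add: add.commute)
  finally show ?thesis by simp
qed

lemma
  fixes f :: "'a::euclidean_space \<Rightarrow> 'b::{banach, second_countable_topology}"
  assumes "integrable lborel f"
  shows integrable_translate: "integrable lborel (\<lambda>z. f (z + h))"
    and integral_translate: "(\<integral>z. f (z + h) \<partial>lborel) = (\<integral>z. f z \<partial>lborel)"
proof -
  have f: "f \<in> borel_measurable borel" using borel_measurable_integrable[OF assms] by simp
  have "integrable (distr lborel borel ((+) h)) f" using assms by (simp add: lborel_distr_plus)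
  then show "integrable lborel (\<lambda>z. f (z + h))"
    by (subst (asm) integrable_distr_eq) (use f in \<open>simp_all add: add.commute\<close>)
  have "(\<integral>z. f z \<partial>lborel) = (\<integral>z. f z \<partial>distr lborel borel ((+) h))" by (simp add: lborel_distr_plus)
  also have "\<dots> = (\<integral>z. f (z + h) \<partial>lborel)"
    by (subst integral_distr) (use f in \<open>simp_all add: add.commute\<close>)
  finally show "(\<integral>z. f (z + h) \<partial>lborel) = (\<integral>z. f z \<partial>lborel)" by simp
qed

lemma translation_diff_triangle:
  fixes f g :: "'a::euclidean_space \<Rightarrow> 'b::{banach, second_countable_topology}"
  assumes f: "integrable lborel f" and g: "integrable lborel g"
  shows "(\<integral>z. norm (f (z + h) - f z) \<partial>lborel)
    \<le> (\<integral>z. norm (g (z + h) - g z) \<partial>lborel) + 2 * (\<integral>z. norm (f z - g z) \<partial>lborel)"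
proof -
  have d: "integrable lborel (\<lambda>z. norm (f z - g z))" using f g by simp
  note i = integrable_translate[OF f, of h] integrable_translate[OF g, of h] integrable_translate[OF d, of h]
  have "(\<integral>z. norm (f (z + h) - f z) \<partial>lborel)
    \<le> (\<integral>z. norm (g (z + h) - g z) + (norm (f (z + h) - g (z + h)) + norm (f z - g z)) \<partial>lborel)"
  proof (intro integral_mono)
    fix z
    have "f (z + h) - f z = (g (z + h) - g z) + ((f (z + h) - g (z + h)) - (f z - g z))" by simp
    then show "norm (f (z + h) - f z) \<le> norm (g (z + h) - g z) + (norm (f (z + h) - g (z + h)) + norm (f z - g z))"
      using norm_triangle_ineq[of "g (z + h) - g z" "(f (z + h) - g (z + h)) - (f z - g z)"]
        norm_triangle_ineq4[of "f (z + h) - g (z + h)" "f z - g z"] by simp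
  qed (use f g i d in auto)
  also have "\<dots> = (\<integral>z. norm (g (z + h) - g z) \<partial>lborel) + 2 * (\<integral>z. norm (f z - g z) \<partial>lborel)"
    using f g i d integral_translate[OF d, of h] by simp
  finally show ?thesis .
qed

text \<open>
  The translated indicator has the same integral, so the distance is twice the integral of the positive
  part of \<open>1\<^sub>U(z) - 1\<^sub>U(z + h)\<close>.  This part is at most \<open>1\<^sub>U\<close> and, as \<open>U\<close> is open, tends to \<open>0\<close> pointwise.
\<close>

lemma translation_continuous_open:
  fixes U :: "'a::euclidean_space set"
  assumes U: "open U" "emeasure lborel U < \<infinity>" and h: "h \<longlonglongrightarrow> 0"
  shows "(\<lambda>k. \<integral>z. norm (indicator U (z + h k) - indicator U z :: real) \<partial>lborel) \<longlonglongrightarrow> 0"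
proof -
  let ?i = "indicator U :: 'a \<Rightarrow> real"
  have meas [measurable]: "U \<in> sets borel" using U by simp
  have i: "integrable lborel ?i" using U by (simp add: integrable_indicator_iff)
  have it: "integrable lborel (\<lambda>z. ?i (z + h k))" for k by (rule integrable_translate[OF i])
  have "(\<lambda>k. \<integral>z. 2 * max 0 (?i z - ?i (z + h k)) \<partial>lborel) \<longlonglongrightarrow> (\<integral>z. 0 \<partial>(lborel::'a measure))"
  proof (rule integral_dominated_convergence[where w="\<lambda>z. 2 * ?i z"])
    show "AE z in lborel. (\<lambda>k. 2 * max 0 (?i z - ?i (z + h k))) \<longlonglongrightarrow> 0"
    proof (rule AE_I2)
      fix z
      have "\<forall>\<^sub>F k in sequentially. 2 * max 0 (?i z - ?i (z + h k)) = 0"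
      proof (cases "z \<in> U")
        case True
        have "(\<lambda>k. z + h k) \<longlonglongrightarrow> z + 0" by (intro tendsto_intros h)
        with topological_tendstoD[OF _ \<open>open U\<close>] True show ?thesis
          by (fastforce elim: eventually_mono)
      qed (simp add: indicator_def)
      then show "(\<lambda>k. 2 * max 0 (?i z - ?i (z + h k))) \<longlonglongrightarrow> 0" by (rule tendsto_eventually)
    qed
    show "AE z in lborel. norm (2 * max 0 (?i z - ?i (z + h k))) \<le> 2 * ?i z" for k
      by (rule AE_I2) (auto simp: indicator_def)
  qed (use i in auto)
  moreover have "(\<integral>z. norm (?i (z + h k) - ?i z) \<partial>lborel) = (\<integral>z. 2 * max 0 (?i z - ?i (z + h k)) \<partial>lborel)" for k
  proof -
    have "(\<integral>z. norm (?i (z + h k) - ?i z) \<partial>lborel)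
        = (\<integral>z. 2 * max 0 (?i z - ?i (z + h k)) + (?i (z + h k) - ?i z) \<partial>lborel)"
      by (rule Bochner_Integration.integral_cong) (auto simp: indicator_def)
    also have "\<dots> = (\<integral>z. 2 * max 0 (?i z - ?i (z + h k)) \<partial>lborel)"
      using i it[of k] integral_translate[OF i, of "h k"] by simp
    finally show ?thesis .
  qed
  ultimately show ?thesis by simp
qed

text \<open>
  Approximation by simple functions reduces the claim to indicators of sets of finite measure, and
  outer regularity reduces it further to open sets.
\<close>

lemma translation_continuous_L1:
  fixes f :: "'a::euclidean_space \<Rightarrow> 'b::{banach, second_countable_topology}"
  assumes "integrable lborel f" and h: "h \<longlonglongrightarrow> 0"
  shows "(\<lambda>k. \<integral>z. norm (f (z + h k) - f z) \<partial>lborel) \<longlonglongrightarrow> 0"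
  using assms(1)
proof (induct rule: integrable_induct)
  case (base A c)
  then have [measurable]: "A \<in> sets borel" by simp
  have iA: "integrable lborel (indicator A :: 'a \<Rightarrow> real)" using base by simp
  have "(\<lambda>k. \<integral>z. norm (indicator A (z + h k) - indicator A z :: real) \<partial>lborel) \<longlonglongrightarrow> 0"
  proof (rule LIMSEQ_I)
    fix e :: real assume "e > 0"
    obtain U where U: "open U" "A \<subseteq> U" "emeasure lborel (U - A) < ennreal (e / 4)"
      using outer_regular_lborel[of A "e / 4"] \<open>e > 0\<close> by auto
    have [measurable]: "U \<in> sets borel" using U by simp
    have fin': "emeasure lborel (U - A) < \<infinity>" using U(3) by (rule less_trans) simp
    have "emeasure lborel U \<le> emeasure lborel A + emeasure lborel (U - A)"
      by (rule order_trans[OF emeasure_mono emeasure_subadditive]) (use U in auto)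
    also have "\<dots> < \<infinity>" using base fin' by simp
    finally have fin: "emeasure lborel U < \<infinity>" .
    then have iU: "integrable lborel (indicator U :: 'a \<Rightarrow> real)" by simp
    have "(\<integral>z. norm (indicator A z - indicator U z :: real) \<partial>lborel) = (\<integral>z. indicator (U - A) z \<partial>lborel)"
      by (rule Bochner_Integration.integral_cong) (use U in \<open>auto simp: indicator_def\<close>)
    also have "\<dots> = measure lborel (U - A)" by simp
    also have "\<dots> < e / 4"
    proof -
      have "ennreal (measure lborel (U - A)) < ennreal (e / 4)"
        using U(3) fin' by (subst emeasure_eq_ennreal_measure[symmetric]) auto
      then show ?thesis by (simp add: ennreal_less_iff)
    qed
    finally have small: "(\<integral>z. norm (indicator A z - indicator U z :: real) \<partial>lborel) < e / 4" .
    from LIMSEQ_D[OF translation_continuous_open[OF U(1) fin h], of "e / 2"] \<open>e > 0\<close>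
    obtain N where N: "\<And>k. k \<ge> N \<Longrightarrow> (\<integral>z. norm (indicator U (z + h k) - indicator U z :: real) \<partial>lborel) < e / 2"
      by (auto simp: Bochner_Integration.integral_nonneg)
    have "(\<integral>z. norm (indicator A (z + h k) - indicator A z :: real) \<partial>lborel) < e" if "k \<ge> N" for k
      using translation_diff_triangle[OF iA iU, of "h k"] N[OF that] small by linarith
    then show "\<exists>N. \<forall>k\<ge>N. norm ((\<integral>z. norm (indicator A (z + h k) - indicator A z :: real) \<partial>lborel) - 0) < e"
      by (auto simp: Bochner_Integration.integral_nonneg)
  qed
  then have "(\<lambda>k. (\<integral>z. norm (indicator A (z + h k) - indicator A z :: real) \<partial>lborel) * norm c) \<longlonglongrightarrow> 0 * norm c"
    by (intro tendsto_intros)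
  then show ?case by (simp flip: scaleR_diff_left)
next
  case (add f g)
  have "(\<lambda>k. (\<integral>z. norm (f (z + h k) - f z) \<partial>lborel) + (\<integral>z. norm (g (z + h k) - g z) \<partial>lborel)) \<longlonglongrightarrow> 0 + 0"
    by (intro tendsto_intros add)
  then have lim: "(\<lambda>k. (\<integral>z. norm (f (z + h k) - f z) \<partial>lborel) + (\<integral>z. norm (g (z + h k) - g z) \<partial>lborel)) \<longlonglongrightarrow> 0"
    by simp
  show ?case
  proof (rule tendsto_sandwich[OF _ _ tendsto_const lim])
    show "\<forall>\<^sub>F k in sequentially. (\<integral>z. norm (f (z + h k) + g (z + h k) - (f z + g z)) \<partial>lborel)
      \<le> (\<integral>z. norm (f (z + h k) - f z) \<partial>lborel) + (\<integral>z. norm (g (z + h k) - g z) \<partial>lborel)"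
    proof (rule always_eventually, rule allI)
      fix k
      note i = add(1,3) integrable_translate[OF add(1), of "h k"] integrable_translate[OF add(3), of "h k"]
      have "(\<integral>z. norm (f (z + h k) + g (z + h k) - (f z + g z)) \<partial>lborel)
        \<le> (\<integral>z. norm (f (z + h k) - f z) + norm (g (z + h k) - g z) \<partial>lborel)"
        by (intro integral_mono) (use i in \<open>auto intro: norm_diff_triangle_ineq\<close>)
      then show "(\<integral>z. norm (f (z + h k) + g (z + h k) - (f z + g z)) \<partial>lborel)
      \<le> (\<integral>z. norm (f (z + h k) - f z) \<partial>lborel) + (\<integral>z. norm (g (z + h k) - g z) \<partial>lborel)" using i by simp
    qed
  qed (auto simp: Bochner_Integration.integral_nonneg)
next
  case (lim f s)
  have "(\<lambda>i. \<integral>z. norm (f z - s i z) \<partial>lborel) \<longlonglongrightarrow> (\<integral>z. 0 \<partial>(lborel::'a measure))"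
  proof (rule integral_dominated_convergence[where w="\<lambda>z. 3 * norm (f z)"])
    show "AE z in lborel. (\<lambda>i. norm (f z - s i z)) \<longlonglongrightarrow> 0"
    proof (rule AE_I2)
      fix z
      have "(\<lambda>i. norm (f z - s i z)) \<longlonglongrightarrow> norm (f z - f z)" by (intro tendsto_intros lim(3)) simp
      then show "(\<lambda>i. norm (f z - s i z)) \<longlonglongrightarrow> 0" by simp
    qed
    show "AE z in lborel. norm (norm (f z - s i z)) \<le> 3 * norm (f z)" for i
    proof (rule AE_I2)
      fix z
      show "norm (norm (f z - s i z)) \<le> 3 * norm (f z)"
        using norm_triangle_ineq4[of "f z" "s i z"] lim(4)[of z i] by simp
    qed
  qed (use lim in \<open>auto dest: borel_measurable_integrable\<close>)
  then have conv: "(\<lambda>i. \<integral>z. norm (f z - s i z) \<partial>lborel) \<longlonglongrightarrow> 0" by simp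
  show ?case
  proof (rule LIMSEQ_I)
    fix e :: real assume "e > 0"
    from LIMSEQ_D[OF conv, of "e / 4"] \<open>e > 0\<close>
    obtain i where i: "(\<integral>z. norm (f z - s i z) \<partial>lborel) < e / 4" by (auto simp: Bochner_Integration.integral_nonneg)
    from LIMSEQ_D[OF lim(2)[of i], of "e / 2"] \<open>e > 0\<close>
    obtain N where N: "\<And>k. k \<ge> N \<Longrightarrow> (\<integral>z. norm (s i (z + h k) - s i z) \<partial>lborel) < e / 2"
      by (auto simp: Bochner_Integration.integral_nonneg)
    have "(\<integral>z. norm (f (z + h k) - f z) \<partial>lborel) < e" if "k \<ge> N" for k
      using translation_diff_triangle[OF lim(5) lim(1), of "h k" i] N[OF that] i by linarith
    then show "\<exists>N. \<forall>k\<ge>N. norm ((\<integral>z. norm (f (z + h k) - f z) \<partial>lborel) - 0) < e"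
      by (auto simp: Bochner_Integration.integral_nonneg)
  qed
qed

lemma translation_continuous_L2:
  fixes u :: "'a::euclidean_space \<Rightarrow> real^3"
  assumes u: "u \<in> L2 lborel" and h: "h \<longlonglongrightarrow> 0"
  shows "(\<lambda>k. \<integral>\<^sup>+z. ennreal ((norm (u (z + h k) - u z))\<^sup>2) \<partial>lborel) \<longlonglongrightarrow> 0"
proof -
  let ?F = "\<lambda>z. sq_map (u z)"
  have iF: "integrable lborel ?F" by (rule integrable_sq_map[OF u])
  have "(\<lambda>k. ennreal (2 * (\<integral>z. norm (?F (z + h k) - ?F z) \<partial>lborel))) \<longlonglongrightarrow> ennreal (2 * 0)"
    by (intro tendsto_ennrealI tendsto_intros translation_continuous_L1[OF iF h])
  then have lim: "(\<lambda>k. ennreal (2 * (\<integral>z. norm (?F (z + h k) - ?F z) \<partial>lborel))) \<longlonglongrightarrow> 0" by simp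
  show ?thesis
  proof (rule tendsto_sandwich[OF _ _ tendsto_const lim])
    show "\<forall>\<^sub>F k in sequentially. (\<integral>\<^sup>+z. ennreal ((norm (u (z + h k) - u z))\<^sup>2) \<partial>lborel)
      \<le> ennreal (2 * (\<integral>z. norm (?F (z + h k) - ?F z) \<partial>lborel))"
    proof (rule always_eventually, rule allI)
      fix k
      have i: "integrable lborel (\<lambda>z. 2 * norm (?F (z + h k) - ?F z))"
        using iF integrable_translate[OF iF, of "h k"] by simp
      have "(\<integral>\<^sup>+z. ennreal ((norm (u (z + h k) - u z))\<^sup>2) \<partial>lborel)
        \<le> (\<integral>\<^sup>+z. ennreal (2 * norm (?F (z + h k) - ?F z)) \<partial>lborel)"
        by (intro nn_integral_mono ennreal_leI norm_diff_sq_le_sq_map)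
      also have "\<dots> = ennreal (2 * (\<integral>z. norm (?F (z + h k) - ?F z) \<partial>lborel))"
        by (subst nn_integral_eq_integral[OF i]) auto
      finally show "(\<integral>\<^sup>+z. ennreal ((norm (u (z + h k) - u z))\<^sup>2) \<partial>lborel)
      \<le> ennreal (2 * (\<integral>z. norm (?F (z + h k) - ?F z) \<partial>lborel))" .
    qed
  qed simp
qed

section \<open>Averages in time\<close>

lemma AE_lborel_fst:
  fixes P :: "'a::euclidean_space \<Rightarrow> bool"
  assumes "AE x in lborel. P x"
  shows "AE z in (lborel :: ('a \<times> 'b::euclidean_space) measure). P (fst z)"
proof -
  from assms obtain N where N: "{x. \<not> P x} \<subseteq> N" "N \<in> sets borel" "emeasure lborel N = 0"
    by (auto elim!: AE_E)
  have "emeasure (lborel \<Otimes>\<^sub>M lborel) (N \<times> (UNIV :: 'b set)) = 0"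
    using N by (subst lborel.emeasure_pair_measure_Times) auto
  then have "N \<times> (UNIV :: 'b set) \<in> null_sets lborel"
    using N by (auto simp: lborel_prod null_sets_def intro!: borel_Times)
  from AE_not_in[OF this] show ?thesis
    by eventually_elim (use N in auto)
qed

text \<open>
  The Cauchy-Schwarz inequality.  Where the product is not integrable, the integral on the left has
  the default value \<open>0\<close>.
\<close>

lemma norm_integral_scaleR_sq_le:
  fixes f :: "'a \<Rightarrow> 'b::{banach, second_countable_topology}"
  assumes [measurable]: "\<eta> \<in> borel_measurable M" "f \<in> borel_measurable M"
  shows "ennreal ((norm (\<integral>s. \<eta> s *\<^sub>R f s \<partial>M))\<^sup>2)
    \<le> (\<integral>\<^sup>+s. ennreal ((\<eta> s)\<^sup>2) \<partial>M) * (\<integral>\<^sup>+s. ennreal ((norm (f s))\<^sup>2) \<partial>M)"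
proof (cases "integrable M (\<lambda>s. \<eta> s *\<^sub>R f s)")
  case True
  have "ennreal ((norm (\<integral>s. \<eta> s *\<^sub>R f s \<partial>M))\<^sup>2) = (ennreal (norm (\<integral>s. \<eta> s *\<^sub>R f s \<partial>M)))\<^sup>2"
    by (simp add: ennreal_power)
  also have "\<dots> \<le> (\<integral>\<^sup>+s. ennreal (norm (\<eta> s *\<^sub>R f s)) \<partial>M)\<^sup>2"
    by (intro power_mono integral_norm_bound_ennreal True) auto
  also have "\<dots> = (\<integral>\<^sup>+s. ennreal \<bar>\<eta> s\<bar> * ennreal (norm (f s)) \<partial>M)\<^sup>2"
    by (simp add: ennreal_mult)
  also have "\<dots> \<le> (\<integral>\<^sup>+s. (ennreal \<bar>\<eta> s\<bar>)\<^sup>2 \<partial>M) * (\<integral>\<^sup>+s. (ennreal (norm (f s)))\<^sup>2 \<partial>M)"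
    by (rule Cauchy_Schwarz_nn_integral) auto
  finally show ?thesis by (simp add: ennreal_power)
qed (simp add: not_integrable_integral_eq)

text \<open>
  Fields are extended by zero outside the time interval, so that averages over any kernel are
  integrals over the whole line.
\<close>

definition time_supported :: "real \<Rightarrow> ('a \<times> real \<Rightarrow> real^3) \<Rightarrow> bool" where
  "time_supported T u \<longleftrightarrow> (\<forall>x t. t \<notin> {0<..<T} \<longrightarrow> u (x, t) = 0)"

text \<open>
  Pairing with a scalar function of time: all that a test function \<open>\<phi>(x) \<eta>(t)\<close> sees of a field.
\<close>

definition smear :: "('a \<times> real \<Rightarrow> real^3) \<Rightarrow> (real \<Rightarrow> real) \<Rightarrow> 'a \<Rightarrow> real^3" where
  "smear u \<eta> x = (\<integral>s. \<eta> s *\<^sub>R u (x, s) \<partial>lborel)"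

text \<open>
  Convolution in time with the reflected kernel: for \<open>\<theta>\<close> supported in \<open>[0, l]\<close>, the value at time \<open>t\<close>
  is an average over \<open>[t, t + l]\<close>.
\<close>

definition mollify :: "('a \<times> real \<Rightarrow> real^3) \<Rightarrow> (real \<Rightarrow> real) \<Rightarrow> 'a \<times> real \<Rightarrow> real^3" where
  "mollify u \<theta> z = smear u (\<lambda>s. \<theta> (s - snd z)) (fst z)"

lemma L2_slice_nn:
  fixes u :: "'a::euclidean_space \<times> real \<Rightarrow> real^3"
  assumes "u \<in> L2 lborel"
  shows "(\<integral>\<^sup>+x. \<integral>\<^sup>+s. ennreal ((norm (u (x, s)))\<^sup>2) \<partial>lborel \<partial>lborel) = ennreal ((L2_norm lborel u)\<^sup>2)"
proof -
  have [measurable]: "u \<in> borel_measurable (lborel \<Otimes>\<^sub>M lborel)" using assms by (simp add: L2_def lborel_prod)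
  have "(\<integral>\<^sup>+x. \<integral>\<^sup>+s. ennreal ((norm (u (x, s)))\<^sup>2) \<partial>lborel \<partial>lborel)
      = (\<integral>\<^sup>+z. ennreal ((norm (u z))\<^sup>2) \<partial>(lborel \<Otimes>\<^sub>M lborel))"
    by (rule lborel.nn_integral_fst) measurable
  then show ?thesis using nn_integral_eq_L2_norm[OF assms] by (simp add: lborel_prod)
qed

lemma L2_slice_meas:
  fixes u :: "'a::euclidean_space \<times> real \<Rightarrow> real^3"
  assumes "u \<in> L2 lborel"
  shows "(\<lambda>s. u (x, s)) \<in> borel_measurable borel" "(\<lambda>x. u (x, s)) \<in> borel_measurable borel"
proof -
  have "u \<in> borel_measurable (lborel \<Otimes>\<^sub>M lborel)" using assms by (simp add: L2_def lborel_prod)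
  from measurable_compose[OF measurable_Pair1'[of x lborel lborel] this] measurable_compose[OF measurable_Pair2'[of s lborel lborel] this]
  show "(\<lambda>s. u (x, s)) \<in> borel_measurable borel" "(\<lambda>x. u (x, s)) \<in> borel_measurable borel" by auto
qed

lemma L2_slice_integrable:
  fixes u :: "'a::euclidean_space \<times> real \<Rightarrow> real^3"
  assumes u: "u \<in> L2 lborel" and supp: "time_supported T u"
  shows "AE x in lborel. integrable lborel (\<lambda>s. u (x, s))"
proof -
  have "integrable (lborel \<Otimes>\<^sub>M lborel) (\<lambda>z. (norm (u z))\<^sup>2)" using u by (simp add: L2_def lborel_prod)
  from lborel_pair.AE_integrable_fst'[OF this]
  have "AE x in lborel. integrable lborel (\<lambda>s. (norm (u (x, s)))\<^sup>2)" .
  then show ?thesis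
  proof eventually_elim
    case (elim x)
    show ?case
    proof (rule Bochner_Integration.integrable_bound)
      show "integrable lborel (\<lambda>s. indicator {0<..<T} s + (norm (u (x, s)))\<^sup>2)"
        using elim by (cases "0 < T") auto
      show "AE s in lborel. norm (u (x, s)) \<le> norm (indicator {0<..<T} s + (norm (u (x, s)))\<^sup>2)"
      proof (rule AE_I2)
        fix s
        show "norm (u (x, s)) \<le> norm (indicator {0<..<T} s + (norm (u (x, s)))\<^sup>2)"
        proof (cases "s \<in> {0<..<T}")
          case True
          have "2 * norm (u (x, s)) \<le> 1 + (norm (u (x, s)))\<^sup>2"
            using sum_squares_bound[of 1 "norm (u (x, s))"] by simp
          then have "norm (u (x, s)) \<le> 1 + (norm (u (x, s)))\<^sup>2" using norm_ge_zero[of "u (x, s)"] by linarith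
          then show ?thesis using True by simp
        next
          case False
          with supp have "u (x, s) = 0" unfolding time_supported_def by blast
          then show ?thesis by simp
        qed
      qed
    qed (use L2_slice_meas[OF u] in simp)
  qed
qed

lemma integrable_bounded_scaleR:
  fixes f :: "'a \<Rightarrow> 'b::{banach, second_countable_topology}"
  assumes "integrable M f" "\<eta> \<in> borel_measurable M" "\<And>s. \<bar>\<eta> s\<bar> \<le> K"
  shows "integrable M (\<lambda>s. \<eta> s *\<^sub>R f s)"
proof (rule Bochner_Integration.integrable_bound)
  show "integrable M (\<lambda>s. K *\<^sub>R norm (f s))" using assms(1) by simp
  show "AE s in M. norm (\<eta> s *\<^sub>R f s) \<le> norm (K *\<^sub>R norm (f s))"
  proof (rule AE_I2)
    fix s
    have "\<bar>\<eta> s\<bar> * norm (f s) \<le> \<bar>K\<bar> * norm (f s)"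
      using assms(3)[of s] by (intro mult_right_mono) auto
    then show "norm (\<eta> s *\<^sub>R f s) \<le> norm (K *\<^sub>R norm (f s))" by (simp add: abs_mult)
  qed
qed (use assms in auto)

lemma smear_restrict:
  assumes "time_supported T u"
  shows "smear u \<eta> x = smear u (\<lambda>s. indicator {0<..<T} s * \<eta> s) x"
  unfolding smear_def
  by (rule Bochner_Integration.integral_cong) (use assms in \<open>auto simp: indicator_def time_supported_def\<close>)

lemma smear_measurable:
  fixes u :: "'a::euclidean_space \<times> real \<Rightarrow> real^3"
  assumes u: "u \<in> L2 lborel" and [measurable]: "\<eta> \<in> borel_measurable borel"
  shows "smear u \<eta> \<in> borel_measurable borel"
proof -
  have [measurable]: "u \<in> borel_measurable (borel \<Otimes>\<^sub>M borel)" using u by (simp add: L2_def borel_prod)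
  have "smear u \<eta> \<in> borel_measurable lborel" unfolding smear_def by measurable
  then show ?thesis by simp
qed

lemma smear_L2_nn:
  fixes u :: "'a::euclidean_space \<times> real \<Rightarrow> real^3"
  assumes u: "u \<in> L2 lborel" and supp: "time_supported T u" and [measurable]: "\<eta> \<in> borel_measurable borel"
    and B: "(\<integral>\<^sup>+s. indicator {0<..<T} s * ennreal ((\<eta> s)\<^sup>2) \<partial>lborel) \<le> ennreal B" "0 \<le> B"
  shows "smear u \<eta> \<in> L2 lborel" "(L2_norm lborel (smear u \<eta>))\<^sup>2 \<le> B * (L2_norm lborel u)\<^sup>2"
proof -
  let ?\<eta> = "\<lambda>s. indicator {0<..<T} s * \<eta> s"
  note [measurable] = L2_slice_meas[OF u]
  have "(\<integral>\<^sup>+x. ennreal ((norm (smear u \<eta> x))\<^sup>2) \<partial>lborel)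
    \<le> (\<integral>\<^sup>+x. ennreal B * (\<integral>\<^sup>+s. ennreal ((norm (u (x, s)))\<^sup>2) \<partial>lborel) \<partial>lborel)"
  proof (rule nn_integral_mono)
    fix x
    have "ennreal ((norm (smear u \<eta> x))\<^sup>2)
      \<le> (\<integral>\<^sup>+s. ennreal ((?\<eta> s)\<^sup>2) \<partial>lborel) * (\<integral>\<^sup>+s. ennreal ((norm (u (x, s)))\<^sup>2) \<partial>lborel)"
      unfolding smear_restrict[OF supp, of \<eta>] unfolding smear_def
      by (rule norm_integral_scaleR_sq_le) measurable
    also have "(\<integral>\<^sup>+s. ennreal ((?\<eta> s)\<^sup>2) \<partial>lborel) = (\<integral>\<^sup>+s. indicator {0<..<T} s * ennreal ((\<eta> s)\<^sup>2) \<partial>lborel)"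
      by (rule nn_integral_cong) (auto simp: indicator_def)
    finally show "ennreal ((norm (smear u \<eta> x))\<^sup>2)
      \<le> ennreal B * (\<integral>\<^sup>+s. ennreal ((norm (u (x, s)))\<^sup>2) \<partial>lborel)"
      using B by (meson mult_right_mono order_trans zero_le)
  qed
  also have "\<dots> = ennreal B * (\<integral>\<^sup>+x. \<integral>\<^sup>+s. ennreal ((norm (u (x, s)))\<^sup>2) \<partial>lborel \<partial>lborel)"
  proof (rule nn_integral_cmult)
    have [measurable]: "u \<in> borel_measurable (borel \<Otimes>\<^sub>M borel)" using u by (simp add: L2_def borel_prod)
    show "(\<lambda>x. \<integral>\<^sup>+s. ennreal ((norm (u (x, s)))\<^sup>2) \<partial>lborel) \<in> borel_measurable lborel" by measurable
  qed
  also have "\<dots> = ennreal (B * (L2_norm lborel u)\<^sup>2)"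
    using B by (simp add: L2_slice_nn[OF u] ennreal_mult)
  finally have le: "(\<integral>\<^sup>+x. ennreal ((norm (smear u \<eta> x))\<^sup>2) \<partial>lborel) \<le> ennreal (B * (L2_norm lborel u)\<^sup>2)" .
  have m: "smear u \<eta> \<in> borel_measurable lborel" using smear_measurable[OF u, of \<eta>] by simp
  from L2_norm_le_of_nn_integral[OF m le] B show "smear u \<eta> \<in> L2 lborel"
    "(L2_norm lborel (smear u \<eta>))\<^sup>2 \<le> B * (L2_norm lborel u)\<^sup>2" by auto
qed

lemma
  fixes u :: "'a::euclidean_space \<times> real \<Rightarrow> real^3"
  assumes u: "u \<in> L2 lborel" and supp: "time_supported T u" and meas: "\<eta> \<in> borel_measurable borel"
    and T: "0 \<le> T" and K: "\<And>s. s \<in> {0<..<T} \<Longrightarrow> \<bar>\<eta> s\<bar> \<le> K"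
  shows smear_L2: "smear u \<eta> \<in> L2 lborel"
    and smear_bound: "0 \<le> K \<Longrightarrow> L2_norm lborel (smear u \<eta>) \<le> K * sqrt T * L2_norm lborel u"
proof -
  have "(\<integral>\<^sup>+s. indicator {0<..<T} s * ennreal ((\<eta> s)\<^sup>2) \<partial>lborel) \<le> (\<integral>\<^sup>+s. ennreal (K\<^sup>2) * indicator {0<..<T} s \<partial>lborel)"
  proof (rule nn_integral_mono)
    fix s
    show "indicator {0<..<T} s * ennreal ((\<eta> s)\<^sup>2) \<le> ennreal (K\<^sup>2) * indicator {0<..<T} s"
    proof (cases "s \<in> {0<..<T}")
      case True
      then have "(\<eta> s)\<^sup>2 \<le> K\<^sup>2" using K[OF True] by (simp add: abs_le_square_iff[symmetric])
      then show ?thesis using True by (simp add: ennreal_leI)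
    qed simp
  qed
  also have "\<dots> = ennreal (K\<^sup>2 * T)" using T by (simp add: nn_integral_cmult_indicator ennreal_mult)
  finally have le: "(\<integral>\<^sup>+s. indicator {0<..<T} s * ennreal ((\<eta> s)\<^sup>2) \<partial>lborel) \<le> ennreal (K\<^sup>2 * T)" .
  note * = smear_L2_nn[OF u supp meas le]
  show "smear u \<eta> \<in> L2 lborel" using * T by simp
  assume "0 \<le> K"
  have "(L2_norm lborel (smear u \<eta>))\<^sup>2 \<le> (K * sqrt T * L2_norm lborel u)\<^sup>2"
    using * T by (simp add: power_mult_distrib)
  then show "L2_norm lborel (smear u \<eta>) \<le> K * sqrt T * L2_norm lborel u"
    by (rule power2_le_imp_le) (use \<open>0 \<le> K\<close> T in simp)
qed

lemma smear_linear_AE: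
  fixes u :: "'a::euclidean_space \<times> real \<Rightarrow> real^3"
  assumes u: "u \<in> L2 lborel" and supp: "time_supported T u"
    and meas: "\<eta> \<in> borel_measurable borel" "\<zeta> \<in> borel_measurable borel"
    and K: "\<And>s. s \<in> {0<..<T} \<Longrightarrow> \<bar>\<eta> s\<bar> \<le> K" "\<And>s. s \<in> {0<..<T} \<Longrightarrow> \<bar>\<zeta> s\<bar> \<le> K"
  shows "AE x in lborel. smear u (\<lambda>s. a * \<eta> s + b * \<zeta> s) x = a *\<^sub>R smear u \<eta> x + b *\<^sub>R smear u \<zeta> x"
  using L2_slice_integrable[OF u supp]
proof eventually_elim
  case (elim x)
  have i: "integrable lborel (\<lambda>s. (indicator {0<..<T} s * \<eta> s) *\<^sub>R u (x, s))"
    "integrable lborel (\<lambda>s. (indicator {0<..<T} s * \<zeta> s) *\<^sub>R u (x, s))"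
    by (rule integrable_bounded_scaleR[OF elim, where K="\<bar>K\<bar>"];
        use meas K in \<open>force simp: indicator_def\<close>)+
  have "smear u (\<lambda>s. a * \<eta> s + b * \<zeta> s) x = (\<integral>s. a *\<^sub>R ((indicator {0<..<T} s * \<eta> s) *\<^sub>R u (x, s)) + b *\<^sub>R ((indicator {0<..<T} s * \<zeta> s) *\<^sub>R u (x, s)) \<partial>lborel)"
    by (subst smear_restrict[OF supp]) (simp add: smear_def algebra_simps)
  also have "\<dots> = a *\<^sub>R smear u \<eta> x + b *\<^sub>R smear u \<zeta> x"
    unfolding smear_restrict[OF supp, of \<eta>] smear_restrict[OF supp, of \<zeta>] unfolding smear_def
    by (simp only: Bochner_Integration.integral_add integrable_scaleR_right integral_scaleR_right i)
  finally show ?case .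
qed

text \<open>
  A negative \<open>l\<close> reflects the kernel, and the mollification then looks backward in time.
\<close>

definition scaled :: "(real \<Rightarrow> real) \<Rightarrow> real \<Rightarrow> real \<Rightarrow> real" where
  "scaled \<rho> l s = \<rho> (s / l) / \<bar>l\<bar>"

lemma mollify_measurable:
  fixes u :: "'a::euclidean_space \<times> real \<Rightarrow> real^3"
  assumes u: "u \<in> L2 lborel" and [measurable]: "\<theta> \<in> borel_measurable borel"
  shows "mollify u \<theta> \<in> borel_measurable borel"
proof -
  have [measurable]: "u \<in> borel_measurable (borel \<Otimes>\<^sub>M borel)" using u by (simp add: L2_def borel_prod)
  have "(\<lambda>(z, s). \<theta> (s - snd z) *\<^sub>R u (fst z, s)) \<in> borel_measurable ((borel \<Otimes>\<^sub>M borel) \<Otimes>\<^sub>M lborel)"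
    by measurable
  then have "(\<lambda>z. \<integral>s. \<theta> (s - snd z) *\<^sub>R u (fst z, s) \<partial>lborel) \<in> borel_measurable (borel \<Otimes>\<^sub>M borel)"
    by measurable
  then show ?thesis by (simp add: borel_prod mollify_def[abs_def] smear_def)
qed

lemma mollify_minus_eq:
  fixes u :: "'a::euclidean_space \<times> real \<Rightarrow> real^3"
  assumes int: "integrable lborel (\<lambda>s. u (x, s))"
    and \<rho>: "\<rho> \<in> borel_measurable borel" "\<And>s. \<bar>\<rho> s\<bar> \<le> K" "integrable lborel \<rho>" "(\<integral>s. \<rho> s \<partial>lborel) = 1"
    and l: "l \<noteq> 0"
  shows "mollify u (scaled \<rho> l) (x, t) - u (x, t) = (\<integral>s. \<rho> s *\<^sub>R (u (x, t + l * s) - u (x, t)) \<partial>lborel)"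
proof -
  have "mollify u (scaled \<rho> l) (x, t) = \<bar>l\<bar> *\<^sub>R (\<integral>s. scaled \<rho> l (t + l * s - t) *\<^sub>R u (x, t + l * s) \<partial>lborel)"
    unfolding mollify_def smear_def fst_conv snd_conv by (rule lborel_integral_real_affine[OF l])
  also have "\<dots> = (\<integral>s. \<rho> s *\<^sub>R u (x, t + l * s) \<partial>lborel)"
    unfolding scaled_def using l by (simp flip: integral_scaleR_right)
  finally have m: "mollify u (scaled \<rho> l) (x, t) = (\<integral>s. \<rho> s *\<^sub>R u (x, t + l * s) \<partial>lborel)" .
  have i: "integrable lborel (\<lambda>s. u (x, t + l * s))"
    using lborel_integrable_real_affine[OF int l] .
  have "u (x, t) = (\<integral>s. \<rho> s *\<^sub>R u (x, t) \<partial>lborel)" using \<rho> by simp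
  then have "mollify u (scaled \<rho> l) (x, t) - u (x, t) = (\<integral>s. \<rho> s *\<^sub>R u (x, t + l * s) \<partial>lborel) - (\<integral>s. \<rho> s *\<^sub>R u (x, t) \<partial>lborel)"
    using m by simp
  also have "\<dots> = (\<integral>s. \<rho> s *\<^sub>R u (x, t + l * s) - \<rho> s *\<^sub>R u (x, t) \<partial>lborel)"
    by (intro Bochner_Integration.integral_diff[symmetric] integrable_bounded_scaleR[OF i] \<rho>)
      (use \<rho> in auto)
  finally show ?thesis by (simp add: scaleR_diff_right)
qed

text \<open>
  The error at \<open>(x, t)\<close> is an average over \<open>s \<in> [0, 1]\<close> of the translation errors
  \<open>u(x, t + l s) - u(x, t)\<close>.  The Cauchy-Schwarz inequality and Tonelli's theorem bound its square
  integral by the mean over \<open>s\<close> of squared translation errors in \<open>L\<^sup>2\<close>, which vanish in the limit.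
\<close>

lemma mollify_converges:
  fixes u :: "'a::euclidean_space \<times> real \<Rightarrow> real^3"
  assumes u: "u \<in> L2 lborel" and supp: "time_supported T u"
    and \<rho>: "\<rho> \<in> borel_measurable borel" "\<And>s. \<bar>\<rho> s\<bar> \<le> K" "integrable lborel \<rho>" "(\<integral>s. \<rho> s \<partial>lborel) = 1"
      "\<And>s. s \<notin> {0..1} \<Longrightarrow> \<rho> s = 0"
    and l: "l \<longlonglongrightarrow> 0" "\<And>k. l k \<noteq> 0"
  shows "(\<lambda>k. \<integral>\<^sup>+z. ennreal ((norm (mollify u (scaled \<rho> (l k)) z - u z))\<^sup>2) \<partial>lborel) \<longlonglongrightarrow> 0"
proof -
  have um [measurable]: "u \<in> borel_measurable (borel \<Otimes>\<^sub>M borel)" "u \<in> borel_measurable borel"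
    using u by (simp_all add: L2_def borel_prod)
  note [measurable] = \<rho>(1) L2_slice_meas[OF u]
  define w where "w s k = (\<integral>\<^sup>+z. ennreal ((norm (u (z + (0, l k * s)) - u z))\<^sup>2) \<partial>lborel)" for s k
  let ?I = "indicator {0..1} :: real \<Rightarrow> real"
  have bound: "ennreal ((norm (mollify u (scaled \<rho> (l k)) (x, t) - u (x, t)))\<^sup>2)
      \<le> ennreal (K\<^sup>2) * (\<integral>\<^sup>+s. ennreal ((norm (?I s *\<^sub>R (u (x, t + l k * s) - u (x, t))))\<^sup>2) \<partial>lborel)"
    if "integrable lborel (\<lambda>s. u (x, s))" for x t k
  proof -
    have "mollify u (scaled \<rho> (l k)) (x, t) - u (x, t) = (\<integral>s. \<rho> s *\<^sub>R (u (x, t + l k * s) - u (x, t)) \<partial>lborel)"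
      by (rule mollify_minus_eq[OF that \<rho>(1,2,3,4) l(2)])
    also have "\<dots> = (\<integral>s. \<rho> s *\<^sub>R (?I s *\<^sub>R (u (x, t + l k * s) - u (x, t))) \<partial>lborel)"
      by (rule Bochner_Integration.integral_cong) (use \<rho>(5) in \<open>auto simp: indicator_def\<close>)
    finally have "ennreal ((norm (mollify u (scaled \<rho> (l k)) (x, t) - u (x, t)))\<^sup>2)
      \<le> (\<integral>\<^sup>+s. ennreal ((\<rho> s)\<^sup>2) \<partial>lborel) * (\<integral>\<^sup>+s. ennreal ((norm (?I s *\<^sub>R (u (x, t + l k * s) - u (x, t))))\<^sup>2) \<partial>lborel)"
      using norm_integral_scaleR_sq_le[of \<rho> lborel "\<lambda>s. ?I s *\<^sub>R (u (x, t + l k * s) - u (x, t))"] by simp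
    moreover have "(\<integral>\<^sup>+s. ennreal ((\<rho> s)\<^sup>2) \<partial>lborel) \<le> (\<integral>\<^sup>+s. ennreal (K\<^sup>2) * indicator {0..1} s \<partial>(lborel :: real measure))"
    proof (rule nn_integral_mono)
      fix s
      have "(\<rho> s)\<^sup>2 \<le> K\<^sup>2" using \<rho>(2)[of s] by (simp add: abs_le_square_iff[symmetric])
      then show "ennreal ((\<rho> s)\<^sup>2) \<le> ennreal (K\<^sup>2) * indicator {0..1} s"
        using \<rho>(5)[of s] by (auto simp: indicator_def ennreal_leI)
    qed
    moreover have "(\<integral>\<^sup>+s. ennreal (K\<^sup>2) * indicator {0..1} s \<partial>(lborel :: real measure)) = ennreal (K\<^sup>2)"
      by (simp add: nn_integral_cmult_indicator)
    ultimately show ?thesis by (auto elim!: order_trans intro!: mult_right_mono)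
  qed
  have AEint: "AE z in (lborel :: ('a \<times> real) measure). integrable lborel (\<lambda>s. u (fst z, s))"
    by (rule AE_lborel_fst[OF L2_slice_integrable[OF u supp]])
  have le: "(\<integral>\<^sup>+z. ennreal ((norm (mollify u (scaled \<rho> (l k)) z - u z))\<^sup>2) \<partial>lborel)
      \<le> ennreal (K\<^sup>2) * (\<integral>\<^sup>+s. indicator {0..1} s * w s k \<partial>lborel)" for k
  proof -
    let ?g = "\<lambda>z s. ennreal ((norm (?I s *\<^sub>R (u (z + (0, l k * s)) - u z)))\<^sup>2)"
    have gm: "case_prod ?g \<in> borel_measurable (lborel \<Otimes>\<^sub>M lborel)"
    proof -
      have "case_prod ?g \<in> borel_measurable (borel \<Otimes>\<^sub>M borel)" by measurable
      then show ?thesis by (simp cong: measurable_cong_sets add: sets_pair_measure_cong[OF sets_lborel sets_lborel])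
    qed
    have "(\<integral>\<^sup>+z. ennreal ((norm (mollify u (scaled \<rho> (l k)) z - u z))\<^sup>2) \<partial>lborel)
      \<le> (\<integral>\<^sup>+z. ennreal (K\<^sup>2) * (\<integral>\<^sup>+s. ?g z s \<partial>lborel) \<partial>lborel)"
      by (rule nn_integral_mono_AE, use AEint in eventually_elim) (use bound in force)
    also have "\<dots> = ennreal (K\<^sup>2) * (\<integral>\<^sup>+z. \<integral>\<^sup>+s. ?g z s \<partial>lborel \<partial>lborel)"
      by (rule nn_integral_cmult) (use lborel.borel_measurable_nn_integral_fst[OF gm] in simp)
    also have "(\<integral>\<^sup>+z. \<integral>\<^sup>+s. ?g z s \<partial>lborel \<partial>lborel) = (\<integral>\<^sup>+s. \<integral>\<^sup>+z. ?g z s \<partial>lborel \<partial>lborel)"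
      using lborel_pair.Fubini[OF gm] by simp
    also have "\<dots> = (\<integral>\<^sup>+s. indicator {0..1} s * w s k \<partial>lborel)"
      unfolding w_def by (rule nn_integral_cong) (auto simp: indicator_def)
    finally show ?thesis .
  qed
  have w_lim: "(\<lambda>k. w s k) \<longlonglongrightarrow> 0" for s
    unfolding w_def
  proof (rule translation_continuous_L2[OF u])
    have "(\<lambda>k. (0::'a, l k * s)) \<longlonglongrightarrow> (0, 0 * s)" by (intro tendsto_intros l)
    then show "(\<lambda>k. (0::'a, l k * s)) \<longlonglongrightarrow> 0" by (simp add: zero_prod_def)
  qed
  have w_bd: "w s k \<le> ennreal (4 * (L2_norm lborel u)\<^sup>2)" for s k
  proof -
    have "w s k \<le> (\<integral>\<^sup>+z. 2 * ennreal ((norm (u (z + (0, l k * s))))\<^sup>2) + 2 * ennreal ((norm (u z))\<^sup>2) \<partial>lborel)"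
      unfolding w_def
    proof (rule nn_integral_mono)
      fix z :: "'a \<times> real"
      let ?a = "u (z + (0, l k * s))" and ?b = "u z"
      have "(norm (?a - ?b))\<^sup>2 \<le> 2 * (norm ?a)\<^sup>2 + 2 * (norm ?b)\<^sup>2"
        using norm_add_sq_le[of ?a "- ?b"] by simp
      then have "ennreal ((norm (?a - ?b))\<^sup>2) \<le> ennreal (2 * (norm ?a)\<^sup>2 + 2 * (norm ?b)\<^sup>2)" by (rule ennreal_leI)
      then show "ennreal ((norm (?a - ?b))\<^sup>2) \<le> 2 * ennreal ((norm ?a)\<^sup>2) + 2 * ennreal ((norm ?b)\<^sup>2)"
        by (simp add: ennreal_plus ennreal_mult)
    qed
    also have "\<dots> = 2 * (\<integral>\<^sup>+z. ennreal ((norm (u (z + (0, l k * s))))\<^sup>2) \<partial>lborel) + 2 * (\<integral>\<^sup>+z. ennreal ((norm (u z))\<^sup>2) \<partial>lborel)"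
      by (simp add: nn_integral_add nn_integral_cmult)
    also have "(\<integral>\<^sup>+z. ennreal ((norm (u (z + (0, l k * s))))\<^sup>2) \<partial>lborel) = (\<integral>\<^sup>+z. ennreal ((norm (u z))\<^sup>2) \<partial>lborel)"
      by (rule nn_integral_translate) measurable
    finally show ?thesis
      by (simp add: nn_integral_eq_L2_norm[OF u] ennreal_plus[symmetric] ennreal_mult'[symmetric] flip: ennreal_numeral)
  qed
  have wm: "(\<lambda>s. w s k) \<in> borel_measurable lborel" for k
  proof -
    have "(\<lambda>(s, z). ennreal ((norm (u (z + (0, l k * s)) - u z))\<^sup>2)) \<in> borel_measurable (borel \<Otimes>\<^sub>M borel)" by measurable
    then have "(\<lambda>(s, z). ennreal ((norm (u (z + (0, l k * s)) - u z))\<^sup>2)) \<in> borel_measurable (lborel \<Otimes>\<^sub>M lborel)"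
      by (simp cong: measurable_cong_sets add: sets_pair_measure_cong[OF sets_lborel sets_lborel])
    from lborel.borel_measurable_nn_integral_fst[OF this] show ?thesis unfolding w_def by simp
  qed
  have "(\<lambda>k. \<integral>\<^sup>+s. indicator {0..1} s * w s k \<partial>lborel) \<longlonglongrightarrow> (\<integral>\<^sup>+s. 0 \<partial>(lborel::real measure))"
  proof (rule nn_integral_dominated_convergence[where w="\<lambda>s. ennreal (4 * (L2_norm lborel u)\<^sup>2) * indicator {0..1} s"])
    show "AE s in lborel. (\<lambda>k. indicator {0..1} s * w s k) \<longlonglongrightarrow> 0"
      using w_lim by (intro AE_I2) (auto simp: indicator_def)
    show "AE s in lborel. indicator {0..1} s * w s k \<le> ennreal (4 * (L2_norm lborel u)\<^sup>2) * indicator {0..1} s" for k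
      using w_bd by (intro AE_I2) (auto simp: indicator_def)
    show "(\<integral>\<^sup>+s. ennreal (4 * (L2_norm lborel u)\<^sup>2) * indicator {0..1} s \<partial>(lborel :: real measure)) < \<infinity>"
      by (simp add: nn_integral_cmult_indicator)
  qed (use wm in auto)
  then have "(\<lambda>k. ennreal (K\<^sup>2) * (\<integral>\<^sup>+s. indicator {0..1} s * w s k \<partial>lborel)) \<longlonglongrightarrow> ennreal (K\<^sup>2) * 0"
    by (intro ennreal_tendsto_cmult) auto
  then have lim: "(\<lambda>k. ennreal (K\<^sup>2) * (\<integral>\<^sup>+s. indicator {0..1} s * w s k \<partial>lborel)) \<longlonglongrightarrow> 0" by simp
  show ?thesis
    by (rule tendsto_sandwich[OF _ always_eventually tendsto_const lim]) (use le in auto)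
qed

section \<open>A spline kernel and energies along translated kernels\<close>

lemma DERIV_max0_power:
  "((\<lambda>s::real. (max 0 s) ^ Suc (Suc k)) has_real_derivative real (Suc (Suc k)) * (max 0 s) ^ Suc k) (at s)"
proof (cases s "0::real" rule: linorder_cases)
  case less
  have "((\<lambda>s::real. 0) has_real_derivative 0) (at s)" by simp
  then have "((\<lambda>s::real. (max 0 s) ^ Suc (Suc k)) has_real_derivative 0) (at s)"
    by (rule has_field_derivative_transform_within_open[where S="{..<0}"]) (use less in auto)
  then show ?thesis using less by simp
next
  case greater
  have "((\<lambda>s::real. s ^ Suc (Suc k)) has_real_derivative real (Suc (Suc k)) * s ^ Suc k) (at s)"
    by (rule derivative_eq_intros refl | simp)+
  then have "((\<lambda>s::real. (max 0 s) ^ Suc (Suc k)) has_real_derivative real (Suc (Suc k)) * s ^ Suc k) (at s)"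
    by (rule has_field_derivative_transform_within_open[where S="{0<..}"]) (use greater in auto)
  then show ?thesis using greater by simp
next
  case equal
  have "((\<lambda>h::real. (max 0 h) ^ Suc (Suc k) / h) \<longlongrightarrow> 0) (at 0)"
  proof (rule Lim_null_comparison)
    show "\<forall>\<^sub>F h::real in at 0. norm ((max 0 h) ^ Suc (Suc k) / h) \<le> \<bar>h\<bar> ^ Suc k"
    proof (rule always_eventually, rule allI)
      fix h :: real
      show "norm ((max 0 h) ^ Suc (Suc k) / h) \<le> \<bar>h\<bar> ^ Suc k"
        by (cases "h \<le> 0") (simp_all add: mult_nonpos_nonneg)
    qed
    have "((\<lambda>h::real. \<bar>h\<bar> ^ Suc k) \<longlongrightarrow> \<bar>0\<bar> ^ Suc k) (at 0)" by (intro tendsto_intros)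
    then show "((\<lambda>h::real. \<bar>h\<bar> ^ Suc k) \<longlongrightarrow> 0) (at 0)" by simp
  qed
  then show ?thesis using equal by (simp add: DERIV_def)
qed

lemma max0_sq_Taylor: "\<bar>(max 0 (s + k))\<^sup>2 - (max 0 s)\<^sup>2 - k * (2 * max 0 s)\<bar> \<le> (k::real)\<^sup>2"
proof -
  consider "s \<ge> 0" "s + k \<ge> 0" | "s \<ge> 0" "s + k < 0" | "s < 0" "s + k \<ge> 0" | "s < 0" "s + k < 0" by linarith
  then show ?thesis
  proof cases
    case 1 then show ?thesis by (simp add: power2_eq_square algebra_simps)
  next
    case 2
    have "0 \<le> (s + k)\<^sup>2" by simp
    then have "- (s\<^sup>2) - 2 * k * s \<le> k\<^sup>2" by (simp add: power2_eq_square algebra_simps)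
    moreover have "0 \<le> s * (- s - 2 * k)" using 2 by (intro mult_nonneg_nonneg) auto
    ultimately show ?thesis using 2 by (simp add: power2_eq_square algebra_simps)
  next
    case 3
    then have "(s + k)\<^sup>2 \<le> k\<^sup>2" by (intro power_mono) auto
    then show ?thesis using 3 by simp
  qed simp
qed

text \<open>
  The quadratic B-spline with knots \<open>0, 1/3, 2/3, 1\<close> and integral \<open>1\<close>.  Its derivative is Lipschitz
  continuous, which yields the quadratic Taylor remainder used for energies, and its primitive is
  explicit.  Writing it with truncated powers \<open>max 0 (s - c)\<close> avoids a case distinction at the knots.
\<close>

definition spline :: "real \<Rightarrow> real" where
  "spline s = 27 / 2 * ((max 0 s)\<^sup>2 - 3 * (max 0 (s - 1/3))\<^sup>2 + 3 * (max 0 (s - 2/3))\<^sup>2 - (max 0 (s - 1))\<^sup>2)"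

definition spline' :: "real \<Rightarrow> real" where
  "spline' s = 27 * (max 0 s - 3 * max 0 (s - 1/3) + 3 * max 0 (s - 2/3) - max 0 (s - 1))"

definition spline_primitive :: "real \<Rightarrow> real" where
  "spline_primitive s = 9 / 2 * ((max 0 s)^3 - 3 * (max 0 (s - 1/3))^3 + 3 * (max 0 (s - 2/3))^3 - (max 0 (s - 1))^3)"

lemma DERIV_max0_shift:
  "((\<lambda>s::real. (max 0 (s - c))\<^sup>2) has_real_derivative 2 * max 0 (s - c)) (at s)"
  "((\<lambda>s::real. (max 0 (s - c))^3) has_real_derivative 3 * (max 0 (s - c))\<^sup>2) (at s)"
proof -
  have d: "((\<lambda>s. s - c) has_real_derivative 1) (at s)" by (auto intro!: derivative_eq_intros)
  show "((\<lambda>s::real. (max 0 (s - c))\<^sup>2) has_real_derivative 2 * max 0 (s - c)) (at s)"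
    using DERIV_chain2[OF DERIV_max0_power[of 0 "s - c"] d] by (simp add: numeral_2_eq_2)
  show "((\<lambda>s::real. (max 0 (s - c))^3) has_real_derivative 3 * (max 0 (s - c))\<^sup>2) (at s)"
    using DERIV_chain2[OF DERIV_max0_power[of 1 "s - c"] d] by (simp add: numeral_2_eq_2 numeral_3_eq_3)
qed

lemma DERIV_spline: "(spline has_real_derivative spline' s) (at s)"
proof -
  note D = DERIV_max0_shift(1)
  show ?thesis
    using DERIV_cmult[OF DERIV_diff[OF DERIV_add[OF DERIV_diff[OF D[of 0 s] DERIV_cmult[OF D[of "1/3" s], of 3]]
      DERIV_cmult[OF D[of "2/3" s], of 3]] D[of 1 s]], of "27/2"]
    by (simp add: spline_def[abs_def] spline'_def algebra_simps)
qed

lemma DERIV_spline_primitive: "(spline_primitive has_real_derivative spline s) (at s)"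
proof -
  note D = DERIV_max0_shift(2)
  show ?thesis
    using DERIV_cmult[OF DERIV_diff[OF DERIV_add[OF DERIV_diff[OF D[of 0 s] DERIV_cmult[OF D[of "1/3" s], of 3]]
      DERIV_cmult[OF D[of "2/3" s], of 3]] D[of 1 s]], of "9/2"]
    by (simp add: spline_primitive_def[abs_def] spline_def algebra_simps)
qed

lemma spline_continuous: "continuous_on S spline" "continuous_on S spline'"
  unfolding spline_def spline'_def by (intro continuous_intros)+

lemma third_difference_bound:
  fixes a b c d q :: real
  assumes "\<bar>a\<bar> \<le> q" "\<bar>b\<bar> \<le> q" "\<bar>c\<bar> \<le> q" "\<bar>d\<bar> \<le> q"
  shows "\<bar>27 / 2 * (a - 3 * b + 3 * c - d)\<bar> \<le> 108 * q"
proof -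
  have "27 * (a - 3 * b + 3 * c - d) \<le> 216 * q" "- (27 * (a - 3 * b + 3 * c - d)) \<le> 216 * q"
    using assms by (simp_all add: abs_le_iff)
  then show ?thesis by (simp add: abs_le_iff)
qed

lemma spline_Taylor: "\<bar>spline (s + k) - spline s - k * spline' s\<bar> \<le> 108 * k\<^sup>2"
proof -
  define D where "D c = (max 0 (s - c + k))\<^sup>2 - (max 0 (s - c))\<^sup>2 - k * (2 * max 0 (s - c))" for c
  have eq: "spline (s + k) - spline s - k * spline' s = 27 / 2 * (D 0 - 3 * D (1/3) + 3 * D (2/3) - D 1)"
    by (simp add: spline_def spline'_def D_def algebra_simps)
  have "\<bar>D c\<bar> \<le> k\<^sup>2" for c unfolding D_def by (rule max0_sq_Taylor)
  then have "\<bar>27 / 2 * (D 0 - 3 * D (1/3) + 3 * D (2/3) - D 1)\<bar> \<le> 108 * k\<^sup>2"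
    by (intro third_difference_bound)
  with eq show ?thesis by simp
qed

text \<open>
  To the right of the last knot the formulas are third differences of polynomials of degree at most two.
\<close>

lemma spline_support: "s \<notin> {0<..<1} \<Longrightarrow> spline s = 0"
  and spline'_support: "s \<notin> {0<..<1} \<Longrightarrow> spline' s = 0"
  by (cases "s \<le> 0"; simp add: spline_def spline'_def power2_eq_square algebra_simps)+

lemma spline_primitive_values: "s \<le> 0 \<Longrightarrow> spline_primitive s = 0" "1 \<le> s \<Longrightarrow> spline_primitive s = 1"
  by (simp_all add: spline_primitive_def power3_eq_cube field_simps)

lemma spline_bound: "\<bar>spline s\<bar> \<le> 108" "\<bar>spline' s\<bar> \<le> 216"
proof -
  have "\<bar>spline s\<bar> \<le> 108 \<and> \<bar>spline' s\<bar> \<le> 216"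
  proof (cases "s \<in> {0<..<1}")
    case True
    define m where "m c = max 0 (s - c)" for c
    have m: "\<bar>m c\<bar> \<le> 1" if "0 \<le> c" for c using True that by (auto simp: m_def)
    have m2: "\<bar>(m c)\<^sup>2\<bar> \<le> 1" if "0 \<le> c" for c using m[OF that] by (simp add: abs_square_le_1)
    have "spline s = 27 / 2 * ((m 0)\<^sup>2 - 3 * (m (1/3))\<^sup>2 + 3 * (m (2/3))\<^sup>2 - (m 1)\<^sup>2)"
      and "spline' s = 2 * (27 / 2 * (m 0 - 3 * m (1/3) + 3 * m (2/3) - m 1))"
      by (simp_all add: spline_def spline'_def m_def)
    moreover have "\<bar>27 / 2 * ((m 0)\<^sup>2 - 3 * (m (1/3))\<^sup>2 + 3 * (m (2/3))\<^sup>2 - (m 1)\<^sup>2)\<bar> \<le> 108 * 1"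
      by (intro third_difference_bound m2) auto
    moreover have "\<bar>27 / 2 * (m 0 - 3 * m (1/3) + 3 * m (2/3) - m 1)\<bar> \<le> 108 * 1"
      by (intro third_difference_bound m) auto
    ultimately show ?thesis by (simp only: abs_mult) simp
  next
    case False
    then show ?thesis using spline_support spline'_support by simp
  qed
  then show "\<bar>spline s\<bar> \<le> 108" "\<bar>spline' s\<bar> \<le> 216" by auto
qed

lemma spline_measurable [measurable]: "spline \<in> borel_measurable borel"
  by (intro borel_measurable_continuous_onI spline_continuous)

lemma spline_integral: "integrable lborel spline" "(\<integral>s. spline s \<partial>lborel) = 1"
proof -
  have hi: "(spline has_integral (spline_primitive 1 - spline_primitive 0)) {0..1}"
    by (rule fundamental_theorem_of_calculus)
      (auto simp flip: has_real_derivative_iff_has_vector_derivative intro: DERIV_spline_primitive DERIV_subset)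
  have si: "set_integrable lborel {0..1} spline"
    by (rule borel_integrable_atLeastAtMost') (rule spline_continuous)
  have eq: "(\<lambda>s. indicator {0..1} s *\<^sub>R spline s) = spline"
    by (rule ext) (force simp: indicator_def intro: spline_support)
  show "integrable lborel spline" using si unfolding set_integrable_def eq .
  have "(\<integral>s. spline s \<partial>lborel) = integral {0..1} spline"
    using set_borel_integral_eq_integral(2)[OF si] unfolding set_lebesgue_integral_def eq .
  also have "\<dots> = 1" using integral_unique[OF hi] by (simp add: spline_primitive_values)
  finally show "(\<integral>s. spline s \<partial>lborel) = 1" .
qed

lemma quadratic_remainder_imp_DERIV:
  fixes f :: "real \<Rightarrow> real"
  assumes "\<And>k. \<bar>k\<bar> \<le> 1 \<Longrightarrow> \<bar>f (t + k) - f t - k * D\<bar> \<le> M * k\<^sup>2"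
  shows "(f has_real_derivative D) (at t)"
  unfolding DERIV_def
proof (rule LIM_zero_cancel, rule Lim_null_comparison)
  show "\<forall>\<^sub>F k in at 0. norm ((f (t + k) - f t) / k - D) \<le> M * \<bar>k\<bar>"
    unfolding eventually_at
  proof (intro exI[of _ 1] conjI ballI impI)
    fix k :: real assume "k \<noteq> 0 \<and> dist k 0 < 1"
    then have k: "k \<noteq> 0" "\<bar>k\<bar> \<le> 1" by auto
    then have "\<bar>(f (t + k) - f t) / k - D\<bar> = \<bar>f (t + k) - f t - k * D\<bar> / \<bar>k\<bar>"
      by (simp add: field_simps flip: abs_divide)
    also have "\<dots> \<le> M * k\<^sup>2 / \<bar>k\<bar>" using assms[OF k(2)] by (intro divide_right_mono) auto
    also have "\<dots> = M * \<bar>k\<bar>" using k by (simp add: power2_eq_square abs_if)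
    finally show "norm ((f (t + k) - f t) / k - D) \<le> M * \<bar>k\<bar>" by simp
  qed simp
  have "((\<lambda>k. M * \<bar>k\<bar>) \<longlongrightarrow> M * \<bar>0\<bar>) (at 0)" by (intro tendsto_intros)
  then show "((\<lambda>k. M * \<bar>k\<bar>) \<longlongrightarrow> 0) (at 0)" by simp
qed

text \<open>
  Replacing \<open>t\<close> by \<open>t + k\<close> changes the translated kernel by \<open>- k \<theta>'(s - t)\<close> up to an error of order
  \<open>k\<^sup>2\<close>, uniformly in \<open>s\<close>, and \<open>B\<close> is bounded with respect to the supremum norm.  Differentiating the
  scalar energy in this way takes the place of differentiating curves with values in a space of fields.
\<close>

lemma bilinear_energy_DERIV:
  fixes B :: "(real \<Rightarrow> real) \<Rightarrow> (real \<Rightarrow> real) \<Rightarrow> real"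
  assumes lin: "\<And>\<alpha> \<beta> \<gamma> a b. \<alpha> \<in> C \<Longrightarrow> \<beta> \<in> C \<Longrightarrow> \<gamma> \<in> C \<Longrightarrow> B (\<lambda>s. a * \<alpha> s + b * \<beta> s) \<gamma> = a * B \<alpha> \<gamma> + b * B \<beta> \<gamma>"
    and comb: "\<And>\<alpha> \<beta> a b. \<alpha> \<in> C \<Longrightarrow> \<beta> \<in> C \<Longrightarrow> (\<lambda>s. a * \<alpha> s + b * \<beta> s) \<in> C"
    and sym: "\<And>\<alpha> \<beta>. \<alpha> \<in> C \<Longrightarrow> \<beta> \<in> C \<Longrightarrow> B \<alpha> \<beta> = B \<beta> \<alpha>"
    and bound: "\<And>\<alpha> \<beta> a b. \<alpha> \<in> C \<Longrightarrow> \<beta> \<in> C \<Longrightarrow> (\<And>s. \<bar>\<alpha> s\<bar> \<le> a) \<Longrightarrow> (\<And>s. \<bar>\<beta> s\<bar> \<le> b) \<Longrightarrow> \<bar>B \<alpha> \<beta>\<bar> \<le> c * a * b"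
    and c: "0 \<le> c"
    and shift: "\<And>t. (\<lambda>s. \<theta> (s - t)) \<in> C" "\<And>t. (\<lambda>s. \<theta>' (s - t)) \<in> C"
    and Taylor: "\<And>s k. \<bar>\<theta> (s + k) - \<theta> s - k * \<theta>' s\<bar> \<le> L * k\<^sup>2"
    and K: "\<And>s. \<bar>\<theta> s\<bar> \<le> K" "\<And>s. \<bar>\<theta>' s\<bar> \<le> K"
  shows "((\<lambda>t. B (\<lambda>s. \<theta> (s - t)) (\<lambda>s. \<theta> (s - t))) has_real_derivative
    - 2 * B (\<lambda>s. \<theta>' (s - t)) (\<lambda>s. \<theta> (s - t))) (at t)"
proof (rule quadratic_remainder_imp_DERIV)
  fix k :: real assume k: "\<bar>k\<bar> \<le> 1"
  let ?e = "\<lambda>t s. \<theta> (s - t)" and ?e' = "\<lambda>s. \<theta>' (s - t)"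
  \<comment> \<open>the increment of the translated kernel and the remainder of its Taylor expansion\<close>
  define d where "d s = 1 * ?e (t + k) s + (- 1) * ?e t s" for s
  define r where "r s = 1 * d s + k * ?e' s" for s
  have dC: "d \<in> C" unfolding d_def[abs_def] by (intro comb shift)
  have rC: "r \<in> C" unfolding r_def[abs_def] by (intro comb dC shift)
  have K0: "0 \<le> K" using K(1)[of 0] by simp
  have L0: "0 \<le> L" using Taylor[of 0 1] by simp
  have r_le: "\<bar>r s\<bar> \<le> L * k\<^sup>2" for s
    using Taylor[of "s - t" "- k"] by (simp add: r_def d_def algebra_simps)
  have d_le: "\<bar>d s\<bar> \<le> (L + K) * \<bar>k\<bar>" for s
  proof -
    have "\<bar>d s\<bar> \<le> \<bar>r s\<bar> + \<bar>k * ?e' s\<bar>" by (simp add: r_def)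
    also have "\<dots> \<le> L * k\<^sup>2 + \<bar>k\<bar> * K"
      using r_le[of s] K(2)[of "s - t"] by (intro add_mono) (auto simp: abs_mult intro: mult_left_mono)
    also have "L * k\<^sup>2 \<le> L * \<bar>k\<bar>"
    proof (rule mult_left_mono[OF _ L0])
      have "\<bar>k\<bar> * \<bar>k\<bar> \<le> 1 * \<bar>k\<bar>" by (rule mult_right_mono[OF k]) simp
      then show "k\<^sup>2 \<le> \<bar>k\<bar>" by (simp add: power2_eq_square)
    qed
    finally show ?thesis by (simp add: algebra_simps)
  qed
  have e1: "?e (t + k) = (\<lambda>s. 1 * d s + 1 * ?e t s)" by (simp add: d_def)
  have "B (?e (t + k)) (?e (t + k)) = B d (?e (t + k)) + B (?e t) (?e (t + k))"
    using lin[OF dC shift(1)[of t] shift(1)[of "t + k"], of 1 1] unfolding e1[symmetric] by simp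
  also have "B d (?e (t + k)) = B d d + B d (?e t)"
    using lin[OF dC shift(1)[of t] dC, of 1 1] unfolding e1[symmetric]
    using sym[OF dC shift(1)[of "t + k"]] sym[OF dC shift(1)[of t]] by simp
  also have "B (?e t) (?e (t + k)) = B d (?e t) + B (?e t) (?e t)"
    using lin[OF dC shift(1)[of t] shift(1)[of t], of 1 1] unfolding e1[symmetric]
    using sym[OF shift(1)[of t] shift(1)[of "t + k"]] by simp
  finally have exp: "B (?e (t + k)) (?e (t + k)) - B (?e t) (?e t) = B d d + 2 * B d (?e t)" by simp
  have "B r (?e t) = B d (?e t) + k * B ?e' (?e t)"
    using lin[OF dC shift(2)[of t] shift(1)[of t], of 1 k] unfolding r_def by simp
  with exp have "B (?e (t + k)) (?e (t + k)) - B (?e t) (?e t) - k * (- 2 * B ?e' (?e t)) = B d d + 2 * B r (?e t)"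
    by simp
  also have "\<bar>\<dots>\<bar> \<le> \<bar>B d d\<bar> + 2 * \<bar>B r (?e t)\<bar>" by linarith
  also have "\<dots> \<le> c * ((L + K) * \<bar>k\<bar>) * ((L + K) * \<bar>k\<bar>) + 2 * (c * (L * k\<^sup>2) * K)"
    using bound[OF dC dC d_le d_le] bound[OF rC shift(1)[of t] r_le K(1)] by simp
  also have "\<dots> = (c * (L + K)\<^sup>2 + 2 * c * L * K) * k\<^sup>2"
    by (simp add: power2_eq_square algebra_simps)
  finally show "\<bar>B (?e (t + k)) (?e (t + k)) - B (?e t) (?e t) - k * (- 2 * B ?e' (?e t))\<bar>
    \<le> (c * (L + K)\<^sup>2 + 2 * c * L * K) * k\<^sup>2" .
qed

text \<open>
  The oscillation of \<open>f\<close> on \<open>[a, b]\<close> is at most \<open>\<integral> G\<close>, and its mean value at most \<open>C / (b - a)\<close> times \<open>\<integral> G\<close>.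
\<close>

lemma sup_le_integral:
  fixes f f' G :: "real \<Rightarrow> real"
  assumes ab: "a < b" and deriv: "\<And>t. t \<in> {a..b} \<Longrightarrow> (f has_real_derivative f' t) (at t)"
    and G: "integrable lborel G" "\<And>t. 0 \<le> G t"
    and f': "\<And>t. t \<in> {a..b} \<Longrightarrow> \<bar>f' t\<bar> \<le> G t" and f: "\<And>t. t \<in> {a..b} \<Longrightarrow> f t \<le> C * G t" and C: "0 \<le> C"
    and t: "t \<in> {a..b}"
  shows "f t \<le> (C / (b - a) + 1) * (\<integral>s. G s \<partial>lborel)"
proof -
  let ?I = "\<integral>s. G s \<partial>lborel"
  have osc: "\<bar>f q - f p\<bar> \<le> ?I" if pq: "a \<le> p" "p \<le> q" "q \<le> b" for p q
  proof -
    have hi: "(f' has_integral (f q - f p)) {p..q}"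
    proof (rule fundamental_theorem_of_calculus[OF pq(2)])
      fix s assume "s \<in> {p..q}"
      then have "(f has_real_derivative f' s) (at s)" using pq by (intro deriv) auto
      then show "(f has_vector_derivative f' s) (at s within {p..q})"
        by (simp add: has_field_derivative_at_within flip: has_real_derivative_iff_has_vector_derivative)
    qed
    have si: "set_integrable lborel {p..q} G"
      unfolding set_integrable_def by (rule integrable_mult_indicator) (use G in auto)
    have "norm (integral {p..q} f') \<le> integral {p..q} G"
      by (rule integral_norm_bound_integral)
        (use hi f' pq set_borel_integral_eq_integral(1)[OF si] in \<open>auto simp: has_integral_integrable\<close>)
    also have "\<dots> = (\<integral>s. indicator {p..q} s *\<^sub>R G s \<partial>lborel)"
      using set_borel_integral_eq_integral(2)[OF si] by (simp add: set_lebesgue_integral_def)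
    also have "\<dots> \<le> ?I"
      by (rule integral_mono) (use si G in \<open>auto simp: set_integrable_def indicator_def\<close>)
    finally show ?thesis using integral_unique[OF hi] by simp
  qed
  have ft: "f t \<le> C * G s + ?I" if "s \<in> {a..b}" for s
    using osc[of s t] osc[of t s] f[OF that] t that by (cases "s \<le> t") auto
  have "(b - a) * (f t - ?I) = (\<integral>s. indicator {a..b} s *\<^sub>R (f t - ?I) \<partial>lborel)"
    using ab by simp
  also have "\<dots> \<le> (\<integral>s. C * G s \<partial>lborel)"
  proof (rule integral_mono)
    fix s
    show "indicator {a..b} s *\<^sub>R (f t - ?I) \<le> C * G s"
      using ft[of s] C G(2)[of s] by (auto simp: indicator_def)
  qed (use G ab in auto)
  also have "\<dots> = C * ?I" by simp
  finally show ?thesis using ab by (simp add: field_simps)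
qed

section \<open>Borel representatives\<close>

lemma borel_imp_lebesgue_on:
  "f \<in> borel_measurable borel \<Longrightarrow> f \<in> borel_measurable (lebesgue_on S)"
  by (intro measurable_restrict_space1 measurable_completion) simp

lemma AE_lebesgue_on_iff:
  assumes "S \<in> sets lebesgue"
  shows "(AE x in lebesgue_on S. P x) \<longleftrightarrow> (AE x in lborel. x \<in> S \<longrightarrow> P x)"
  using assms by (simp add: AE_restrict_space_iff AE_completion_iff)

lemma integral_lebesgue_on_borel:
  fixes f :: "'a::euclidean_space \<Rightarrow> 'b::{banach, second_countable_topology}"
  assumes S: "S \<in> sets borel" and f: "f \<in> borel_measurable borel" and supp: "\<And>x. x \<notin> S \<Longrightarrow> f x = 0"
  shows "(\<integral>x. f x \<partial>lebesgue_on S) = (\<integral>x. f x \<partial>lborel)"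
proof -
  have "(\<integral>x. f x \<partial>lebesgue_on S) = (\<integral>x. indicator S x *\<^sub>R f x \<partial>lebesgue)"
    by (rule integral_restrict_space) (use S in auto)
  also have "(\<lambda>x. indicator S x *\<^sub>R f x) = f" by (rule ext) (use supp in \<open>auto simp: indicator_def\<close>)
  also have "(\<integral>x. f x \<partial>lebesgue) = (\<integral>x. f x \<partial>lborel)"
    by (rule integral_completion) (use f in simp)
  finally show ?thesis .
qed

lemma nn_integral_lebesgue_on_borel:
  assumes S: "S \<in> sets borel" and f: "f \<in> borel_measurable borel"
  shows "(\<integral>\<^sup>+x. f x \<partial>lebesgue_on S) = (\<integral>\<^sup>+x. f x * indicator S x \<partial>lborel)"
proof -
  have "(\<integral>\<^sup>+x. f x \<partial>lebesgue_on S) = (\<integral>\<^sup>+x. f x * indicator S x \<partial>lebesgue)"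
    by (rule nn_integral_restrict_space) (use S in auto)
  also have "\<dots> = (\<integral>\<^sup>+x. f x * indicator S x \<partial>lborel)"
    by (rule nn_integral_completion)
  finally show ?thesis .
qed

lemma L2_lebesgue_on:
  fixes u :: "'a::euclidean_space \<Rightarrow> real^3"
  assumes S: "S \<in> sets borel" and u: "u \<in> L2 lborel"
  shows "u \<in> L2 (lebesgue_on S)"
proof -
  have ub: "u \<in> borel_measurable borel" using u by (simp add: L2_def)
  have "(\<integral>\<^sup>+x. ennreal ((norm (u x))\<^sup>2) \<partial>lebesgue_on S) \<le> (\<integral>\<^sup>+x. ennreal ((norm (u x))\<^sup>2) \<partial>lborel)"
    by (subst nn_integral_lebesgue_on_borel[OF S]) (use ub in \<open>auto intro!: nn_integral_mono simp: indicator_def\<close>)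
  also have "\<dots> = ennreal ((L2_norm lborel u)\<^sup>2)" by (rule nn_integral_eq_L2_norm[OF u])
  finally have le: "(\<integral>\<^sup>+x. ennreal ((norm (u x))\<^sup>2) \<partial>lebesgue_on S) \<le> ennreal ((L2_norm lborel u)\<^sup>2)" .
  show "u \<in> L2 (lebesgue_on S)"
    by (rule L2_norm_le_of_nn_integral(1)[OF borel_imp_lebesgue_on[OF ub] le]) simp
qed

lemma L2_norm_lebesgue_on_eq:
  fixes u :: "'a::euclidean_space \<Rightarrow> real^3"
  assumes S: "S \<in> sets borel" and u: "u \<in> borel_measurable borel" and supp: "\<And>x. x \<notin> S \<Longrightarrow> u x = 0"
  shows "L2_norm (lebesgue_on S) u = L2_norm lborel u"
  unfolding L2_norm_def L2_inner_self
  by (subst integral_lebesgue_on_borel[OF S]) (use u supp in auto)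

lemma L2_of_lebesgue_on:
  fixes u :: "'a::euclidean_space \<Rightarrow> real^3"
  assumes S: "S \<in> sets borel" and u: "u \<in> borel_measurable borel" and supp: "\<And>x. x \<notin> S \<Longrightarrow> u x = 0"
    and L: "u \<in> L2 (lebesgue_on S)"
  shows "u \<in> L2 lborel"
proof -
  have ub: "u \<in> borel_measurable borel" using u by (simp add: L2_def)
  have eq: "(\<lambda>x. ennreal ((norm (u x))\<^sup>2) * indicator S x) = (\<lambda>x. ennreal ((norm (u x))\<^sup>2))"
    by (rule ext) (use supp in \<open>auto simp: indicator_def\<close>)
  have "(\<integral>\<^sup>+x. ennreal ((norm (u x))\<^sup>2) \<partial>lborel) = (\<integral>\<^sup>+x. ennreal ((norm (u x))\<^sup>2) \<partial>lebesgue_on S)"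
    by (subst nn_integral_lebesgue_on_borel[OF S]) (use ub eq in auto)
  also have "\<dots> = ennreal ((L2_norm (lebesgue_on S) u)\<^sup>2)" by (rule nn_integral_eq_L2_norm[OF L])
  finally have le: "(\<integral>\<^sup>+x. ennreal ((norm (u x))\<^sup>2) \<partial>lborel) \<le> ennreal ((L2_norm (lebesgue_on S) u)\<^sup>2)" by simp
  have m: "u \<in> borel_measurable lborel" using u by simp
  from L2_norm_le_of_nn_integral(1)[OF m le] show ?thesis by simp
qed

text \<open>
  Passing to a Borel measurable function that vanishes outside \<open>S\<close> makes Fubini's theorem for products
  of \<open>lborel\<close> available; a Lebesgue measurable function is in general not measurable for such a product.
\<close>

lemma borel_version:
  fixes u :: "'a::euclidean_space \<Rightarrow> real^3"
  assumes S: "S \<in> sets borel" and u: "u \<in> borel_measurable (lebesgue_on S)"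
  obtains v where "v \<in> borel_measurable borel" "\<forall>x. x \<notin> S \<longrightarrow> v x = 0" "AE x in lebesgue_on S. u x = v x"
proof -
  have S': "S \<in> sets lebesgue" using S by auto
  have "\<exists>g. g \<in> borel_measurable borel \<and> (AE x in lborel. x \<in> S \<longrightarrow> u x \<bullet> b = g x)" for b
  proof -
    have "(\<lambda>x. u x \<bullet> b) \<in> borel_measurable (lebesgue_on S)" using u by measurable
    then have "(\<lambda>x. if x \<in> S then u x \<bullet> b else 0) \<in> borel_measurable lebesgue"
      using borel_measurable_if_I S' by blast
    from completion_ex_borel_measurable_real[OF this] obtain g where
      "g \<in> borel_measurable lborel" "AE x in lborel. (if x \<in> S then u x \<bullet> b else 0) = g x" by blast
    then show ?thesis by (intro exI[of _ g]) (auto elim!: eventually_mono)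
  qed
  then have "\<forall>b. \<exists>g. g \<in> borel_measurable borel \<and> (AE x in lborel. x \<in> S \<longrightarrow> u x \<bullet> b = g x)" by (rule allI)
  from choice[OF this] obtain g where g: "\<And>b. g b \<in> borel_measurable borel" "\<And>b. AE x in lborel. x \<in> S \<longrightarrow> u x \<bullet> b = g b x"
    by blast
  define v where "v x = indicator S x *\<^sub>R (\<Sum>b\<in>Basis. g b x *\<^sub>R b)" for x
  have "v \<in> borel_measurable borel" unfolding v_def using g(1) S by measurable
  moreover have "v x = 0" if "x \<notin> S" for x using that by (simp add: v_def)
  moreover have "AE x in lborel. x \<in> S \<longrightarrow> u x = v x"
  proof -
    have "AE x in lborel. \<forall>b\<in>Basis. x \<in> S \<longrightarrow> u x \<bullet> b = g b x"
      by (rule AE_finite_allI) (use g(2) in auto)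
    then show ?thesis
    proof eventually_elim
      case (elim x)
      show ?case
      proof
        assume "x \<in> S"
        then have "v x = (\<Sum>b\<in>Basis. (u x \<bullet> b) *\<^sub>R b)" using elim by (simp add: v_def)
        then show "u x = v x" by (simp add: euclidean_representation)
      qed
    qed
  qed
  ultimately show ?thesis using that AE_lebesgue_on_iff[OF S'] by blast
qed

lemma L2_borel_version:
  fixes u :: "'a::euclidean_space \<Rightarrow> real^3"
  assumes S: "S \<in> sets borel" and u: "u \<in> L2 (lebesgue_on S)"
  obtains v where "v \<in> L2 lborel" "\<forall>x. x \<notin> S \<longrightarrow> v x = 0" "AE x in lebesgue_on S. u x = v x"
proof -
  have um: "u \<in> borel_measurable (lebesgue_on S)" using u by (simp add: L2_def)
  obtain v where v: "v \<in> borel_measurable borel" "\<forall>x. x \<notin> S \<longrightarrow> v x = 0" "AE x in lebesgue_on S. u x = v x"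
    by (rule borel_version[OF S um])
  have "v \<in> L2 (lebesgue_on S)"
  proof (rule L2_bound)
    show "v \<in> borel_measurable (lebesgue_on S)" by (rule borel_imp_lebesgue_on[OF v(1)])
    show "integrable (lebesgue_on S) (\<lambda>x. (norm (u x))\<^sup>2)" using u by (simp add: L2_def)
    show "AE x in lebesgue_on S. (norm (v x))\<^sup>2 \<le> (norm (u x))\<^sup>2"
      using v(3) by eventually_elim simp
  qed
  from that[OF L2_of_lebesgue_on[OF S v(1) _ this] v(2,3)] v(2) show thesis by blast
qed

section \<open>Matrix fields\<close>

lemma matrix_vector_norm_le:
  fixes A :: "real^3^3"
  assumes "\<And>i k. \<bar>A $ i $ k\<bar> \<le> B"
  shows "norm (A *v w) \<le> 9 * B * norm w"
proof -
  have "norm (A *v w) \<le> (\<Sum>i\<in>UNIV. \<bar>(A *v w) $ i\<bar>)" by (rule norm_le_l1_cart)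
  also have "\<dots> \<le> (\<Sum>i\<in>(UNIV::3 set). 3 * B * norm w)"
  proof (rule sum_mono)
    fix i :: 3
    have "\<bar>(A *v w) $ i\<bar> \<le> (\<Sum>k\<in>UNIV. \<bar>A $ i $ k * w $ k\<bar>)"
      unfolding matrix_vector_mult_def by (simp add: sum_abs)
    also have "\<dots> \<le> (\<Sum>k\<in>(UNIV::3 set). B * norm w)"
      unfolding abs_mult using assms component_le_norm_cart[of w]
      by (intro sum_mono mult_mono) (auto intro: order_trans[OF abs_ge_zero])
    finally show "\<bar>(A *v w) $ i\<bar> \<le> 3 * B * norm w" by simp
  qed
  finally show ?thesis by simp
qed

lemma matrix_vector_measurable:
  fixes A :: "'a \<Rightarrow> real^3^3"
  assumes "\<And>i k. (\<lambda>x. A x $ i $ k) \<in> borel_measurable M" and w: "w \<in> borel_measurable M"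
  shows "(\<lambda>x. A x *v w x) \<in> borel_measurable M"
proof (subst borel_measurable_euclidean_space, rule ballI)
  fix b :: "real^3" assume "b \<in> Basis"
  then obtain i where b: "b = axis i 1" by (auto simp: Basis_vec_def)
  have wk: "(\<lambda>x. w x $ k) \<in> borel_measurable M" for k
    using borel_measurable_inner[OF w borel_measurable_const[of "axis k 1"]] by (simp add: inner_axis)
  have "(\<lambda>x. \<Sum>k\<in>UNIV. A x $ i $ k * w x $ k) \<in> borel_measurable M"
    using assms(1) wk by (intro borel_measurable_sum borel_measurable_times)
  then show "(\<lambda>x. (A x *v w x) \<bullet> b) \<in> borel_measurable M"
    by (simp add: b inner_axis matrix_vector_mult_def)
qed

definition coefficient :: "(real^3) set \<Rightarrow> (real^3 \<Rightarrow> real^3^3) \<Rightarrow> real \<Rightarrow> bool" where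
  "coefficient \<Omega> A c \<longleftrightarrow> bounded_measurable_entries \<Omega> A \<and> (\<forall>x\<in>\<Omega>. transpose (A x) = A x) \<and>
     0 < c \<and> (\<forall>x\<in>\<Omega>. \<forall>\<xi>. (A x *v \<xi>) \<bullet> \<xi> \<ge> c * (norm \<xi>)\<^sup>2)"

lemma bounded_entries_uniform:
  assumes "bounded_measurable_entries \<Omega> A"
  obtains B where "0 \<le> B" "\<And>x i k. x \<in> \<Omega> \<Longrightarrow> \<bar>A x $ i $ k\<bar> \<le> B"
proof -
  have "\<exists>b. \<forall>x\<in>\<Omega>. \<bar>A x $ i $ k\<bar> \<le> b" for i k
    using assms unfolding bounded_measurable_entries_def bounded_iff by auto
  then obtain b where b: "\<And>i k x. x \<in> \<Omega> \<Longrightarrow> \<bar>A x $ i $ k\<bar> \<le> b i k" by metis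
  define B where "B = (\<Sum>i\<in>UNIV. \<Sum>k\<in>UNIV. \<bar>b i k\<bar>)"
  have "\<bar>b i k\<bar> \<le> B" for i k
  proof -
    have "\<bar>b i k\<bar> \<le> (\<Sum>k\<in>UNIV. \<bar>b i k\<bar>)" by (rule member_le_sum) auto
    also have "\<dots> \<le> B" unfolding B_def by (rule member_le_sum[of i UNIV]) (auto intro: sum_nonneg)
    finally show ?thesis .
  qed
  then have "\<bar>A x $ i $ k\<bar> \<le> B" if "x \<in> \<Omega>" for x i k
    using b[OF that, of i k] by (meson abs_ge_self order_trans)
  moreover have "0 \<le> B" unfolding B_def by (auto intro!: sum_nonneg)
  ultimately show ?thesis using that by blast
qed

lemma L2_matrix_mult:
  assumes A: "bounded_measurable_entries \<Omega> A" and w: "w \<in> L2 (lebesgue_on \<Omega>)"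
  shows "(\<lambda>x. A x *v w x) \<in> L2 (lebesgue_on \<Omega>)"
proof -
  from bounded_entries_uniform[OF A] obtain B where B: "0 \<le> B" "\<And>x i k. x \<in> \<Omega> \<Longrightarrow> \<bar>A x $ i $ k\<bar> \<le> B" by blast
  show ?thesis
  proof (rule L2_bound)
    show "(\<lambda>x. A x *v w x) \<in> borel_measurable (lebesgue_on \<Omega>)"
      using A w by (intro matrix_vector_measurable) (auto simp: bounded_measurable_entries_def L2_def)
    show "integrable (lebesgue_on \<Omega>) (\<lambda>x. (9 * B)\<^sup>2 * (norm (w x))\<^sup>2)" using w by (simp add: L2_def)
    show "AE x in lebesgue_on \<Omega>. (norm (A x *v w x))\<^sup>2 \<le> (9 * B)\<^sup>2 * (norm (w x))\<^sup>2"
    proof (rule AE_I2)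
      fix x assume "x \<in> space (lebesgue_on \<Omega>)"
      then have "norm (A x *v w x) \<le> 9 * B * norm (w x)" using B by (intro matrix_vector_norm_le) auto
      then have "(norm (A x *v w x))\<^sup>2 \<le> (9 * B * norm (w x))\<^sup>2" by (intro power_mono) auto
      then show "(norm (A x *v w x))\<^sup>2 \<le> (9 * B)\<^sup>2 * (norm (w x))\<^sup>2" by (simp add: power_mult_distrib)
    qed
  qed
qed

lemma L2_matrix_mult_bound:
  assumes A: "bounded_measurable_entries \<Omega> A"
  obtains C where "0 \<le> C" "\<And>w. w \<in> L2 (lebesgue_on \<Omega>) \<Longrightarrow> L2_norm (lebesgue_on \<Omega>) (\<lambda>x. A x *v w x) \<le> C * L2_norm (lebesgue_on \<Omega>) w"
proof -
  from bounded_entries_uniform[OF A] obtain B where B: "0 \<le> B" "\<And>x i k. x \<in> \<Omega> \<Longrightarrow> \<bar>A x $ i $ k\<bar> \<le> B" by blast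
  have "L2_norm (lebesgue_on \<Omega>) (\<lambda>x. A x *v w x) \<le> (9 * B) * L2_norm (lebesgue_on \<Omega>) w"
    if w: "w \<in> L2 (lebesgue_on \<Omega>)" for w
  proof (rule power2_le_imp_le)
    have "(\<integral>x. (norm (A x *v w x))\<^sup>2 \<partial>lebesgue_on \<Omega>) \<le> (\<integral>x. (9 * B)\<^sup>2 * (norm (w x))\<^sup>2 \<partial>lebesgue_on \<Omega>)"
    proof (rule integral_mono)
      fix x assume "x \<in> space (lebesgue_on \<Omega>)"
      then have "norm (A x *v w x) \<le> 9 * B * norm (w x)" using B by (intro matrix_vector_norm_le) auto
      then have "(norm (A x *v w x))\<^sup>2 \<le> (9 * B * norm (w x))\<^sup>2" by (intro power_mono) auto
      then show "(norm (A x *v w x))\<^sup>2 \<le> (9 * B)\<^sup>2 * (norm (w x))\<^sup>2" by (simp add: power_mult_distrib)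
    qed (use L2_matrix_mult[OF A w] w in \<open>auto simp: L2_def\<close>)
    then show "(L2_norm (lebesgue_on \<Omega>) (\<lambda>x. A x *v w x))\<^sup>2 \<le> (9 * B * L2_norm (lebesgue_on \<Omega>) w)\<^sup>2"
      by (simp add: L2_norm_sq power_mult_distrib)
  qed (use B in simp)
  with B(1) that[of "9 * B"] show ?thesis by simp
qed

lemma L2_inner_matrix_sym:
  assumes "\<forall>x\<in>\<Omega>. transpose (A x) = A x"
  shows "L2_inner (lebesgue_on \<Omega>) (\<lambda>x. A x *v u x) v = L2_inner (lebesgue_on \<Omega>) u (\<lambda>x. A x *v v x)"
  unfolding L2_inner_def
proof (rule Bochner_Integration.integral_cong[OF refl])
  fix x assume "x \<in> space (lebesgue_on \<Omega>)"
  then have "transpose (A x) = A x" using assms by simp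
  then show "(A x *v u x) \<bullet> v x = u x \<bullet> (A x *v v x)"
    by (metis dot_lmul_matrix transpose_matrix_vector)
qed

lemma L2_inner_matrix_coercive:
  assumes A: "coefficient \<Omega> A c" and w: "w \<in> L2 (lebesgue_on \<Omega>)"
  shows "c * (L2_norm (lebesgue_on \<Omega>) w)\<^sup>2 \<le> L2_inner (lebesgue_on \<Omega>) (\<lambda>x. A x *v w x) w"
proof -
  have "(\<integral>x. c * (norm (w x))\<^sup>2 \<partial>lebesgue_on \<Omega>) \<le> (\<integral>x. (A x *v w x) \<bullet> w x \<partial>lebesgue_on \<Omega>)"
  proof (rule integral_mono)
    show "integrable (lebesgue_on \<Omega>) (\<lambda>x. c * (norm (w x))\<^sup>2)" using w by (simp add: L2_def)
    show "integrable (lebesgue_on \<Omega>) (\<lambda>x. (A x *v w x) \<bullet> w x)"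
      using A w by (intro L2_inner_integrable L2_matrix_mult) (auto simp: coefficient_def)
  qed (use A in \<open>auto simp: coefficient_def\<close>)
  then show ?thesis by (simp add: L2_norm_sq L2_inner_def)
qed

section \<open>Test fields\<close>

text \<open>
  Coinduction for smoothness: no higher derivative has to be computed once a family closed under
  partial derivatives is at hand.
\<close>

lemma Ck_of_closed_family:
  assumes diff: "\<And>f. f \<in> F \<Longrightarrow> f differentiable_on UNIV"
    and closed: "\<And>f b. f \<in> F \<Longrightarrow> b \<in> Basis \<Longrightarrow> (\<lambda>x. frechet_derivative f (at x) b) \<in> F"
    and f: "f \<in> F"
  shows "Ck k f"
  using f
proof (induction k arbitrary: f)
  case 0
  then show ?case using diff by (simp add: differentiable_imp_continuous_on)
next
  case (Suc k)
  then show ?case using diff closed by simp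
qed

text \<open>
  Polynomials in \<open>1 / r\<close> times \<open>exp (- 1 / r)\<close>, continued by zero; the family contains its own derivatives.
\<close>

definition flat :: "real poly \<Rightarrow> real \<Rightarrow> real" where
  "flat p r = (if r \<le> 0 then 0 else poly p (1 / r) * exp (- (1 / r)))"

lemma poly_div_exp_tendsto_0: "((\<lambda>y::real. poly p y / exp y) \<longlongrightarrow> 0) at_top"
proof -
  have "((\<lambda>y::real. \<Sum>i\<le>degree p. coeff p i * (y ^ i / exp y)) \<longlongrightarrow> (\<Sum>i\<le>degree p. coeff p i * 0)) at_top"
    by (intro tendsto_intros tendsto_power_div_exp_0)
  then show ?thesis by (simp add: poly_altdef sum_divide_distrib)
qed

text \<open>
  For \<open>r > 0\<close> this is the chain rule.  At \<open>r = 0\<close> the difference quotient is a polynomial in \<open>y = 1 / r\<close>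
  divided by \<open>exp y\<close>.
\<close>

lemma DERIV_flat: "(flat p has_real_derivative flat ([:0, 0, 1:] * (p - pderiv p)) r) (at r)"
proof (cases r "0::real" rule: linorder_cases)
  case less
  have "((\<lambda>s::real. 0) has_real_derivative 0) (at r)" by simp
  then have "(flat p has_real_derivative 0) (at r)"
    by (rule has_field_derivative_transform_within_open[where S="{..<0}"]) (use less in \<open>auto simp: flat_def\<close>)
  then show ?thesis using less by (simp add: flat_def)
next
  case greater
  have "((\<lambda>s::real. poly p (1 / s) * exp (- (1 / s))) has_real_derivative
      poly (pderiv p) (1 / r) * (- (1 / r\<^sup>2)) * exp (- (1 / r)) + poly p (1 / r) * (exp (- (1 / r)) * (1 / r\<^sup>2))) (at r)"
    using greater
    by (auto intro!: derivative_eq_intros DERIV_chain2[OF poly_DERIV] simp: power2_eq_square divide_simps)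
  also have "poly (pderiv p) (1 / r) * (- (1 / r\<^sup>2)) * exp (- (1 / r)) + poly p (1 / r) * (exp (- (1 / r)) * (1 / r\<^sup>2))
      = flat ([:0, 0, 1:] * (p - pderiv p)) r"
    using greater by (simp add: flat_def power2_eq_square field_simps)
  finally show ?thesis
    by (rule has_field_derivative_transform_within_open[where S="{0<..}"]) (use greater in \<open>auto simp: flat_def\<close>)
next
  case equal
  have "((\<lambda>h. flat p h / h) \<longlongrightarrow> 0) (at 0)"
  proof (rule filterlim_split_at)
    show "((\<lambda>h. flat p h / h) \<longlongrightarrow> 0) (at_left 0)"
      by (rule tendsto_eventually) (auto simp: flat_def eventually_at_filter)
    have "((\<lambda>h. poly ([:0, 1:] * p) (inverse h) / exp (inverse h)) \<longlongrightarrow> 0) (at_right (0::real))"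
      by (rule filterlim_compose[OF poly_div_exp_tendsto_0 filterlim_inverse_at_top_right])
    then show "((\<lambda>h. flat p h / h) \<longlongrightarrow> 0) (at_right 0)"
      by (rule Lim_transform_eventually)
        (auto simp: flat_def eventually_at_filter exp_minus field_simps)
  qed
  then show ?thesis using equal by (simp add: DERIV_def flat_def)
qed

text \<open>
  The product rule turns one product into a sum of two; closing the products under addition gives a
  family of functions, flat at both end points of the interval, that contains its own derivatives.
\<close>

inductive_set interval_bumps :: "real \<Rightarrow> real \<Rightarrow> real \<Rightarrow> (real \<Rightarrow> real) set" for n a b where
  base: "(\<lambda>s. c * (flat p (n * (s - a)) * flat q (n * (b - s)))) \<in> interval_bumps n a b"
| add: "f \<in> interval_bumps n a b \<Longrightarrow> g \<in> interval_bumps n a b \<Longrightarrow> (\<lambda>s. f s + g s) \<in> interval_bumps n a b"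

lemma interval_bumps_DERIV:
  "f \<in> interval_bumps n a b \<Longrightarrow> \<exists>f'\<in>interval_bumps n a b. \<forall>s. (f has_real_derivative f' s) (at s)"
proof (induction rule: interval_bumps.induct)
  case (base c p q)
  let ?p = "[:0, 0, 1:] * (p - pderiv p)" and ?q = "[:0, 0, 1:] * (q - pderiv q)"
  let ?f' = "\<lambda>s. (c * n) * (flat ?p (n * (s - a)) * flat q (n * (b - s))) + (- (c * n)) * (flat p (n * (s - a)) * flat ?q (n * (b - s)))"
  have "((\<lambda>s. c * (flat p (n * (s - a)) * flat q (n * (b - s)))) has_real_derivative ?f' s) (at s)" for s
  proof -
    have "((\<lambda>s. n * (s - a)) has_real_derivative n) (at s)" "((\<lambda>s. n * (b - s)) has_real_derivative - n) (at s)"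
      by (auto intro!: derivative_eq_intros)
    note 1 = DERIV_chain2[OF DERIV_flat this(1), of p] and 2 = DERIV_chain2[OF DERIV_flat this(2), of q]
    show ?thesis using DERIV_cmult[OF DERIV_mult[OF 1 2], of c] by (simp add: algebra_simps)
  qed
  moreover have "?f' \<in> interval_bumps n a b" by (intro interval_bumps.intros)
  ultimately show ?case by (intro bexI[of _ ?f'] allI)
next
  case (add f g)
  then obtain f' g' where "f' \<in> interval_bumps n a b" "g' \<in> interval_bumps n a b"
    "\<And>s. (f has_real_derivative f' s) (at s)" "\<And>s. (g has_real_derivative g' s) (at s)" by blast
  then show ?case by (intro bexI[of _ "\<lambda>s. f' s + g' s"] allI DERIV_add interval_bumps.add) auto
qed

text \<open>
  A partial derivative of such a product acts on a single factor, so one-dimensional families that are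
  closed under differentiation give a family that is closed under partial derivatives.
\<close>

definition box_bumps :: "real \<Rightarrow> real^3 \<Rightarrow> real^3 \<Rightarrow> (real^3 \<Rightarrow> real^3) set" where
  "box_bumps n a b = {\<lambda>x. (\<Prod>i\<in>UNIV. g i (x $ i)) *\<^sub>R v | g v. \<forall>i. g i \<in> interval_bumps n (a $ i) (b $ i)}"

lemma box_bumps_derivative:
  assumes "\<forall>i. g i \<in> interval_bumps n (a $ i) (b $ i)"
    and g': "\<forall>i s. (g i has_real_derivative g' i s) (at s)"
  shows "((\<lambda>x::real^3. (\<Prod>i\<in>UNIV. g i (x $ i)) *\<^sub>R v) has_derivative
    (\<lambda>y. (\<Sum>i\<in>UNIV. (g' i (x $ i) * y $ i) * (\<Prod>j\<in>UNIV - {i}. g j (x $ j))) *\<^sub>R v)) (at x)"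
proof -
  have "((\<lambda>x::real^3. g i (x $ i)) has_derivative (\<lambda>y. g' i (x $ i) * y $ i)) (at x)" for i
  proof -
    have "((\<lambda>x::real^3. x $ i) has_derivative (\<lambda>y. y $ i)) (at x)"
      by (rule bounded_linear_imp_has_derivative) (rule bounded_linear_vec_nth)
    moreover have "(g i has_derivative (*) (g' i (x $ i))) (at (x $ i))"
      using g' by (simp add: has_field_derivative_def)
    ultimately show ?thesis using has_derivative_compose by fastforce
  qed
  then have "((\<lambda>x::real^3. \<Prod>i\<in>UNIV. g i (x $ i)) has_derivative
    (\<lambda>y. \<Sum>i\<in>UNIV. (g' i (x $ i) * y $ i) * (\<Prod>j\<in>UNIV - {i}. g j (x $ j)))) (at x)"
    by (intro has_derivative_prod) auto
  from has_derivative_scaleR_left[OF this, of v] show ?thesis .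
qed

lemma box_bumps_Ck:
  assumes "f \<in> box_bumps n a b" shows "Ck k f"
proof (rule Ck_of_closed_family[OF _ _ assms])
  have main: "f differentiable_on UNIV \<and> (\<forall>c\<in>Basis. (\<lambda>x. frechet_derivative f (at x) c) \<in> box_bumps n a b)"
    if f: "f \<in> box_bumps n a b" for f
  proof -
    from f obtain g v where f_eq: "f = (\<lambda>x. (\<Prod>i\<in>UNIV. g i (x $ i)) *\<^sub>R v)"
      and g: "\<forall>i. g i \<in> interval_bumps n (a $ i) (b $ i)" unfolding box_bumps_def by blast
    have "\<forall>i. \<exists>g'. g' \<in> interval_bumps n (a $ i) (b $ i) \<and> (\<forall>s. (g i has_real_derivative g' s) (at s))"
      using interval_bumps_DERIV g by blast
    from choice[OF this] obtain g' where g': "\<And>i. g' i \<in> interval_bumps n (a $ i) (b $ i)"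
      "\<forall>i s. (g i has_real_derivative g' i s) (at s)" by blast
    note D = box_bumps_derivative[OF g g'(2), of v, folded f_eq]
    have "f differentiable_on UNIV"
      using D by (auto simp: differentiable_on_def differentiable_def)
    moreover have "(\<lambda>x. frechet_derivative f (at x) c) \<in> box_bumps n a b" if "c \<in> Basis" for c
    proof -
      from that obtain j where c: "c = axis j 1" by (auto simp: Basis_vec_def)
      have "frechet_derivative f (at x) c = (\<Prod>i\<in>UNIV. (g(j := g' j)) i (x $ i)) *\<^sub>R v" for x
      proof -
        have "frechet_derivative f (at x) c = (\<Sum>i\<in>UNIV. (g' i (x $ i) * c $ i) * (\<Prod>k\<in>UNIV - {i}. g k (x $ k))) *\<^sub>R v"
          by (simp add: frechet_derivative_at[OF D, symmetric])
        also have "(\<Sum>i\<in>UNIV. (g' i (x $ i) * c $ i) * (\<Prod>k\<in>UNIV - {i}. g k (x $ k)))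
          = (\<Sum>i\<in>UNIV. if i = j then g' j (x $ j) * (\<Prod>k\<in>UNIV - {j}. g k (x $ k)) else 0)"
          by (rule sum.cong) (auto simp: c axis_def)
        also have "\<dots> = g' j (x $ j) * (\<Prod>k\<in>UNIV - {j}. g k (x $ k))" by simp
        also have "\<dots> = (\<Prod>i\<in>UNIV. (g(j := g' j)) i (x $ i))"
          by (subst prod.remove[of UNIV j]) (auto intro!: prod.cong)
        finally show ?thesis .
      qed
      moreover have "\<forall>i. (g(j := g' j)) i \<in> interval_bumps n (a $ i) (b $ i)" using g g'(1) by simp
      ultimately show ?thesis unfolding box_bumps_def by blast
    qed
    ultimately show ?thesis by blast
  qed
  show "f differentiable_on UNIV" if "f \<in> box_bumps n a b" for f using main[OF that] by blast
  show "(\<lambda>x. frechet_derivative f (at x) c) \<in> box_bumps n a b" if "f \<in> box_bumps n a b" "c \<in> Basis" for f c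
    using main[OF that(1)] that(2) by blast
qed

text \<open>
  The factor \<open>Suc n\<close> steepens the flanks; for \<open>n \<rightarrow> \<infinity>\<close> the bumps converge to the indicator of the box.
\<close>

definition bump :: "nat \<Rightarrow> real^3 \<Rightarrow> real^3 \<Rightarrow> real^3 \<Rightarrow> real" where
  "bump n a b x = (\<Prod>i\<in>UNIV. flat 1 (real (Suc n) * (x $ i - a $ i)) * flat 1 (real (Suc n) * (b $ i - x $ i)))"

lemma flat_1: "0 \<le> flat 1 r" "flat 1 r \<le> 1" "r \<le> 0 \<Longrightarrow> flat 1 r = 0"
  by (auto simp: flat_def)

lemma flat_1_tendsto: "0 < r \<Longrightarrow> (\<lambda>n. flat 1 (real (Suc n) * r)) \<longlonglongrightarrow> 1"
proof -
  assume r: "0 < r"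
  have "(\<lambda>n. exp (- (inverse (real (Suc n)) * (1 / r)))) \<longlonglongrightarrow> exp (- (0 * (1 / r)))"
    by (intro tendsto_intros LIMSEQ_inverse_real_of_nat)
  moreover have "flat 1 (real (Suc n) * r) = exp (- (inverse (real (Suc n)) * (1 / r)))" for n
    using r by (simp add: flat_def divide_simps mult_le_0_iff)
  ultimately show ?thesis by simp
qed

lemma mem_box_vec: "(x::real^3) \<in> box a b \<longleftrightarrow> (\<forall>i. a $ i < x $ i \<and> x $ i < b $ i)"
  by (auto simp: mem_box_cart)

lemma bump_outside: "x \<notin> box a b \<Longrightarrow> bump n a b x = 0"
proof -
  assume "x \<notin> box a b"
  then obtain i where "x $ i \<le> a $ i \<or> b $ i \<le> x $ i" by (auto simp: mem_box_vec not_less)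
  then have "real (Suc n) * (x $ i - a $ i) \<le> 0 \<or> real (Suc n) * (b $ i - x $ i) \<le> 0"
    by (auto intro: mult_nonneg_nonpos)
  then have "flat 1 (real (Suc n) * (x $ i - a $ i)) * flat 1 (real (Suc n) * (b $ i - x $ i)) = 0"
    using flat_1(3) by (metis mult_eq_0_iff)
  then show ?thesis unfolding bump_def by (intro prod_zero) auto
qed

lemma bump_bounds: "0 \<le> bump n a b x" "bump n a b x \<le> 1"
  unfolding bump_def by (auto intro!: prod_nonneg prod_le_1 mult_le_one simp: flat_1)

lemma bump_tendsto: "(\<lambda>n. bump n a b x) \<longlonglongrightarrow> indicator (box a b) x"
proof (cases "x \<in> box a b")
  case True
  have "(\<lambda>n. bump n a b x) \<longlonglongrightarrow> (\<Prod>i\<in>(UNIV::3 set). 1 * 1)"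
    unfolding bump_def by (intro tendsto_prod tendsto_mult flat_1_tendsto) (use True in \<open>auto simp: mem_box_vec\<close>)
  then show ?thesis using True by simp
qed (simp add: bump_outside)

lemma bump_test_field:
  assumes "cbox a b \<subseteq> \<Omega>"
  shows "(\<lambda>x. bump n a b x *\<^sub>R v) \<in> test_fields \<Omega>"
proof -
  have "(\<lambda>x. bump n a b x *\<^sub>R v) \<in> box_bumps (real (Suc n)) a b"
  proof -
    let ?g = "\<lambda>i s. 1 * (flat 1 (real (Suc n) * (s - a $ i)) * flat 1 (real (Suc n) * (b $ i - s)))"
    have "\<forall>i. ?g i \<in> interval_bumps (real (Suc n)) (a $ i) (b $ i)" by (intro allI interval_bumps.base)
    then have "(\<lambda>x. (\<Prod>i\<in>UNIV. ?g i (x $ i)) *\<^sub>R v) \<in> box_bumps (real (Suc n)) a b"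
      unfolding box_bumps_def mem_Collect_eq by (intro exI[of _ ?g] exI[of _ v] conjI refl)
    then show ?thesis by (simp add: bump_def)
  qed
  then have "Ck k (\<lambda>x. bump n a b x *\<^sub>R v)" for k by (rule box_bumps_Ck)
  moreover have "closure {x. bump n a b x *\<^sub>R v \<noteq> 0} \<subseteq> cbox a b"
  proof (rule closure_minimal)
    show "{x. bump n a b x *\<^sub>R v \<noteq> 0} \<subseteq> cbox a b"
      using bump_outside[of _ a b n] box_subset_cbox[of a b] by auto
  qed (rule closed_cbox)
  moreover from this have "compact (closure {x. bump n a b x *\<^sub>R v \<noteq> 0})"
    by (meson bounded_cbox bounded_subset closed_closure compact_eq_bounded_closed)
  ultimately show ?thesis using assms unfolding test_fields_def by blast
qed

text \<open>
  Bumps times unit vectors are test fields, and they converge to indicators of boxes.  Thus every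
  component of \<open>G\<close> has integral zero over every box inside \<open>\<Omega>\<close>, and the Lebesgue differentiation theorem
  for cubes gives \<open>G = 0\<close> almost everywhere.
\<close>

lemma L2_orthogonal_test_fields:
  fixes \<Omega> :: "(real^3) set"
  assumes \<Omega>: "open \<Omega>" and G: "G \<in> L2 (lebesgue_on \<Omega>)"
    and orth: "\<And>\<phi>. \<phi> \<in> test_fields \<Omega> \<Longrightarrow> (\<integral>x. G x \<bullet> \<phi> x \<partial>lebesgue_on \<Omega>) = 0"
  shows "AE x in lebesgue_on \<Omega>. G x = 0"
proof -
  have \<Omega>b: "\<Omega> \<in> sets borel" using \<Omega> by simp
  obtain v where v: "v \<in> L2 lborel" "\<forall>x. x \<notin> \<Omega> \<longrightarrow> v x = 0" "AE x in lebesgue_on \<Omega>. G x = v x"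
    by (rule L2_borel_version[OF \<Omega>b G])
  have vm: "v \<in> borel_measurable borel" using v by (simp add: L2_def)
  have vint: "integrable lborel (\<lambda>x. indicator A x *\<^sub>R (v x $ k))" if A: "A \<in> sets borel" "bounded A" for A k
  proof -
    have "integrable lborel (\<lambda>x. v x \<bullet> (indicator A x *\<^sub>R axis k 1))"
    proof (rule L2_inner_integrable[OF v(1)])
      have "integrable lborel (indicator A :: _ \<Rightarrow> real)"
        using A emeasure_bounded_finite[OF A(2)] by simp
      moreover have "(\<lambda>x. (norm (indicator A x *\<^sub>R (axis k 1 :: real^3)))\<^sup>2) = indicator A"
        by (auto simp: fun_eq_iff indicator_def)
      ultimately show "(\<lambda>x. indicator A x *\<^sub>R (axis k 1 :: real^3)) \<in> L2 lborel"
        using A(1) by (simp add: L2_def)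
    qed
    then show ?thesis by (simp add: inner_axis)
  qed
  have zero: "(\<integral>x. indicator (box a b) x *\<^sub>R (v x $ k) \<partial>lborel) = 0" if ab: "cbox a b \<subseteq> \<Omega>" for a b :: "real^3" and k
  proof -
    have bm: "bump n a b \<in> borel_measurable borel" for n
    proof -
      have "Ck 0 (\<lambda>x. bump n a b x *\<^sub>R (axis 1 1 :: real^3))" using bump_test_field[OF ab] by (simp add: test_fields_def)
      then have "continuous_on UNIV (\<lambda>x. bump n a b x *\<^sub>R (axis 1 1 :: real^3))" by simp
      from continuous_on_inner[OF this continuous_on_const[of _ "axis 1 1"]]
      have "continuous_on UNIV (bump n a b)" by (simp add: inner_axis_axis)
      then show ?thesis by (rule borel_measurable_continuous_onI)
    qed
    have vk: "(\<lambda>x. v x $ k) \<in> borel_measurable borel"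
      using borel_measurable_inner[OF vm borel_measurable_const[of "axis k 1"]] by (simp add: inner_axis)
    have test: "(\<integral>x. bump n a b x *\<^sub>R (v x $ k) \<partial>lborel) = 0" for n
    proof -
      let ?\<phi> = "\<lambda>x. bump n a b x *\<^sub>R (axis k 1 :: real^3)"
      have "(\<integral>x. bump n a b x *\<^sub>R (v x $ k) \<partial>lborel) = (\<integral>x. v x \<bullet> ?\<phi> x \<partial>lborel)" by (simp add: inner_axis)
      also have "\<dots> = (\<integral>x. v x \<bullet> ?\<phi> x \<partial>lebesgue_on \<Omega>)"
        by (rule integral_lebesgue_on_borel[symmetric, OF \<Omega>b]) (use vm bm v(2) in auto)
      also have "\<dots> = (\<integral>x. G x \<bullet> ?\<phi> x \<partial>lebesgue_on \<Omega>)"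
      proof (rule integral_cong_AE)
        have p: "?\<phi> \<in> borel_measurable (lebesgue_on \<Omega>)" by (rule borel_imp_lebesgue_on) (use bm in measurable)
        show "(\<lambda>x. v x \<bullet> ?\<phi> x) \<in> borel_measurable (lebesgue_on \<Omega>)" "(\<lambda>x. G x \<bullet> ?\<phi> x) \<in> borel_measurable (lebesgue_on \<Omega>)"
          by (intro borel_measurable_inner p borel_imp_lebesgue_on vm L2D(1)[OF G])+
        show "AE x in lebesgue_on \<Omega>. v x \<bullet> ?\<phi> x = G x \<bullet> ?\<phi> x" using v(3) by eventually_elim simp
      qed
      also have "\<dots> = 0" by (rule orth[OF bump_test_field[OF ab]])
      finally show ?thesis .
    qed
    have "(\<lambda>n. \<integral>x. bump n a b x *\<^sub>R (v x $ k) \<partial>lborel) \<longlonglongrightarrow> (\<integral>x. indicator (box a b) x *\<^sub>R (v x $ k) \<partial>lborel)"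
    proof (rule integral_dominated_convergence[where w="\<lambda>x. \<bar>indicator (box a b) x *\<^sub>R (v x $ k)\<bar>"])
      show "integrable lborel (\<lambda>x. \<bar>indicator (box a b) x *\<^sub>R (v x $ k)\<bar>)"
        by (intro integrable_abs vint) auto
      show "AE x in lborel. (\<lambda>n. bump n a b x *\<^sub>R (v x $ k)) \<longlonglongrightarrow> indicator (box a b) x *\<^sub>R (v x $ k)"
        by (intro AE_I2 tendsto_intros bump_tendsto)
      show "AE x in lborel. norm (bump n a b x *\<^sub>R (v x $ k)) \<le> \<bar>indicator (box a b) x *\<^sub>R (v x $ k)\<bar>" for n
      proof (rule AE_I2)
        fix x
        show "norm (bump n a b x *\<^sub>R (v x $ k)) \<le> \<bar>indicator (box a b) x *\<^sub>R (v x $ k)\<bar>"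
          using bump_bounds[of n a b x] bump_outside[of x a b n]
          by (cases "x \<in> box a b") (auto simp: abs_mult intro: mult_left_le_one_le)
      qed
    qed (use bm vk in auto)
    then have "(\<lambda>n::nat. 0::real) \<longlonglongrightarrow> (\<integral>x. indicator (box a b) x *\<^sub>R (v x $ k) \<partial>lborel)" unfolding test .
    then show ?thesis by (simp add: LIMSEQ_const_iff)
  qed
  have comp: "AE x in lborel. v x $ k = 0" for k
  proof -
    let ?f = "\<lambda>x. v x $ k"
    have int: "?f integrable_on cbox a b" "integral (box a b) ?f = (\<integral>x. indicator (box a b) x *\<^sub>R ?f x \<partial>lborel)" for a b
    proof -
      have "set_integrable lborel (cbox a b) ?f" "set_integrable lborel (box a b) ?f"
        unfolding set_integrable_def by (rule vint; simp)+
      from set_borel_integral_eq_integral(1)[OF this(1)] set_borel_integral_eq_integral(2)[OF this(2)]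
      show "?f integrable_on cbox a b" "integral (box a b) ?f = (\<integral>x. indicator (box a b) x *\<^sub>R ?f x \<partial>lborel)"
        by (auto simp: set_lebesgue_integral_def)
    qed
    obtain N where N: "negligible N" "\<And>x e. \<lbrakk>x \<notin> N; 0 < e\<rbrakk> \<Longrightarrow>
               \<exists>d>0. \<forall>h. 0 < h \<and> h < d \<longrightarrow> norm(integral (cbox x (x + h *\<^sub>R One)) ?f /\<^sub>R h ^ DIM(real^3) - ?f x) < e"
      using integrable_ccontinuous_explicit[OF int(1)] by blast
    have "v x $ k = 0" if "x \<notin> N" for x
    proof (cases "x \<in> \<Omega>")
      case True
      then obtain r where r: "0 < r" "cball x r \<subseteq> \<Omega>" using \<Omega> open_contains_cball by blast
      show ?thesis
      proof (rule ccontr)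
        assume "v x $ k \<noteq> 0"
        then have "0 < \<bar>v x $ k\<bar>" by simp
        from N(2)[OF that this] obtain d where d: "0 < d"
          "\<And>h. 0 < h \<Longrightarrow> h < d \<Longrightarrow> norm(integral (cbox x (x + h *\<^sub>R One)) ?f /\<^sub>R h ^ DIM(real^3) - ?f x) < \<bar>v x $ k\<bar>" by blast
        \<comment> \<open>a cube of side \<open>h\<close> with corner \<open>x\<close> lies in the ball of radius \<open>3 h\<close>, by the bound of the norm by the sum norm\<close>
        define h where "h = min (d / 2) (r / 3)"
        have h: "0 < h" "h < d" "3 * h \<le> r" using d r by (auto simp: h_def)
        have "cbox x (x + h *\<^sub>R One) \<subseteq> cball x r"
        proof
          fix y assume mem: "y \<in> cbox x (x + h *\<^sub>R One)"
          have One_nth: "(One :: real^3) $ i = 1" for i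
            using inner_sum_left_Basis[of "axis i 1 :: real^3" "\<lambda>_. 1"] by (simp add: inner_axis del: sum_component)
          have y: "x $ i \<le> y $ i" "y $ i \<le> x $ i + h" for i
            using mem by (simp_all add: mem_box_cart One_nth del: sum_component)
          have "norm (y - x) \<le> (\<Sum>i\<in>UNIV. \<bar>(y - x) $ i\<bar>)" by (rule norm_le_l1_cart)
          also have "\<dots> \<le> (\<Sum>i\<in>(UNIV::3 set). h)"
          proof (rule sum_mono)
            fix i :: 3
            show "\<bar>(y - x) $ i\<bar> \<le> h" using y(1)[of i] y(2)[of i] h(1) by simp
          qed
          finally show "y \<in> cball x r" using h(3) by (simp add: dist_norm norm_minus_commute)
        qed
        then have "integral (cbox x (x + h *\<^sub>R One)) ?f = 0"
          using zero[of x "x + h *\<^sub>R One" k] r int(2)[of x "x + h *\<^sub>R One"]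
          by (simp add: integral_open_interval)
        with d(2)[OF h(1,2)] show False by simp
      qed
    qed (use v(2) in simp)
    then have "{x. v x $ k \<noteq> 0} \<subseteq> N" by blast
    then have "AE x in lebesgue. v x $ k = 0"
      using N(1) by (auto simp: negligible_iff_null_sets intro: AE_I')
    then show ?thesis by (simp add: AE_completion_iff)
  qed
  have "AE x in lborel. \<forall>k\<in>UNIV. v x $ k = 0"
    by (rule AE_finite_allI) (use comp in auto)
  then have "AE x in lborel. x \<in> \<Omega> \<longrightarrow> v x = 0" by eventually_elim (simp add: vec_eq_iff)
  then have "AE x in lebesgue_on \<Omega>. v x = 0" by (subst AE_lebesgue_on_iff) (use \<Omega>b in auto)
  with v(3) show ?thesis by eventually_elim simp
qed

section \<open>Integration by parts for the curl\<close>

lemma integrable_compact_support: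
  fixes f :: "'a::euclidean_space \<Rightarrow> 'b::euclidean_space"
  assumes "continuous_on UNIV f" "compact K" "\<And>x. x \<notin> K \<Longrightarrow> f x = 0"
  shows "integrable lborel f"
proof -
  have "integrable lborel (\<lambda>x. indicator K x *\<^sub>R f x)"
    by (rule borel_integrable_compact[OF assms(2) continuous_on_subset[OF assms(1)]]) simp
  moreover have "(\<lambda>x. indicator K x *\<^sub>R f x) = f" using assms(3) by (auto simp: fun_eq_iff indicator_def)
  ultimately show ?thesis by simp
qed

lemma L2_compact_support:
  fixes f :: "'a::euclidean_space \<Rightarrow> real^3"
  assumes f: "continuous_on UNIV f" and K: "compact K" "\<And>x. x \<notin> K \<Longrightarrow> f x = 0"
  shows "f \<in> L2 lborel"
proof -
  have "integrable lborel (\<lambda>x. (norm (f x))\<^sup>2)"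
    by (rule integrable_compact_support[OF _ K(1)]) (use f K(2) in \<open>auto intro!: continuous_intros\<close>)
  then show ?thesis using f by (auto simp: L2_def intro: borel_measurable_continuous_onI)
qed

text \<open>
  The difference quotients in direction \<open>b\<close> have integral zero by translation invariance.  They are
  bounded and live in one fixed ball, so dominated convergence applies.
\<close>

lemma integral_directional_derivative_eq_0:
  fixes f :: "'a::euclidean_space \<Rightarrow> real"
  assumes deriv: "\<And>x. (f has_derivative F x) (at x)" and cont: "continuous_on UNIV (\<lambda>x. F x b)"
    and K: "compact K" "\<And>x. x \<notin> K \<Longrightarrow> f x = 0" "\<And>x. x \<notin> K \<Longrightarrow> F x b = 0"
  shows "(\<integral>x. F x b \<partial>lborel) = 0"
proof -
  have fc: "continuous_on UNIV f"
    by (rule differentiable_imp_continuous_on) (use deriv in \<open>auto simp: differentiable_on_def differentiable_def\<close>)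
  have fi: "integrable lborel f" by (rule integrable_compact_support[OF fc K(1,2)])
  define s where "s n = inverse (real (Suc n))" for n
  have s: "0 < s n" "s n \<le> 1" for n by (auto simp: s_def field_simps)
  have s_lim: "s \<longlonglongrightarrow> 0" unfolding s_def by (rule LIMSEQ_inverse_real_of_nat)
  define q where "q n x = (f (x + s n *\<^sub>R b) - f x) / s n" for n x
  have line: "((\<lambda>t. f (x + t *\<^sub>R b)) has_real_derivative F (x + t *\<^sub>R b) b) (at t)" for x t
  proof -
    have "((\<lambda>t. x + t *\<^sub>R b) has_derivative (\<lambda>t. t *\<^sub>R b)) (at t)" by (auto intro!: derivative_eq_intros)
    from has_derivative_compose[OF this deriv]
    have "((\<lambda>t. f (x + t *\<^sub>R b)) has_derivative (\<lambda>h. F (x + t *\<^sub>R b) (h *\<^sub>R b))) (at t)" .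
    moreover have "F (x + t *\<^sub>R b) (h *\<^sub>R b) = F (x + t *\<^sub>R b) b * h" for h
      using linear_scale[OF has_derivative_linear[OF deriv]] by simp
    ultimately show ?thesis by (simp add: has_field_derivative_def)
  qed
  obtain B where B: "\<And>x. \<bar>F x b\<bar> \<le> B"
  proof -
    have "compact ((\<lambda>x. F x b) ` K)" by (rule compact_continuous_image[OF continuous_on_subset[OF cont] K(1)]) simp
    then obtain B where "\<And>x. x \<in> K \<Longrightarrow> \<bar>F x b\<bar> \<le> B" using compact_imp_bounded bounded_iff by (metis imageI real_norm_def)
    then have "\<bar>F x b\<bar> \<le> max B 0" for x using K(3)[of x] by (cases "x \<in> K") (auto simp: le_max_iff_disj)
    then show ?thesis by (rule that)
  qed
  obtain R where R: "\<And>x. x \<in> K \<Longrightarrow> norm x \<le> R" using compact_imp_bounded[OF K(1)] bounded_iff by blast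
  \<comment> \<open>if \<open>x\<close> or \<open>x + s b\<close> lies in \<open>K\<close> then \<open>|x| \<le> R + |b|\<close>, because \<open>s \<le> 1\<close>\<close>
  define L where "L = cball (0::'a) (R + norm b)"
  have q_le: "\<bar>q n x\<bar> \<le> B * indicator L x" for n x
  proof (cases "x \<in> L")
    case True
    obtain z where z: "0 < z" "z < s n" "f (x + s n *\<^sub>R b) - f (x + 0 *\<^sub>R b) = (s n - 0) * F (x + z *\<^sub>R b) b"
      using MVT2[OF s(1)[of n], of "\<lambda>t. f (x + t *\<^sub>R b)" "\<lambda>t. F (x + t *\<^sub>R b) b"] line by blast
    then have "q n x = F (x + z *\<^sub>R b) b" using s(1)[of n] by (simp add: q_def)
    then show ?thesis using B True by simp
  next
    case False
    then have nx: "norm x > R + norm b" by (simp add: L_def)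
    have "norm (s n *\<^sub>R b) \<le> norm b" using s[of n] by (simp add: mult_left_le_one_le)
    moreover have "norm x \<le> norm (x + s n *\<^sub>R b) + norm (s n *\<^sub>R b)"
      using norm_triangle_ineq4[of "x + s n *\<^sub>R b" "s n *\<^sub>R b"] by simp
    ultimately have "R < norm (x + s n *\<^sub>R b)" using nx by linarith
    then have "x + s n *\<^sub>R b \<notin> K" using R by force
    moreover have "x \<notin> K" using R[of x] nx norm_ge_zero[of b] by linarith
    ultimately show ?thesis using K(2) False by (simp add: q_def)
  qed
  have "(\<lambda>n. \<integral>x. q n x \<partial>lborel) \<longlonglongrightarrow> (\<integral>x. F x b \<partial>lborel)"
  proof (rule integral_dominated_convergence[where w="\<lambda>x. B * indicator L x"])
    show "(\<lambda>x. F x b) \<in> borel_measurable lborel" using borel_measurable_continuous_onI[OF cont] by simp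
    show "q n \<in> borel_measurable lborel" for n
    proof -
      have "continuous_on UNIV (\<lambda>x. f (x + s n *\<^sub>R b))"
        by (rule continuous_on_compose2[OF fc]) (auto intro!: continuous_intros)
      then have "continuous_on UNIV (q n)" unfolding q_def using s(1)[of n] fc by (auto intro!: continuous_intros)
      then show ?thesis using borel_measurable_continuous_onI by simp
    qed
    have "emeasure lborel L < \<infinity>" unfolding L_def by (rule emeasure_bounded_finite) simp
    moreover have "L \<in> sets borel" unfolding L_def by simp
    ultimately show "integrable lborel (\<lambda>x. B * indicator L x)" by simp
    show "AE x in lborel. (\<lambda>n. q n x) \<longlonglongrightarrow> F x b"
    proof (rule AE_I2)
      fix x
      have "((\<lambda>h. (f (x + (0 + h) *\<^sub>R b) - f (x + 0 *\<^sub>R b)) / h) \<longlongrightarrow> F (x + 0 *\<^sub>R b) b) (at 0)"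
        using line[of x 0] unfolding DERIV_def .
      moreover have "filterlim s (at 0) sequentially"
        using s_lim s(1) by (auto simp: filterlim_at less_imp_neq[symmetric])
      ultimately show "(\<lambda>n. q n x) \<longlonglongrightarrow> F x b" unfolding q_def
        using filterlim_compose by fastforce
    qed
    show "AE x in lborel. norm (q n x) \<le> B * indicator L x" for n using q_le by simp
  qed
  moreover have "(\<integral>x. q n x \<partial>lborel) = 0" for n
    unfolding q_def using fi integrable_translate[OF fi, of "s n *\<^sub>R b"] integral_translate[OF fi, of "s n *\<^sub>R b"]
    by simp
  ultimately show ?thesis by (simp add: LIMSEQ_const_iff)
qed

lemma
  fixes \<phi> :: "'a::euclidean_space \<Rightarrow> real^3"
  assumes \<phi>: "\<phi> \<in> test_fields S"
  shows test_field_has_derivative: "(\<phi> has_derivative frechet_derivative \<phi> (at x)) (at x)"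
    and test_field_continuous: "continuous_on UNIV \<phi>"
    and test_field_derivative_continuous: "b \<in> Basis \<Longrightarrow> continuous_on UNIV (\<lambda>x. frechet_derivative \<phi> (at x) b)"
    and test_field_support: "compact (closure {x. \<phi> x \<noteq> 0})" "closure {x. \<phi> x \<noteq> 0} \<subseteq> S"
    and test_field_outside: "x \<notin> closure {x. \<phi> x \<noteq> 0} \<Longrightarrow> \<phi> x = 0"
    and test_field_derivative_outside: "x \<notin> closure {x. \<phi> x \<noteq> 0} \<Longrightarrow> frechet_derivative \<phi> (at x) b = 0"
proof -
  have Ck: "Ck k \<phi>" for k using \<phi> by (simp add: test_fields_def)
  show c0: "continuous_on UNIV \<phi>" using Ck[of 0] by simp
  have d: "\<phi> differentiable_on UNIV" using Ck[of "Suc 0"] by simp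
  show "(\<phi> has_derivative frechet_derivative \<phi> (at x)) (at x)" for x
    using d by (simp add: differentiable_on_def frechet_derivative_works)
  show "continuous_on UNIV (\<lambda>x. frechet_derivative \<phi> (at x) b)" if "b \<in> Basis"
    using Ck[of "Suc 0"] that by simp
  show "compact (closure {x. \<phi> x \<noteq> 0})" "closure {x. \<phi> x \<noteq> 0} \<subseteq> S" using \<phi> by (auto simp: test_fields_def)
  define K where "K = closure {x. \<phi> x \<noteq> 0}"
  have out: "\<phi> y = 0" if "y \<notin> K" for y
    using that subsetD[OF closure_subset, of y "{x. \<phi> x \<noteq> 0}"] unfolding K_def by (cases "\<phi> y = 0") simp_all
  have "closed K" unfolding K_def by simp
  show "\<phi> x = 0" if "x \<notin> closure {x. \<phi> x \<noteq> 0}" using out that unfolding K_def by blast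
  show "frechet_derivative \<phi> (at x) b = 0" if "x \<notin> closure {x. \<phi> x \<noteq> 0}"
  proof -
    have "x \<in> - K" using that unfolding K_def by simp
    have "((\<lambda>x. 0 :: real^3) has_derivative (\<lambda>h. 0)) (at x)" by simp
    then have "(\<phi> has_derivative (\<lambda>h. 0)) (at x)"
      by (rule has_derivative_transform_within_open[OF _ _ \<open>x \<in> - K\<close>]) (use \<open>closed K\<close> in \<open>auto simp: out\<close>)
    from fun_cong[OF frechet_derivative_at[OF this], of b] show ?thesis by simp
  qed
qed

lemma test_field_L2:
  fixes \<phi> :: "'a::euclidean_space \<Rightarrow> real^3"
  assumes \<phi>: "\<phi> \<in> test_fields S"
  shows "\<phi> \<in> L2 lborel" and "b \<in> Basis \<Longrightarrow> (\<lambda>x. frechet_derivative \<phi> (at x) b) \<in> L2 lborel"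
proof -
  show "\<phi> \<in> L2 lborel"
    by (rule L2_compact_support[OF test_field_continuous[OF \<phi>] test_field_support(1)[OF \<phi>]])
      (rule test_field_outside[OF \<phi>])
  show "(\<lambda>x. frechet_derivative \<phi> (at x) b) \<in> L2 lborel" if "b \<in> Basis"
    by (rule L2_compact_support[OF test_field_derivative_continuous[OF \<phi> that] test_field_support(1)[OF \<phi>]])
      (rule test_field_derivative_outside[OF \<phi>])
qed

lemma axis_Basis: "axis i (1::real) \<in> (Basis :: (real^3) set)" by (auto simp: Basis_vec_def)

lemma
  assumes \<phi>: "\<phi> \<in> test_fields S" and \<chi>: "\<psi> \<in> test_fields S'"
  shows integral_partial_product: "(\<integral>x. partial i \<phi> x $ j * \<psi> x $ k + \<phi> x $ j * partial i \<psi> x $ k \<partial>lborel) = 0"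
    and integrable_partial_product: "integrable lborel (\<lambda>x. partial i \<phi> x $ j * \<psi> x $ k + \<phi> x $ j * partial i \<psi> x $ k)"
proof -
  let ?F = "\<lambda>x y. frechet_derivative \<phi> (at x) y $ j * \<psi> x $ k + \<phi> x $ j * frechet_derivative \<psi> (at x) y $ k"
  let ?K = "closure {x. \<phi> x \<noteq> 0}"
  have D: "((\<lambda>x. \<phi> x $ j * \<psi> x $ k) has_derivative ?F x) (at x)" for x
  proof -
    have "((\<lambda>x. \<phi> x $ j) has_derivative (\<lambda>y. frechet_derivative \<phi> (at x) y $ j)) (at x)"
      by (rule bounded_linear.has_derivative[OF bounded_linear_vec_nth test_field_has_derivative[OF \<phi>]])
    moreover have "((\<lambda>x. \<psi> x $ k) has_derivative (\<lambda>y. frechet_derivative \<psi> (at x) y $ k)) (at x)"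
      by (rule bounded_linear.has_derivative[OF bounded_linear_vec_nth test_field_has_derivative[OF \<chi>]])
    ultimately show ?thesis
      by (rule has_derivative_eq_rhs[OF has_derivative_mult]) (simp add: add.commute)
  qed
  have cont: "continuous_on UNIV (\<lambda>x. ?F x (axis i 1))"
    by (intro continuous_intros continuous_on_component test_field_continuous[OF \<phi>] test_field_continuous[OF \<chi>]
      test_field_derivative_continuous[OF \<phi> axis_Basis] test_field_derivative_continuous[OF \<chi> axis_Basis])
  have out: "\<phi> x = 0" "?F x (axis i 1) = 0" if "x \<notin> ?K" for x
    using test_field_outside[OF \<phi> that] test_field_derivative_outside[OF \<phi> that] by simp_all
  have prod0: "\<phi> x $ j * \<psi> x $ k = 0" if "x \<notin> ?K" for x by (simp add: out(1)[OF that])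
  show "integrable lborel (\<lambda>x. partial i \<phi> x $ j * \<psi> x $ k + \<phi> x $ j * partial i \<psi> x $ k)"
    unfolding partial_def by (rule integrable_compact_support[OF cont test_field_support(1)[OF \<phi>] out(2)])
  show "(\<integral>x. partial i \<phi> x $ j * \<psi> x $ k + \<phi> x $ j * partial i \<psi> x $ k \<partial>lborel) = 0"
    unfolding partial_def
    by (rule integral_directional_derivative_eq_0[where f="\<lambda>x. \<phi> x $ j * \<psi> x $ k" and F="?F" and b="axis i 1", OF D cont test_field_support(1)[OF \<phi>] prod0 out(2)])
qed

lemma curl_test_field_L2:
  assumes \<phi>: "\<phi> \<in> test_fields S"
  shows "curl \<phi> \<in> L2 lborel"
proof (rule L2_compact_support[OF _ test_field_support(1)[OF \<phi>]])
  have c: "continuous_on UNIV (\<lambda>x. partial i \<phi> x $ j)" for i j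
    unfolding partial_def by (intro continuous_on_component test_field_derivative_continuous[OF \<phi> axis_Basis])
  have "continuous_on UNIV (\<lambda>x. curl \<phi> x $ 1)" "continuous_on UNIV (\<lambda>x. curl \<phi> x $ 2)"
    "continuous_on UNIV (\<lambda>x. curl \<phi> x $ 3)"
    by (simp_all add: curl_def continuous_on_diff c)
  then have "continuous_on UNIV (\<lambda>x. curl \<phi> x $ i)" for i
    using exhaust_3[of i] by auto
  then have "continuous_on UNIV (\<lambda>x. \<chi> i. curl \<phi> x $ i)" by (rule continuous_on_vec_lambda)
  then show "continuous_on UNIV (curl \<phi>)" by simp
  fix x assume "x \<notin> closure {x. \<phi> x \<noteq> 0}"
  then have "partial i \<phi> x = 0" for i unfolding partial_def by (rule test_field_derivative_outside[OF \<phi>])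
  then show "curl \<phi> x = 0" by (simp add: curl_def vec_eq_iff forall_3)
qed

lemma test_field_zero:
  assumes \<phi>: "\<phi> \<in> test_fields S" and x: "x \<notin> S"
  shows "\<phi> x = 0"
  by (rule test_field_outside[OF \<phi> contra_subsetD[OF test_field_support(2)[OF \<phi>] x]])

text \<open>
  The difference \<open>\<phi> \<bullet> curl \<psi> - curl \<phi> \<bullet> \<psi>\<close> is the divergence of \<open>\<psi> \<times> \<phi>\<close>, hence a sum of partial
  derivatives of products of components.
\<close>

lemma curl_integration_by_parts:
  assumes \<phi>: "\<phi> \<in> test_fields S" and \<psi>: "\<psi> \<in> test_fields S'"
  shows "(\<integral>x. \<phi> x \<bullet> curl \<psi> x \<partial>lborel) = (\<integral>x. curl \<phi> x \<bullet> \<psi> x \<partial>lborel)"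
proof -
  let ?d = "\<lambda>i j k x. partial i \<phi> x $ j * \<psi> x $ k + \<phi> x $ j * partial i \<psi> x $ k"
  have i: "integrable lborel (\<lambda>x. \<phi> x \<bullet> curl \<psi> x)" "integrable lborel (\<lambda>x. curl \<phi> x \<bullet> \<psi> x)"
    by (intro L2_inner_integrable test_field_L2(1)[OF \<phi>] test_field_L2(1)[OF \<psi>] curl_test_field_L2[OF \<phi>] curl_test_field_L2[OF \<psi>])+
  have "(\<integral>x. \<phi> x \<bullet> curl \<psi> x \<partial>lborel) - (\<integral>x. curl \<phi> x \<bullet> \<psi> x \<partial>lborel) = (\<integral>x. \<phi> x \<bullet> curl \<psi> x - curl \<phi> x \<bullet> \<psi> x \<partial>lborel)"
    using i by simp
  also have "\<dots> = (\<integral>x. (?d 2 1 3 x - ?d 3 1 2 x) + (?d 3 2 1 x - ?d 1 2 3 x) + (?d 1 3 2 x - ?d 2 3 1 x) \<partial>lborel)"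
    by (rule Bochner_Integration.integral_cong[OF refl]) (simp add: curl_def inner_vec_def sum_3 algebra_simps)
  also have "\<dots> = 0"
    using integrable_partial_product[OF \<phi> \<psi>] integral_partial_product[OF \<phi> \<psi>] by (simp only: Bochner_Integration.integral_add Bochner_Integration.integral_diff
      Bochner_Integration.integrable_add Bochner_Integration.integrable_diff)
  finally show ?thesis by simp
qed

section \<open>The spaces of fields with a weak curl\<close>

lemma weak_curl_works: "u \<in> V \<Omega> \<Longrightarrow> has_weak_curl \<Omega> u (weak_curl \<Omega> u)"
  unfolding V_def weak_curl_def using someI_ex[of "has_weak_curl \<Omega> u"] by simp

lemma V_L2: "u \<in> V \<Omega> \<Longrightarrow> u \<in> L2 (lebesgue_on \<Omega>)" "u \<in> V \<Omega> \<Longrightarrow> weak_curl \<Omega> u \<in> L2 (lebesgue_on \<Omega>)"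
  using weak_curl_works[of u \<Omega>] by (auto simp: V_def has_weak_curl_def)

lemma test_field_L2_on: "open \<Omega> \<Longrightarrow> \<phi> \<in> test_fields \<Omega> \<Longrightarrow> \<phi> \<in> L2 (lebesgue_on \<Omega>)"
  by (rule L2_lebesgue_on[OF _ test_field_L2(1)]) auto

lemma has_weak_curl_unique:
  assumes \<Omega>: "open \<Omega>" and F: "has_weak_curl \<Omega> u F" and G: "has_weak_curl \<Omega> u G"
  shows "AE x in lebesgue_on \<Omega>. F x = G x"
proof -
  have L: "F \<in> L2 (lebesgue_on \<Omega>)" "G \<in> L2 (lebesgue_on \<Omega>)" using F G by (auto simp: has_weak_curl_def)
  have "AE x in lebesgue_on \<Omega>. F x - G x = 0"
  proof (rule L2_orthogonal_test_fields[OF \<Omega> L2_diff[OF L]])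
    fix \<phi> assume \<phi>: "\<phi> \<in> test_fields \<Omega>"
    have "(\<integral>x. (F x - G x) \<bullet> \<phi> x \<partial>lebesgue_on \<Omega>) = L2_inner (lebesgue_on \<Omega>) F \<phi> - L2_inner (lebesgue_on \<Omega>) G \<phi>"
      using L2_inner_diff_left[OF L test_field_L2_on[OF \<Omega> \<phi>]] by (simp add: L2_inner_def)
    then show "(\<integral>x. (F x - G x) \<bullet> \<phi> x \<partial>lebesgue_on \<Omega>) = 0"
      using F G \<phi> by (simp add: has_weak_curl_def L2_inner_def)
  qed
  then show ?thesis by eventually_elim simp
qed

text \<open>
  Since weak curls are unique up to null sets, any weak curl may stand for the chosen one.
\<close>

lemma has_weak_curl_imp:
  assumes \<Omega>: "open \<Omega>" and u: "u \<in> L2 (lebesgue_on \<Omega>)" and F: "has_weak_curl \<Omega> u F"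
  shows "u \<in> V \<Omega>" "AE x in lebesgue_on \<Omega>. weak_curl \<Omega> u x = F x"
proof -
  show "u \<in> V \<Omega>" using u F by (auto simp: V_def)
  from has_weak_curl_unique[OF \<Omega> weak_curl_works[OF this] F] show "AE x in lebesgue_on \<Omega>. weak_curl \<Omega> u x = F x" .
qed

lemma has_weak_curl_test_field:
  assumes \<Omega>: "open \<Omega>" and \<phi>: "\<phi> \<in> test_fields \<Omega>"
  shows "has_weak_curl \<Omega> \<phi> (curl \<phi>)"
proof -
  have \<Omega>b: "\<Omega> \<in> sets borel" using \<Omega> by simp
  have b: "\<psi> \<in> borel_measurable borel" "curl \<psi> \<in> borel_measurable borel" if "\<psi> \<in> test_fields \<Omega>" for \<psi>
    using test_field_L2(1)[OF that] curl_test_field_L2[OF that] by (simp_all add: L2_def)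
  have "(\<integral>x. \<phi> x \<bullet> curl \<psi> x \<partial>lebesgue_on \<Omega>) = (\<integral>x. curl \<phi> x \<bullet> \<psi> x \<partial>lebesgue_on \<Omega>)" if \<psi>: "\<psi> \<in> test_fields \<Omega>" for \<psi>
    using curl_integration_by_parts[OF \<phi> \<psi>] b[OF \<phi>] b[OF \<psi>] test_field_zero[OF \<phi>] test_field_zero[OF \<psi>]
    by (simp add: integral_lebesgue_on_borel[OF \<Omega>b])
  then show ?thesis using L2_lebesgue_on[OF \<Omega>b curl_test_field_L2[OF \<phi>]] by (simp add: has_weak_curl_def)
qed

lemma test_fields_V:
  assumes \<Omega>: "open \<Omega>" and \<phi>: "\<phi> \<in> test_fields \<Omega>"
  shows "\<phi> \<in> V \<Omega>" "AE x in lebesgue_on \<Omega>. weak_curl \<Omega> \<phi> x = curl \<phi> x"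
  using has_weak_curl_imp[OF \<Omega> test_field_L2_on[OF \<Omega> \<phi>] has_weak_curl_test_field[OF \<Omega> \<phi>]] by auto

text \<open>
  For a test field \<open>\<phi>\<close> the identity that defines \<open>V\<^sub>0\<close> is the definition of the weak curl of \<open>\<psi>\<close>.
\<close>

lemma test_fields_V0:
  assumes \<Omega>: "open \<Omega>" and \<phi>: "\<phi> \<in> test_fields \<Omega>"
  shows "\<phi> \<in> V0 \<Omega>"
  unfolding V0_def
proof (intro CollectI conjI ballI)
  show \<phi>V: "\<phi> \<in> V \<Omega>" by (rule test_fields_V(1)[OF \<Omega> \<phi>])
  fix \<psi> assume \<psi>: "\<psi> \<in> V \<Omega>"
  have \<Omega>b: "\<Omega> \<in> sets borel" using \<Omega> by simp
  have "(\<integral>x. weak_curl \<Omega> \<phi> x \<bullet> \<psi> x \<partial>lebesgue_on \<Omega>) = (\<integral>x. curl \<phi> x \<bullet> \<psi> x \<partial>lebesgue_on \<Omega>)"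
    using L2_inner_cong_AE[OF V_L2(2)[OF \<phi>V] L2_lebesgue_on[OF \<Omega>b curl_test_field_L2[OF \<phi>]] V_L2(1)[OF \<psi>] V_L2(1)[OF \<psi>]
      test_fields_V(2)[OF \<Omega> \<phi>]] by (simp add: L2_inner_def)
  also have "\<dots> = (\<integral>x. \<psi> x \<bullet> curl \<phi> x \<partial>lebesgue_on \<Omega>)" by (simp add: inner_commute)
  also have "\<dots> = (\<integral>x. weak_curl \<Omega> \<psi> x \<bullet> \<phi> x \<partial>lebesgue_on \<Omega>)"
    using weak_curl_works[OF \<psi>] \<phi> by (simp add: has_weak_curl_def)
  finally show "(\<integral>x. weak_curl \<Omega> \<phi> x \<bullet> \<psi> x \<partial>lebesgue_on \<Omega>) = (\<integral>x. \<phi> x \<bullet> weak_curl \<Omega> \<psi> x \<partial>lebesgue_on \<Omega>)"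
    by (simp add: inner_commute)
qed

lemma
  assumes \<Omega>: "open \<Omega>" and u: "u \<in> V \<Omega>"
  shows V_scaleR: "(\<lambda>x. c *\<^sub>R u x) \<in> V \<Omega>"
    and weak_curl_scaleR: "AE x in lebesgue_on \<Omega>. weak_curl \<Omega> (\<lambda>x. c *\<^sub>R u x) x = c *\<^sub>R weak_curl \<Omega> u x"
proof -
  have "has_weak_curl \<Omega> (\<lambda>x. c *\<^sub>R u x) (\<lambda>x. c *\<^sub>R weak_curl \<Omega> u x)"
    using weak_curl_works[OF u] by (auto simp: has_weak_curl_def intro: L2_scaleR)
  from has_weak_curl_imp[OF \<Omega> L2_scaleR[OF V_L2(1)[OF u]] this]
  show "(\<lambda>x. c *\<^sub>R u x) \<in> V \<Omega>" "AE x in lebesgue_on \<Omega>. weak_curl \<Omega> (\<lambda>x. c *\<^sub>R u x) x = c *\<^sub>R weak_curl \<Omega> u x"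
    by auto
qed

lemma V0_scaleR:
  assumes \<Omega>: "open \<Omega>" and u: "u \<in> V0 \<Omega>"
  shows "(\<lambda>x. c *\<^sub>R u x) \<in> V0 \<Omega>"
  unfolding V0_def
proof (intro CollectI conjI ballI)
  have uV: "u \<in> V \<Omega>" using u by (simp add: V0_def)
  show cu: "(\<lambda>x. c *\<^sub>R u x) \<in> V \<Omega>" by (rule V_scaleR[OF \<Omega> uV])
  fix \<psi> assume \<psi>: "\<psi> \<in> V \<Omega>"
  have "(\<integral>x. weak_curl \<Omega> (\<lambda>x. c *\<^sub>R u x) x \<bullet> \<psi> x \<partial>lebesgue_on \<Omega>) = (\<integral>x. (c *\<^sub>R weak_curl \<Omega> u x) \<bullet> \<psi> x \<partial>lebesgue_on \<Omega>)"
    using L2_inner_cong_AE[OF V_L2(2)[OF cu] L2_scaleR[OF V_L2(2)[OF uV]] V_L2(1)[OF \<psi>] V_L2(1)[OF \<psi>]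
      weak_curl_scaleR[OF \<Omega> uV]] by (simp add: L2_inner_def)
  also have "\<dots> = (\<integral>x. (c *\<^sub>R u x) \<bullet> weak_curl \<Omega> \<psi> x \<partial>lebesgue_on \<Omega>)"
    using u \<psi> by (simp add: V0_def)
  finally show "(\<integral>x. weak_curl \<Omega> (\<lambda>x. c *\<^sub>R u x) x \<bullet> \<psi> x \<partial>lebesgue_on \<Omega>) = (\<integral>x. (c *\<^sub>R u x) \<bullet> weak_curl \<Omega> \<psi> x \<partial>lebesgue_on \<Omega>)" .
qed

lemma V_norm_scaleR:
  assumes \<Omega>: "open \<Omega>" and u: "u \<in> V \<Omega>"
  shows "V_norm \<Omega> (\<lambda>x. c *\<^sub>R u x) = \<bar>c\<bar> * V_norm \<Omega> u"
proof -
  let ?w = "weak_curl \<Omega> u" and ?cw = "weak_curl \<Omega> (\<lambda>x. c *\<^sub>R u x)"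
  have "V_inner \<Omega> (\<lambda>x. c *\<^sub>R u x) (\<lambda>x. c *\<^sub>R u x)
    = (\<integral>x. c\<^sup>2 *\<^sub>R (u x \<bullet> u x + ?w x \<bullet> ?w x) \<partial>lebesgue_on \<Omega>)"
    unfolding V_inner_def
  proof (rule integral_cong_AE)
    note m = L2D(1)[OF V_L2(1)[OF u]] L2D(1)[OF V_L2(2)[OF u]] L2D(1)[OF V_L2(2)[OF V_scaleR[OF \<Omega> u, of c]]]
    note [measurable] = m
    show "(\<lambda>x. c *\<^sub>R u x \<bullet> c *\<^sub>R u x + ?cw x \<bullet> ?cw x) \<in> borel_measurable (lebesgue_on \<Omega>)"
      "(\<lambda>x. c\<^sup>2 *\<^sub>R (u x \<bullet> u x + ?w x \<bullet> ?w x)) \<in> borel_measurable (lebesgue_on \<Omega>)" by measurable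
    show "AE x in lebesgue_on \<Omega>. c *\<^sub>R u x \<bullet> c *\<^sub>R u x + ?cw x \<bullet> ?cw x = c\<^sup>2 *\<^sub>R (u x \<bullet> u x + ?w x \<bullet> ?w x)"
      using weak_curl_scaleR[OF \<Omega> u, of c] by eventually_elim (simp add: power2_eq_square algebra_simps)
  qed
  also have "\<dots> = c\<^sup>2 * V_inner \<Omega> u u" by (simp add: V_inner_def)
  finally show ?thesis by (simp add: V_norm_def real_sqrt_mult)
qed

section \<open>Energy of mollified fields\<close>

definition bounded_continuous :: "(real \<Rightarrow> real) set" where
  "bounded_continuous = {\<alpha>. continuous_on UNIV \<alpha> \<and> (\<exists>K. \<forall>s. \<bar>\<alpha> s\<bar> \<le> K)}"

lemma bounded_continuous_measurable: "\<alpha> \<in> bounded_continuous \<Longrightarrow> \<alpha> \<in> borel_measurable borel"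
  by (auto simp: bounded_continuous_def intro: borel_measurable_continuous_onI)

lemma bounded_continuous_combination:
  assumes "\<alpha> \<in> bounded_continuous" "\<beta> \<in> bounded_continuous"
  shows "(\<lambda>s. a * \<alpha> s + b * \<beta> s) \<in> bounded_continuous"
proof -
  from assms obtain K L where KL: "\<And>s. \<bar>\<alpha> s\<bar> \<le> K" "\<And>s. \<bar>\<beta> s\<bar> \<le> L" by (auto simp: bounded_continuous_def)
  have "\<bar>a * \<alpha> s + b * \<beta> s\<bar> \<le> \<bar>a\<bar> * K + \<bar>b\<bar> * L" for s
    by (rule order_trans[OF abs_triangle_ineq]) (auto simp: abs_mult intro!: add_mono mult_left_mono KL)
  moreover have "continuous_on UNIV (\<lambda>s. a * \<alpha> s + b * \<beta> s)"
    using assms by (auto simp: bounded_continuous_def intro!: continuous_intros)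
  ultimately show ?thesis unfolding bounded_continuous_def by blast
qed

lemma bounded_continuous_shift:
  assumes "\<alpha> \<in> bounded_continuous" shows "(\<lambda>s. \<alpha> (s - t)) \<in> bounded_continuous"
proof -
  have c: "continuous_on UNIV \<alpha>" using assms by (simp add: bounded_continuous_def)
  have "continuous_on UNIV (\<lambda>s. \<alpha> (s - t))"
    by (rule continuous_on_compose2[OF c]) (auto intro!: continuous_intros)
  then show ?thesis using assms by (auto simp: bounded_continuous_def)
qed

text \<open>
  Kernels whose translates \<open>\<theta>(s - t)\<close> depend differentiably on \<open>t\<close>, uniformly in \<open>s\<close>.
\<close>

definition C11_kernel :: "(real \<Rightarrow> real) \<Rightarrow> (real \<Rightarrow> real) \<Rightarrow> bool" where
  "C11_kernel \<theta> \<theta>' \<longleftrightarrow> \<theta> \<in> bounded_continuous \<and> \<theta>' \<in> bounded_continuous \<and>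
     (\<forall>s. (\<theta> has_real_derivative \<theta>' s) (at s)) \<and>
     (\<exists>L. \<forall>s k. \<bar>\<theta> (s + k) - \<theta> s - k * \<theta>' s\<bar> \<le> L * k\<^sup>2)"

lemma mollify_slice_integral:
  fixes u :: "'a::euclidean_space \<times> real \<Rightarrow> real^3"
  assumes "mollify u \<theta> \<in> L2 lborel"
  shows "integrable lborel (\<lambda>t. (L2_norm lborel (smear u (\<lambda>s. \<theta> (s - t))))\<^sup>2)"
    and "(\<integral>t. (L2_norm lborel (smear u (\<lambda>s. \<theta> (s - t))))\<^sup>2 \<partial>lborel) = (L2_norm lborel (mollify u \<theta>))\<^sup>2"
proof -
  have "integrable lborel (\<lambda>z. (norm (mollify u \<theta> z))\<^sup>2)" using assms by (simp add: L2_def)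
  then have i: "integrable (lborel \<Otimes>\<^sub>M lborel) (\<lambda>(x, t). (norm (mollify u \<theta> (x, t)))\<^sup>2)"
    by (simp add: lborel_prod split_beta')
  have eq: "(L2_norm lborel (smear u (\<lambda>s. \<theta> (s - t))))\<^sup>2 = (\<integral>x. (norm (mollify u \<theta> (x, t)))\<^sup>2 \<partial>lborel)" for t
    by (simp add: L2_norm_sq mollify_def)
  show "integrable lborel (\<lambda>t. (L2_norm lborel (smear u (\<lambda>s. \<theta> (s - t))))\<^sup>2)"
    unfolding eq by (rule lborel_pair.integrable_snd[OF i])
  show "(\<integral>t. (L2_norm lborel (smear u (\<lambda>s. \<theta> (s - t))))\<^sup>2 \<partial>lborel) = (L2_norm lborel (mollify u \<theta>))\<^sup>2"
    unfolding eq lborel_pair.integral_snd[OF i] by (simp add: lborel_prod split_beta' L2_norm_sq)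
qed

locale space_time =
  fixes \<Omega> :: "(real^3) set" and T :: real
  assumes open_\<Omega>: "open \<Omega>" and T_pos: "0 < T"
begin

abbreviation "M \<equiv> lebesgue_on \<Omega>"

lemma \<Omega>_borel: "\<Omega> \<in> sets borel" using open_\<Omega> by simp

text \<open>
  Borel measurable representatives on the whole of \<open>real^3 \<times> real\<close> of elements of \<open>L\<^sup>2(Q\<^sub>T)\<^sup>3\<close>.
\<close>

definition field :: "((real^3) \<times> real \<Rightarrow> real^3) \<Rightarrow> bool" where
  "field u \<longleftrightarrow> u \<in> L2 lborel \<and> (\<forall>z. z \<notin> QT \<Omega> T \<longrightarrow> u z = 0)"

lemma field_L2: "field u \<Longrightarrow> u \<in> L2 lborel" by (simp add: field_def)

lemma field_time: "field u \<Longrightarrow> time_supported T u"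
  by (auto simp: field_def time_supported_def QT_def)

lemma smear_outside: "field u \<Longrightarrow> x \<notin> \<Omega> \<Longrightarrow> smear u \<eta> x = 0"
  by (simp add: field_def smear_def QT_def)

lemma smear_in_lborel: "field u \<Longrightarrow> \<alpha> \<in> bounded_continuous \<Longrightarrow> smear u \<alpha> \<in> L2 lborel"
  using smear_L2[OF field_L2 field_time bounded_continuous_measurable, of u \<alpha>] T_pos
  by (auto simp: bounded_continuous_def)

lemma smear_in: "field u \<Longrightarrow> \<alpha> \<in> bounded_continuous \<Longrightarrow> smear u \<alpha> \<in> L2 M"
  by (rule L2_lebesgue_on[OF \<Omega>_borel smear_in_lborel])

lemma smear_norm_eq: "field u \<Longrightarrow> \<alpha> \<in> bounded_continuous \<Longrightarrow> L2_norm M (smear u \<alpha>) = L2_norm lborel (smear u \<alpha>)"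
  using smear_in_lborel[of u \<alpha>] by (intro L2_norm_lebesgue_on_eq \<Omega>_borel) (auto simp: L2_def smear_outside)

lemma smear_norm_le:
  assumes "field u" "\<alpha> \<in> bounded_continuous" "\<And>s. \<bar>\<alpha> s\<bar> \<le> a"
  shows "L2_norm M (smear u \<alpha>) \<le> a * sqrt T * L2_norm lborel u"
proof -
  have "0 \<le> a" using assms(3)[of 0] by simp
  then show ?thesis unfolding smear_norm_eq[OF assms(1,2)]
    using smear_bound[OF field_L2 field_time bounded_continuous_measurable, of u \<alpha> a] assms T_pos by simp
qed

lemma smear_combination:
  assumes u: "field u" and "\<alpha> \<in> bounded_continuous" "\<beta> \<in> bounded_continuous"
  shows "AE x in M. smear u (\<lambda>s. a * \<alpha> s + b * \<beta> s) x = a *\<^sub>R smear u \<alpha> x + b *\<^sub>R smear u \<beta> x"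
proof -
  from assms(2,3) obtain K L where KL: "\<And>s. \<bar>\<alpha> s\<bar> \<le> K" "\<And>s. \<bar>\<beta> s\<bar> \<le> L" by (auto simp: bounded_continuous_def)
  have "AE x in lborel. smear u (\<lambda>s. a * \<alpha> s + b * \<beta> s) x = a *\<^sub>R smear u \<alpha> x + b *\<^sub>R smear u \<beta> x"
    by (rule smear_linear_AE[OF field_L2[OF u] field_time[OF u], where K="max K L"])
      (use assms KL in \<open>auto intro: bounded_continuous_measurable simp: le_max_iff_disj\<close>)
  then have "AE x in lborel. x \<in> \<Omega> \<longrightarrow> smear u (\<lambda>s. a * \<alpha> s + b * \<beta> s) x = a *\<^sub>R smear u \<alpha> x + b *\<^sub>R smear u \<beta> x"
    by eventually_elim simp
  then show ?thesis using AE_lebesgue_on_iff[of \<Omega>] \<Omega>_borel by auto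
qed

text \<open>
  With \<open>A = \<epsilon>\<close> and \<open>A = \<mu>\<close> these are the two parts of the energy, regarded as bilinear forms in functions
  of time.
\<close>

definition weighted :: "(real^3 \<Rightarrow> real^3^3) \<Rightarrow> ((real^3) \<times> real \<Rightarrow> real^3) \<Rightarrow> (real \<Rightarrow> real) \<Rightarrow> (real \<Rightarrow> real) \<Rightarrow> real" where
  "weighted A u \<alpha> \<beta> = L2_inner M (\<lambda>x. A x *v smear u \<alpha> x) (smear u \<beta>)"

lemma weighted_combination:
  assumes A: "bounded_measurable_entries \<Omega> A" and u: "field u"
    and C: "\<alpha> \<in> bounded_continuous" "\<beta> \<in> bounded_continuous" "\<gamma> \<in> bounded_continuous"
  shows "weighted A u (\<lambda>s. a * \<alpha> s + b * \<beta> s) \<gamma> = a * weighted A u \<alpha> \<gamma> + b * weighted A u \<beta> \<gamma>"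
proof -
  note S = smear_in[OF u C(1)] smear_in[OF u C(2)] smear_in[OF u C(3)]
  note S' = S(1,2)[THEN L2_matrix_mult[OF A]]
  have "weighted A u (\<lambda>s. a * \<alpha> s + b * \<beta> s) \<gamma>
    = L2_inner M (\<lambda>x. a *\<^sub>R (A x *v smear u \<alpha> x) + b *\<^sub>R (A x *v smear u \<beta> x)) (smear u \<gamma>)"
    unfolding weighted_def
  proof (rule L2_inner_cong_AE)
    show "AE x in M. A x *v smear u (\<lambda>s. a * \<alpha> s + b * \<beta> s) x = a *\<^sub>R (A x *v smear u \<alpha> x) + b *\<^sub>R (A x *v smear u \<beta> x)"
      using smear_combination[OF u C(1,2), of a b]
      by eventually_elim (simp add: matrix_vector_right_distrib matrix_vector_mult_scaleR)
  qed (intro L2_matrix_mult[OF A] smear_in[OF u] bounded_continuous_combination C L2_add L2_scaleR S S' AE_I2 refl)+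
  also have "\<dots> = a * weighted A u \<alpha> \<gamma> + b * weighted A u \<beta> \<gamma>"
    unfolding weighted_def
    by (subst L2_inner_add_left) (auto intro: L2_scaleR S S' simp: L2_inner_scaleR_left)
  finally show ?thesis .
qed

lemma weighted_sym:
  assumes "\<forall>x\<in>\<Omega>. transpose (A x) = A x"
  shows "weighted A u \<alpha> \<beta> = weighted A u \<beta> \<alpha>"
  unfolding weighted_def by (subst L2_inner_matrix_sym[OF assms]) (rule L2_inner_commute)

lemma weighted_bound:
  assumes A: "bounded_measurable_entries \<Omega> A" and u: "field u"
  obtains c where "0 \<le> c"
    "\<And>\<alpha> \<beta>. \<alpha> \<in> bounded_continuous \<Longrightarrow> \<beta> \<in> bounded_continuous \<Longrightarrow>
      \<bar>weighted A u \<alpha> \<beta>\<bar> \<le> c * L2_norm M (smear u \<alpha>) * L2_norm M (smear u \<beta>)"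
proof -
  from L2_matrix_mult_bound[OF A] obtain c where c: "0 \<le> c"
    "\<And>w. w \<in> L2 M \<Longrightarrow> L2_norm M (\<lambda>x. A x *v w x) \<le> c * L2_norm M w" by blast
  have "\<bar>weighted A u \<alpha> \<beta>\<bar> \<le> c * L2_norm M (smear u \<alpha>) * L2_norm M (smear u \<beta>)"
    if C: "\<alpha> \<in> bounded_continuous" "\<beta> \<in> bounded_continuous" for \<alpha> \<beta>
  proof -
    have "\<bar>weighted A u \<alpha> \<beta>\<bar> \<le> L2_norm M (\<lambda>x. A x *v smear u \<alpha> x) * L2_norm M (smear u \<beta>)"
      unfolding weighted_def by (intro L2_Cauchy_Schwarz L2_matrix_mult[OF A] smear_in[OF u] C)
    also have "\<dots> \<le> c * L2_norm M (smear u \<alpha>) * L2_norm M (smear u \<beta>)"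
      by (intro mult_right_mono c smear_in[OF u] C) simp
    finally show ?thesis .
  qed
  with c(1) that show ?thesis by blast
qed

end

text \<open>
  The balance law is the part of the Maxwell system on which the energy method rests.
\<close>

locale smeared_maxwell = space_time +
  fixes \<epsilon> \<mu> :: "real^3 \<Rightarrow> real^3^3" and eps mu :: real and e h J :: "(real^3) \<times> real \<Rightarrow> real^3"
  assumes \<epsilon>: "coefficient \<Omega> \<epsilon> eps" and \<mu>: "coefficient \<Omega> \<mu> mu"
    and e: "field e" and h: "field h" and J: "field J"
    and balance: "\<And>\<eta> \<eta>'. \<eta> \<in> bounded_continuous \<Longrightarrow> \<eta>' \<in> bounded_continuous \<Longrightarrow>
      (\<And>s. (\<eta> has_real_derivative \<eta>' s) (at s)) \<Longrightarrow> \<eta> 0 = 0 \<Longrightarrow> \<eta> T = 0 \<Longrightarrow>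
      weighted \<epsilon> e \<eta>' \<eta> + weighted \<mu> h \<eta>' \<eta> = L2_inner M (smear J \<eta>) (smear e \<eta>)"
begin

text \<open>
  Along translates of \<open>\<theta>\<close> the energy has the derivative \<open>- 2 (J\<^sub>\<eta>, e\<^sub>\<eta>)\<close>, by the balance law and the symmetry
  of the coefficients.  Energy and derivative are bounded by squared norms of time slices of the
  mollifications, whose integrals in time are the squared norms over space-time.  The constant is
  the same for all kernels.
\<close>

lemma energy_estimate:
  assumes ab: "a < b"
  obtains C where "\<And>\<theta> \<theta>' t. C11_kernel \<theta> \<theta>' \<Longrightarrow> (\<And>t. t \<in> {a..b} \<Longrightarrow> \<theta> (- t) = 0 \<and> \<theta> (T - t) = 0) \<Longrightarrow>
    mollify e \<theta> \<in> L2 lborel \<Longrightarrow> mollify h \<theta> \<in> L2 lborel \<Longrightarrow> mollify J \<theta> \<in> L2 lborel \<Longrightarrow> t \<in> {a..b} \<Longrightarrow>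
    (L2_norm M (smear e (\<lambda>s. \<theta> (s - t))))\<^sup>2 + (L2_norm M (smear h (\<lambda>s. \<theta> (s - t))))\<^sup>2
    \<le> C * ((L2_norm lborel (mollify e \<theta>))\<^sup>2 + (L2_norm lborel (mollify h \<theta>))\<^sup>2 + (L2_norm lborel (mollify J \<theta>))\<^sup>2)"
proof -
  have A: "bounded_measurable_entries \<Omega> \<epsilon>" "bounded_measurable_entries \<Omega> \<mu>"
    and symm: "\<forall>x\<in>\<Omega>. transpose (\<epsilon> x) = \<epsilon> x" "\<forall>x\<in>\<Omega>. transpose (\<mu> x) = \<mu> x"
    and pos: "0 < eps" "0 < mu"
    using \<epsilon> \<mu> by (auto simp: coefficient_def)
  from weighted_bound[OF A(1) e] obtain c1 where c1: "0 \<le> c1"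
    "\<And>\<alpha> \<beta>. \<alpha> \<in> bounded_continuous \<Longrightarrow> \<beta> \<in> bounded_continuous \<Longrightarrow>
      \<bar>weighted \<epsilon> e \<alpha> \<beta>\<bar> \<le> c1 * L2_norm M (smear e \<alpha>) * L2_norm M (smear e \<beta>)" by blast
  from weighted_bound[OF A(2) h] obtain c2 where c2: "0 \<le> c2"
    "\<And>\<alpha> \<beta>. \<alpha> \<in> bounded_continuous \<Longrightarrow> \<beta> \<in> bounded_continuous \<Longrightarrow>
      \<bar>weighted \<mu> h \<alpha> \<beta>\<bar> \<le> c2 * L2_norm M (smear h \<alpha>) * L2_norm M (smear h \<beta>)" by blast
  define B where "B \<alpha> \<beta> = weighted \<epsilon> e \<alpha> \<beta> + weighted \<mu> h \<alpha> \<beta>" for \<alpha> \<beta>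
  define c where "c = c1 * T * (L2_norm lborel e)\<^sup>2 + c2 * T * (L2_norm lborel h)\<^sup>2"
  have Bbound: "\<bar>B \<alpha> \<beta>\<bar> \<le> c * p * q"
    if C: "\<alpha> \<in> bounded_continuous" "\<beta> \<in> bounded_continuous" and K: "\<And>s. \<bar>\<alpha> s\<bar> \<le> p" "\<And>s. \<bar>\<beta> s\<bar> \<le> q" for \<alpha> \<beta> p q
  proof -
    have pq: "0 \<le> p" "0 \<le> q" using K(1)[of 0] K(2)[of 0] by auto
    have one: "x * L2_norm M (smear u \<alpha>) * L2_norm M (smear u \<beta>) \<le> x * T * (L2_norm lborel u)\<^sup>2 * p * q"
      if x: "0 \<le> x" and u: "field u" for x u
    proof -
      have "L2_norm M (smear u \<alpha>) * L2_norm M (smear u \<beta>) \<le> (p * sqrt T * L2_norm lborel u) * (q * sqrt T * L2_norm lborel u)"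
        by (intro mult_mono smear_norm_le[OF u] C K) (use pq T_pos in auto)
      also have "\<dots> = T * (L2_norm lborel u)\<^sup>2 * p * q"
        using T_pos by (simp add: power2_eq_square)
      finally show ?thesis using mult_left_mono[OF _ x] by (simp add: mult.assoc)
    qed
    have "\<bar>B \<alpha> \<beta>\<bar> \<le> \<bar>weighted \<epsilon> e \<alpha> \<beta>\<bar> + \<bar>weighted \<mu> h \<alpha> \<beta>\<bar>" by (simp add: B_def)
    also have "\<dots> \<le> c1 * T * (L2_norm lborel e)\<^sup>2 * p * q + c2 * T * (L2_norm lborel h)\<^sup>2 * p * q"
      by (intro add_mono order_trans[OF c1(2)[OF C] one[OF c1(1) e]] order_trans[OF c2(2)[OF C] one[OF c2(1) h]])
    finally show ?thesis by (simp add: c_def algebra_simps)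
  qed
  have Blin: "B (\<lambda>s. p * \<alpha> s + q * \<beta> s) \<gamma> = p * B \<alpha> \<gamma> + q * B \<beta> \<gamma>"
    if "\<alpha> \<in> bounded_continuous" "\<beta> \<in> bounded_continuous" "\<gamma> \<in> bounded_continuous" for \<alpha> \<beta> \<gamma> p q
    unfolding B_def weighted_combination[OF A(1) e that] weighted_combination[OF A(2) h that] by (simp add: algebra_simps)
  have Bsym: "B \<alpha> \<beta> = B \<beta> \<alpha>" for \<alpha> \<beta>
    unfolding B_def by (simp add: weighted_sym[OF symm(1), of e \<alpha>] weighted_sym[OF symm(2), of h \<alpha>])
  have c0: "0 \<le> c" using c1(1) c2(1) T_pos by (simp add: c_def)
  define C where "C = (1 / eps + 1 / mu) * ((c1 + c2) / (b - a) + 1)"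
  have main: "(L2_norm M (smear e (\<lambda>s. \<theta> (s - t))))\<^sup>2 + (L2_norm M (smear h (\<lambda>s. \<theta> (s - t))))\<^sup>2
    \<le> C * ((L2_norm lborel (mollify e \<theta>))\<^sup>2 + (L2_norm lborel (mollify h \<theta>))\<^sup>2 + (L2_norm lborel (mollify J \<theta>))\<^sup>2)"
    if \<theta>: "C11_kernel \<theta> \<theta>'" and zero: "\<And>t. t \<in> {a..b} \<Longrightarrow> \<theta> (- t) = 0 \<and> \<theta> (T - t) = 0"
      and L2: "mollify e \<theta> \<in> L2 lborel" "mollify h \<theta> \<in> L2 lborel" "mollify J \<theta> \<in> L2 lborel" and t: "t \<in> {a..b}"
    for \<theta> \<theta>' t
  proof -
    let ?k = "\<lambda>t s. \<theta> (s - t)"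
    have bc: "\<theta> \<in> bounded_continuous" "\<theta>' \<in> bounded_continuous" using \<theta> by (auto simp: C11_kernel_def)
    note sh = bounded_continuous_shift[OF bc(1)] bounded_continuous_shift[OF bc(2)]
    from \<theta> obtain L where L: "\<And>s k. \<bar>\<theta> (s + k) - \<theta> s - k * \<theta>' s\<bar> \<le> L * k\<^sup>2" by (auto simp: C11_kernel_def)
    from bc obtain K1 K2 where "\<And>s. \<bar>\<theta> s\<bar> \<le> K1" "\<And>s. \<bar>\<theta>' s\<bar> \<le> K2" by (auto simp: bounded_continuous_def)
    then have K: "\<And>s. \<bar>\<theta> s\<bar> \<le> max K1 K2" "\<And>s. \<bar>\<theta>' s\<bar> \<le> max K1 K2" by (auto simp: le_max_iff_disj)
    have deriv: "((\<lambda>t. B (?k t) (?k t)) has_real_derivative - 2 * B (\<lambda>s. \<theta>' (s - t)) (?k t)) (at t)" for t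
      by (rule bilinear_energy_DERIV[where C=bounded_continuous and c=c and L=L and K="max K1 K2"])
        (intro Blin Bsym Bbound c0 sh L K bounded_continuous_combination; assumption)+
    \<comment> \<open>\<open>n u t\<close> is the squared norm of the time slice at \<open>t\<close> of the mollified field\<close>
    define n where "n u t = (L2_norm lborel (smear u (?k t)))\<^sup>2" for u :: "(real^3) \<times> real \<Rightarrow> real^3" and t
    define G where "G t = n e t + n h t + n J t" for t
    have nM: "(L2_norm M (smear u (?k t)))\<^sup>2 = n u t" if "field u" for u t
      unfolding n_def by (simp add: smear_norm_eq[OF that sh(1)])
    have n0: "0 \<le> n u t" for u t by (simp add: n_def)
    have G0: "0 \<le> G t" for t by (simp add: G_def n0)
    have intG: "integrable lborel G" "(\<integral>s. G s \<partial>lborel) = (L2_norm lborel (mollify e \<theta>))\<^sup>2 + (L2_norm lborel (mollify h \<theta>))\<^sup>2 + (L2_norm lborel (mollify J \<theta>))\<^sup>2"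
      unfolding G_def n_def using mollify_slice_integral[OF L2(1)] mollify_slice_integral[OF L2(2)] mollify_slice_integral[OF L2(3)]
      by simp_all
    have bal: "B (\<lambda>s. \<theta>' (s - t)) (?k t) = L2_inner M (smear J (?k t)) (smear e (?k t))" if "t \<in> {a..b}" for t
      unfolding B_def
    proof (rule balance[OF sh])
      fix s
      have "(\<theta> has_real_derivative \<theta>' (s - t)) (at (s - t))" using \<theta> by (simp add: C11_kernel_def)
      moreover have "((\<lambda>s. s - t) has_real_derivative 1) (at s)" by (auto intro!: derivative_eq_intros)
      ultimately show "(?k t has_real_derivative \<theta>' (s - t)) (at s)"
        using DERIV_chain2[where f=\<theta> and g="\<lambda>s. s - t" and x=s] by fastforce
    qed (use zero[OF that] in auto)
    have est: "B (?k t) (?k t) \<le> ((c1 + c2) / (b - a) + 1) * (\<integral>s. G s \<partial>lborel)"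
    proof (rule sup_le_integral[OF ab deriv intG(1)])
      fix t assume t: "t \<in> {a..b}"
      let ?x = "L2_norm M (smear J (?k t))" and ?y = "L2_norm M (smear e (?k t))"
      have "\<bar>L2_inner M (smear J (?k t)) (smear e (?k t))\<bar> \<le> ?x * ?y"
        by (intro L2_Cauchy_Schwarz smear_in sh e J)
      also have "2 * (?x * ?y) \<le> ?x\<^sup>2 + ?y\<^sup>2" using sum_squares_bound[of ?x ?y] by simp
      also have "\<dots> = n J t + n e t" using nM[OF J] nM[OF e] by simp
      finally show "\<bar>- 2 * B (\<lambda>s. \<theta>' (s - t)) (?k t)\<bar> \<le> G t"
        using n0[of h t] by (simp add: bal[OF t] G_def abs_mult)
      have "B (?k t) (?k t) \<le> c1 * n e t + c2 * n h t"
        using c1(2)[OF sh(1) sh(1), of t t] c2(2)[OF sh(1) sh(1), of t t]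
        unfolding B_def mult.assoc nM[OF e, of t, unfolded power2_eq_square] nM[OF h, of t, unfolded power2_eq_square]
        by linarith
      also have "\<dots> \<le> (c1 + c2) * G t"
      proof -
        have "c1 * n e t \<le> c1 * G t" "c2 * n h t \<le> c2 * G t"
          using n0[of e t] n0[of h t] n0[of J t] c1(1) c2(1) by (auto simp: G_def intro!: mult_left_mono)
        then show ?thesis by (simp add: distrib_right)
      qed
      finally show "B (?k t) (?k t) \<le> (c1 + c2) * G t" .
    qed (use c1(1) c2(1) t G0 in auto)
    have "eps * n e t \<le> weighted \<epsilon> e (?k t) (?k t)" "mu * n h t \<le> weighted \<mu> h (?k t) (?k t)"
      using L2_inner_matrix_coercive[OF \<epsilon> smear_in[OF e sh(1)[of t]]] L2_inner_matrix_coercive[OF \<mu> smear_in[OF h sh(1)[of t]]]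
      by (simp_all add: weighted_def nM e h)
    moreover have "0 \<le> eps * n e t" "0 \<le> mu * n h t" using pos n0 by simp_all
    ultimately have "eps * n e t \<le> B (?k t) (?k t)" "mu * n h t \<le> B (?k t) (?k t)" by (simp_all add: B_def)
    then have "n e t \<le> B (?k t) (?k t) / eps" "n h t \<le> B (?k t) (?k t) / mu"
      using pos by (simp_all add: field_simps)
    then have "n e t + n h t \<le> (1 / eps + 1 / mu) * B (?k t) (?k t)" by (simp add: field_simps)
    also have "\<dots> \<le> (1 / eps + 1 / mu) * (((c1 + c2) / (b - a) + 1) * (\<integral>s. G s \<partial>lborel))"
      by (rule mult_left_mono[OF est]) (use pos in simp)
    finally show ?thesis by (simp add: nM e h C_def intG(2) mult.assoc)
  qed
  show ?thesis by (rule that[of C], rule main)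
qed

end

section \<open>Continuous representatives\<close>

lemma C11_kernel_combination:
  assumes "C11_kernel \<theta> \<theta>'" "C11_kernel \<zeta> \<zeta>'"
  shows "C11_kernel (\<lambda>s. a * \<theta> s + b * \<zeta> s) (\<lambda>s. a * \<theta>' s + b * \<zeta>' s)"
proof -
  from assms obtain L1 L2 where L: "\<And>s k. \<bar>\<theta> (s + k) - \<theta> s - k * \<theta>' s\<bar> \<le> L1 * k\<^sup>2"
    "\<And>s k. \<bar>\<zeta> (s + k) - \<zeta> s - k * \<zeta>' s\<bar> \<le> L2 * k\<^sup>2" unfolding C11_kernel_def by blast
  have "\<bar>(a * \<theta> (s + k) + b * \<zeta> (s + k)) - (a * \<theta> s + b * \<zeta> s) - k * (a * \<theta>' s + b * \<zeta>' s)\<bar>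
    \<le> (\<bar>a\<bar> * L1 + \<bar>b\<bar> * L2) * k\<^sup>2" for s k
  proof -
    have "(a * \<theta> (s + k) + b * \<zeta> (s + k)) - (a * \<theta> s + b * \<zeta> s) - k * (a * \<theta>' s + b * \<zeta>' s)
      = a * (\<theta> (s + k) - \<theta> s - k * \<theta>' s) + b * (\<zeta> (s + k) - \<zeta> s - k * \<zeta>' s)" by (simp add: algebra_simps)
    also have "\<bar>\<dots>\<bar> \<le> \<bar>a\<bar> * (L1 * k\<^sup>2) + \<bar>b\<bar> * (L2 * k\<^sup>2)"
      by (rule order_trans[OF abs_triangle_ineq], unfold abs_mult) (intro add_mono mult_left_mono L; simp)
    finally show ?thesis by (simp add: algebra_simps)
  qed
  moreover have "((\<lambda>s. a * \<theta> s + b * \<zeta> s) has_real_derivative a * \<theta>' s + b * \<zeta>' s) (at s)" for s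
    using assms unfolding C11_kernel_def by (intro DERIV_add DERIV_cmult) auto
  ultimately show ?thesis
    using assms bounded_continuous_combination unfolding C11_kernel_def by blast
qed

lemma C11_scaled_spline:
  assumes l: "l \<noteq> 0"
  shows "C11_kernel (scaled spline l) (\<lambda>s. spline' (s / l) / (l * \<bar>l\<bar>))"
proof -
  have c: "continuous_on UNIV (\<lambda>s. spline (s / l))" "continuous_on UNIV (\<lambda>s. spline' (s / l))"
    by (rule continuous_on_compose2[OF spline_continuous(1)[of UNIV]], use l in \<open>auto intro!: continuous_intros\<close>)
      (rule continuous_on_compose2[OF spline_continuous(2)[of UNIV]], use l in \<open>auto intro!: continuous_intros\<close>)
  have "scaled spline l \<in> bounded_continuous"
  proof -
    have "\<bar>scaled spline l s\<bar> \<le> 108 / \<bar>l\<bar>" for s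
      using spline_bound(1) l by (auto simp: scaled_def intro!: divide_right_mono)
    moreover have "continuous_on UNIV (scaled spline l)"
      unfolding scaled_def[abs_def] using l by (auto intro!: continuous_intros c)
    ultimately show ?thesis unfolding bounded_continuous_def by blast
  qed
  moreover have "(\<lambda>s. spline' (s / l) / (l * \<bar>l\<bar>)) \<in> bounded_continuous"
  proof -
    have "\<bar>spline' (s / l) / (l * \<bar>l\<bar>)\<bar> \<le> 216 / \<bar>l * \<bar>l\<bar>\<bar>" for s
      using spline_bound(2) unfolding abs_divide by (auto intro!: divide_right_mono)
    moreover have "continuous_on UNIV (\<lambda>s. spline' (s / l) / (l * \<bar>l\<bar>))"
      using l by (auto intro!: continuous_intros c)
    ultimately show ?thesis unfolding bounded_continuous_def by blast
  qed
  moreover have "(scaled spline l has_real_derivative spline' (s / l) / (l * \<bar>l\<bar>)) (at s)" for s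
  proof -
    have "((\<lambda>s. s / l) has_real_derivative 1 / l) (at s)" using l by (auto intro!: derivative_eq_intros)
    from DERIV_chain2[OF DERIV_spline[of "s / l"] this]
    have "((\<lambda>s. spline (s / l)) has_real_derivative spline' (s / l) * (1 / l)) (at s)" .
    from DERIV_cdivide[OF this, of "\<bar>l\<bar>"] show ?thesis by (simp add: scaled_def[abs_def])
  qed
  moreover have "\<bar>scaled spline l (s + k) - scaled spline l s - k * (spline' (s / l) / (l * \<bar>l\<bar>))\<bar> \<le> (108 / (l\<^sup>2 * \<bar>l\<bar>)) * k\<^sup>2" for s k
  proof -
    have "scaled spline l (s + k) - scaled spline l s - k * (spline' (s / l) / (l * \<bar>l\<bar>))
      = (spline (s / l + k / l) - spline (s / l) - (k / l) * spline' (s / l)) / \<bar>l\<bar>"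
      using l by (simp add: scaled_def add_divide_distrib diff_divide_distrib)
    also have "\<bar>\<dots>\<bar> \<le> (108 * (k / l)\<^sup>2) / \<bar>l\<bar>"
      unfolding abs_divide abs_abs by (intro divide_right_mono spline_Taylor) simp
    also have "\<dots> = (108 / (l\<^sup>2 * \<bar>l\<bar>)) * k\<^sup>2" by (simp add: power_divide)
    finally show ?thesis .
  qed
  ultimately show ?thesis unfolding C11_kernel_def by blast
qed

lemma C11_uniformly_continuous:
  assumes "C11_kernel \<theta> \<theta>'"
  obtains K L where "0 \<le> K" "\<And>s k. \<bar>\<theta> (s + k) - \<theta> s\<bar> \<le> K * \<bar>k\<bar> + L * k\<^sup>2"
proof -
  from assms obtain K L where KL: "\<And>s. \<bar>\<theta>' s\<bar> \<le> K" "\<And>s k. \<bar>\<theta> (s + k) - \<theta> s - k * \<theta>' s\<bar> \<le> L * k\<^sup>2"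
    unfolding C11_kernel_def bounded_continuous_def by blast
  have "\<bar>\<theta> (s + k) - \<theta> s\<bar> \<le> K * \<bar>k\<bar> + L * k\<^sup>2" for s k
  proof -
    have "\<bar>k * \<theta>' s\<bar> \<le> K * \<bar>k\<bar>" using mult_left_mono[OF KL(1)[of s], of "\<bar>k\<bar>"] by (simp add: abs_mult mult.commute)
    then show ?thesis using KL(2)[of s k] by linarith
  qed
  moreover have "0 \<le> K" using KL(1)[of 0] by simp
  ultimately show ?thesis using that by blast
qed

context space_time
begin

lemma mollify_spline_eventually:
  assumes u: "field u" and l: "l \<longlonglongrightarrow> 0" "\<And>k. l k \<noteq> 0" and e: "0 < e"
  shows "\<forall>\<^sub>F k in sequentially. mollify u (scaled spline (l k)) \<in> L2 lborel \<and>
    L2_norm lborel (\<lambda>z. mollify u (scaled spline (l k)) z - u z) < e"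
proof -
  have "(\<lambda>k. \<integral>\<^sup>+z. ennreal ((norm (mollify u (scaled spline (l k)) z - u z))\<^sup>2) \<partial>lborel) \<longlonglongrightarrow> 0"
    by (rule mollify_converges[OF field_L2[OF u] field_time[OF u] spline_measurable spline_bound(1) spline_integral _ l])
      (rule spline_support, auto)
  moreover have "0 < ennreal ((e / 2)\<^sup>2)" using e by simp
  ultimately have "\<forall>\<^sub>F k in sequentially. (\<integral>\<^sup>+z. ennreal ((norm (mollify u (scaled spline (l k)) z - u z))\<^sup>2) \<partial>lborel) < ennreal ((e / 2)\<^sup>2)"
    by (rule order_tendstoD(2))
  then show ?thesis
  proof eventually_elim
    case (elim k)
    let ?m = "mollify u (scaled spline (l k))"
    have sm: "scaled spline (l k) \<in> borel_measurable borel"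
      unfolding scaled_def[abs_def] by measurable
    have "u \<in> borel_measurable borel" using field_L2[OF u] by (simp add: L2_def)
    then have m: "(\<lambda>z. ?m z - u z) \<in> borel_measurable lborel"
      using mollify_measurable[OF field_L2[OF u] sm] by simp
    note d = L2_norm_le_of_nn_integral[OF m less_imp_le[OF elim]]
    have "L2_norm lborel (\<lambda>z. ?m z - u z) \<le> e / 2"
      by (rule power2_le_imp_le) (use d(2) e in auto)
    moreover have "?m \<in> L2 lborel" using L2_add[OF d(1) field_L2[OF u]] by simp
    ultimately show ?case using e by simp
  qed
qed

text \<open>
  Completeness provides a limit at each time, and uniformity makes it continuous.  It agrees with \<open>u\<close>
  because Fatou's lemma in \<open>t\<close> shows that the distances of the slices of \<open>V n\<close> and \<open>u\<close> have lower limit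
  zero for almost every \<open>t\<close>.
\<close>

lemma continuous_representative:
  fixes V :: "nat \<Rightarrow> (real^3) \<times> real \<Rightarrow> real^3"
  assumes u: "field u" and Vm: "\<And>n. V n \<in> borel_measurable borel"
    and VL: "\<And>n t. t \<in> {0..T} \<Longrightarrow> (\<lambda>x. V n (x, t)) \<in> L2 M"
    and cont: "\<And>n t. t \<in> {0..T} \<Longrightarrow> ((\<lambda>s. L2_norm M (\<lambda>x. V n (x, s) - V n (x, t))) \<longlongrightarrow> 0) (at t within {0..T})"
    and Cauchy: "\<And>\<delta>. 0 < \<delta> \<Longrightarrow> \<exists>N. \<forall>m\<ge>N. \<forall>n\<ge>N. \<forall>t\<in>{0..T}. L2_norm M (\<lambda>x. V m (x, t) - V n (x, t)) < \<delta>"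
    and approx: "(\<lambda>n. \<integral>\<^sup>+z. ennreal ((norm (V n z - u z))\<^sup>2) \<partial>lborel) \<longlonglongrightarrow> 0"
  obtains w where "w \<in> C_H \<Omega> T" "represents \<Omega> T w u"
    "\<And>t. t \<in> {0..T} \<Longrightarrow> (\<lambda>n. L2_norm M (\<lambda>x. V n (x, t) - w t x)) \<longlonglongrightarrow> 0"
proof -
  have "\<exists>w. w \<in> L2 M \<and> (\<lambda>n. L2_norm M (\<lambda>x. V n (x, t) - w x)) \<longlonglongrightarrow> 0" if t: "t \<in> {0..T}" for t
  proof -
    have C: "\<exists>N. \<forall>m\<ge>N. \<forall>n\<ge>N. L2_norm M (\<lambda>x. V m (x, t) - V n (x, t)) < \<delta>" if "0 < \<delta>" for \<delta>
      using Cauchy[OF that] t by blast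
    show ?thesis
    proof (rule L2_complete[of "\<lambda>n x. V n (x, t)" M, OF VL[OF t] C])
      fix w assume "w \<in> L2 M" "(\<lambda>n. L2_norm M (\<lambda>x. V n (x, t) - w x)) \<longlonglongrightarrow> 0"
      then show ?thesis by blast
    qed
  qed
  then have "\<forall>t. \<exists>w. t \<in> {0..T} \<longrightarrow> w \<in> L2 M \<and> (\<lambda>n. L2_norm M (\<lambda>x. V n (x, t) - w x)) \<longlonglongrightarrow> 0" by blast
  from choice[OF this] obtain w where w: "\<And>t. t \<in> {0..T} \<Longrightarrow> w t \<in> L2 M"
    "\<And>t. t \<in> {0..T} \<Longrightarrow> (\<lambda>n. L2_norm M (\<lambda>x. V n (x, t) - w t x)) \<longlonglongrightarrow> 0" by blast
  \<comment> \<open>letting the second index tend to infinity in the Cauchy condition\<close>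
  have unif: "\<exists>n. \<forall>t\<in>{0..T}. L2_norm M (\<lambda>x. V n (x, t) - w t x) \<le> \<delta>" if "0 < \<delta>" for \<delta>
  proof -
    obtain N where N: "\<And>m n t. m \<ge> N \<Longrightarrow> n \<ge> N \<Longrightarrow> t \<in> {0..T} \<Longrightarrow> L2_norm M (\<lambda>x. V m (x, t) - V n (x, t)) < \<delta>"
      using Cauchy[OF \<open>0 < \<delta>\<close>] by blast
    have "L2_norm M (\<lambda>x. V N (x, t) - w t x) \<le> \<delta>" if t: "t \<in> {0..T}" for t
    proof (rule LIMSEQ_le_const)
      show "(\<lambda>n. \<delta> + L2_norm M (\<lambda>x. V n (x, t) - w t x)) \<longlonglongrightarrow> \<delta>"
        using tendsto_add[OF tendsto_const w(2)[OF t], of \<delta>] by simp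
      show "\<exists>N'. \<forall>n\<ge>N'. L2_norm M (\<lambda>x. V N (x, t) - w t x) \<le> \<delta> + L2_norm M (\<lambda>x. V n (x, t) - w t x)"
      proof (intro exI[of _ N] allI impI)
        fix n assume "N \<le> n"
        then show "L2_norm M (\<lambda>x. V N (x, t) - w t x) \<le> \<delta> + L2_norm M (\<lambda>x. V n (x, t) - w t x)"
          using L2_norm_triangle_diff[OF VL[OF t] VL[OF t] w(1)[OF t], of N n] N[of N n t] t by linarith
      qed
    qed
    then show ?thesis by blast
  qed
  have "w \<in> C_H \<Omega> T"
    unfolding C_H_def
  proof (intro CollectI conjI ballI w(1))
    fix t assume t: "t \<in> {0..T}"
    show "((\<lambda>s. L2_norm M (\<lambda>x. w s x - w t x)) \<longlongrightarrow> 0) (at t within {0..T})"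
    proof (rule tendstoI)
      fix \<delta> :: real assume \<delta>: "0 < \<delta>"
      have "0 < \<delta> / 4" using \<delta> by simp
      from unif[OF this] obtain n where n: "\<And>t. t \<in> {0..T} \<Longrightarrow> L2_norm M (\<lambda>x. V n (x, t) - w t x) \<le> \<delta> / 4"
        by blast
      have "\<forall>\<^sub>F s in at t within {0..T}. dist (L2_norm M (\<lambda>x. V n (x, s) - V n (x, t))) 0 < \<delta> / 4"
        by (rule tendstoD[OF cont[OF t]]) (use \<delta> in simp)
      moreover have "\<forall>\<^sub>F s in at t within {0..T}. s \<in> {0..T}" by (simp add: eventually_at_filter)
      ultimately show "\<forall>\<^sub>F s in at t within {0..T}. dist (L2_norm M (\<lambda>x. w s x - w t x)) 0 < \<delta>"
      proof eventually_elim
        case (elim s)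
        have "L2_norm M (\<lambda>x. w s x - w t x) \<le> L2_norm M (\<lambda>x. w s x - V n (x, s)) + L2_norm M (\<lambda>x. V n (x, s) - w t x)"
          by (rule L2_norm_triangle_diff) (use w(1) VL t elim in auto)
        also have "L2_norm M (\<lambda>x. w s x - V n (x, s)) \<le> \<delta> / 4"
          using n[OF elim(2)] by (subst L2_norm_minus_commute)
        also have "L2_norm M (\<lambda>x. V n (x, s) - w t x) \<le> L2_norm M (\<lambda>x. V n (x, s) - V n (x, t)) + L2_norm M (\<lambda>x. V n (x, t) - w t x)"
          by (rule L2_norm_triangle_diff) (use w(1) VL t elim in auto)
        finally show ?case using elim(1) n[OF t] \<delta> by simp
      qed
    qed
  qed
  moreover have "represents \<Omega> T w u"
  proof -
    have um: "u \<in> borel_measurable borel" using field_L2[OF u] by (simp add: L2_def)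
    define g where "g n t = (\<integral>\<^sup>+x. ennreal ((norm (V n (x, t) - u (x, t)))\<^sup>2) \<partial>lborel)" for n t
    have pm: "(\<lambda>z. ennreal ((norm (V n z - u z))\<^sup>2)) \<in> borel_measurable (lborel \<Otimes>\<^sub>M lborel)" for n
      using Vm[of n] um by (simp add: lborel_prod)
    have gm: "g n \<in> borel_measurable lborel" for n
    proof -
      have "(\<lambda>(t, x). ennreal ((norm (V n (x, t) - u (x, t)))\<^sup>2)) \<in> borel_measurable (lborel \<Otimes>\<^sub>M lborel)"
        using measurable_compose[OF measurable_pair_swap' pm[of n]] by (simp add: split_beta')
      from lborel.borel_measurable_nn_integral_fst[OF this] show ?thesis by (simp add: g_def[abs_def])
    qed
    have gint: "(\<integral>\<^sup>+t. g n t \<partial>lborel) = (\<integral>\<^sup>+z. ennreal ((norm (V n z - u z))\<^sup>2) \<partial>lborel)" for n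
      using lborel_pair.nn_integral_snd[OF pm[of n]] by (simp add: g_def lborel_prod)
    have "(\<integral>\<^sup>+t. liminf (\<lambda>n. g n t) \<partial>lborel) \<le> liminf (\<lambda>n. \<integral>\<^sup>+t. g n t \<partial>lborel)"
      by (rule nn_integral_liminf) (use gm in simp)
    also have "\<dots> = 0" unfolding gint using lim_imp_Liminf[OF _ approx] by simp
    finally have "AE t in lborel. liminf (\<lambda>n. g n t) = 0"
      by (subst (asm) le_zero_eq, subst (asm) nn_integral_0_iff_AE) (use gm in auto)
    moreover have "AE x in M. w t x = u (x, t)" if t: "t \<in> {0<..<T}" and lim0: "liminf (\<lambda>n. g n t) = 0" for t
    proof -
      have t': "t \<in> {0..T}" using t by simp
      have ut: "(\<lambda>x. u (x, t)) \<in> borel_measurable M"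
        by (rule borel_imp_lebesgue_on[OF L2_slice_meas(2)[OF field_L2[OF u]]])
      have wm: "w t \<in> borel_measurable M" using w(1)[OF t'] by (simp add: L2_def)
      have le: "(\<integral>\<^sup>+x. ennreal ((norm (w t x - u (x, t)))\<^sup>2) \<partial>M) \<le> ennreal (2 * (L2_norm M (\<lambda>x. V n (x, t) - w t x))\<^sup>2) + 2 * g n t" for n
      proof -
        have vb: "(\<lambda>x. V n (x, t)) \<in> borel_measurable borel"
          by (rule measurable_compose[OF _ Vm]) (simp add: borel_prod[symmetric])
        have "(\<integral>\<^sup>+x. ennreal ((norm (w t x - u (x, t)))\<^sup>2) \<partial>M)
          \<le> (\<integral>\<^sup>+x. 2 * ennreal ((norm (V n (x, t) - w t x))\<^sup>2) + 2 * ennreal ((norm (V n (x, t) - u (x, t)))\<^sup>2) \<partial>M)"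
        proof (rule nn_integral_mono)
          fix x
          have "(norm (w t x - u (x, t)))\<^sup>2 \<le> 2 * (norm (V n (x, t) - w t x))\<^sup>2 + 2 * (norm (V n (x, t) - u (x, t)))\<^sup>2"
            using norm_add_sq_le[of "w t x - V n (x, t)" "V n (x, t) - u (x, t)"] by (simp add: norm_minus_commute)
          then have "ennreal ((norm (w t x - u (x, t)))\<^sup>2) \<le> ennreal (2 * (norm (V n (x, t) - w t x))\<^sup>2 + 2 * (norm (V n (x, t) - u (x, t)))\<^sup>2)"
            by (rule ennreal_leI)
          then show "ennreal ((norm (w t x - u (x, t)))\<^sup>2) \<le> 2 * ennreal ((norm (V n (x, t) - w t x))\<^sup>2) + 2 * ennreal ((norm (V n (x, t) - u (x, t)))\<^sup>2)"
            by (simp add: ennreal_plus ennreal_mult)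
        qed
        also have "\<dots> = 2 * (\<integral>\<^sup>+x. ennreal ((norm (V n (x, t) - w t x))\<^sup>2) \<partial>M) + 2 * (\<integral>\<^sup>+x. ennreal ((norm (V n (x, t) - u (x, t)))\<^sup>2) \<partial>M)"
          using wm ut borel_imp_lebesgue_on[OF vb, of \<Omega>] by (simp add: nn_integral_add nn_integral_cmult)
        also have "(\<integral>\<^sup>+x. ennreal ((norm (V n (x, t) - w t x))\<^sup>2) \<partial>M) = ennreal ((L2_norm M (\<lambda>x. V n (x, t) - w t x))\<^sup>2)"
          by (rule nn_integral_eq_L2_norm) (intro L2_diff VL w(1) t')
        also have "2 * (\<integral>\<^sup>+x. ennreal ((norm (V n (x, t) - u (x, t)))\<^sup>2) \<partial>M) \<le> 2 * g n t"
          unfolding g_def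
          by (subst nn_integral_lebesgue_on_borel[OF \<Omega>_borel])
            (use vb L2_slice_meas(2)[OF field_L2[OF u]] in \<open>auto intro!: mult_left_mono nn_integral_mono simp: indicator_def\<close>)
        finally show ?thesis by (simp add: ennreal_mult add_left_mono)
      qed
      have "(\<lambda>n. ennreal (2 * (L2_norm M (\<lambda>x. V n (x, t) - w t x))\<^sup>2)) \<longlonglongrightarrow> ennreal (2 * 0\<^sup>2)"
        by (intro tendsto_ennrealI tendsto_intros w(2)[OF t'])
      then have l1: "(\<lambda>n. ennreal (2 * (L2_norm M (\<lambda>x. V n (x, t) - w t x))\<^sup>2)) \<longlonglongrightarrow> 0" by simp
      have small: "(\<integral>\<^sup>+x. ennreal ((norm (w t x - u (x, t)))\<^sup>2) \<partial>M) \<le> ennreal \<delta>" if "0 < \<delta>" for \<delta>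
      proof -
        let ?d = "ennreal (\<delta> / 4)"
        have d: "0 < ?d" using that by simp
        \<comment> \<open>the first error is small eventually, the second one for infinitely many \<open>n\<close>\<close>
        have ev: "\<forall>\<^sub>F n in sequentially. ennreal (2 * (L2_norm M (\<lambda>x. V n (x, t) - w t x))\<^sup>2) < ?d"
          by (rule order_tendstoD(2)[OF l1 d])
        have freq: "\<not> (\<forall>\<^sub>F n in sequentially. \<not> g n t < ?d)"
        proof
          assume "\<forall>\<^sub>F n in sequentially. \<not> g n t < ?d"
          then have "\<forall>\<^sub>F n in sequentially. ?d \<le> g n t" by eventually_elim simp
          then have "?d \<le> liminf (\<lambda>n. g n t)" by (rule Liminf_bounded)
          with lim0 d show False by simp
        qed
        have "\<not> (\<forall>\<^sub>F n in sequentially. \<not> (g n t < ?d \<and> ennreal (2 * (L2_norm M (\<lambda>x. V n (x, t) - w t x))\<^sup>2) < ?d))"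
        proof
          assume "\<forall>\<^sub>F n in sequentially. \<not> (g n t < ?d \<and> ennreal (2 * (L2_norm M (\<lambda>x. V n (x, t) - w t x))\<^sup>2) < ?d)"
          with ev have "\<forall>\<^sub>F n in sequentially. \<not> g n t < ?d" by eventually_elim blast
          with freq show False by blast
        qed
        then obtain n where "g n t < ?d" "ennreal (2 * (L2_norm M (\<lambda>x. V n (x, t) - w t x))\<^sup>2) < ?d"
          using not_eventuallyD by blast
        then have "ennreal (2 * (L2_norm M (\<lambda>x. V n (x, t) - w t x))\<^sup>2) + 2 * g n t \<le> ?d + 2 * ?d"
          by (intro add_mono mult_left_mono) auto
        also have "\<dots> \<le> ennreal \<delta>"
          using that by (simp add: ennreal_plus[symmetric] ennreal_mult'[symmetric] ennreal_leI flip: ennreal_numeral)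
        finally show ?thesis using le[of n] by (rule order_trans[rotated])
      qed
      have "(\<integral>\<^sup>+x. ennreal ((norm (w t x - u (x, t)))\<^sup>2) \<partial>M) \<le> 0"
        by (rule ennreal_le_epsilon) (use small in simp)
      then have "AE x in M. ennreal ((norm (w t x - u (x, t)))\<^sup>2) = 0"
        by (subst (asm) le_zero_eq, subst (asm) nn_integral_0_iff_AE) (use wm ut in auto)
      then show ?thesis by eventually_elim simp
    qed
    ultimately have "AE t in lborel. t \<in> {0<..<T} \<longrightarrow> (AE x in M. w t x = u (x, t))"
      by (auto elim: eventually_mono)
    then show ?thesis unfolding represents_def by (subst AE_lebesgue_on_iff) auto
  qed
  ultimately show ?thesis using that w(2) by blast
qed

end

context space_time
begin

lemma mollify_slice_in:
  assumes "field u" "l \<noteq> 0"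
  shows "(\<lambda>x. mollify u (scaled spline l) (x, t)) \<in> L2 M"
proof -
  have "scaled spline l \<in> bounded_continuous" using C11_scaled_spline[OF assms(2)] by (simp add: C11_kernel_def)
  from smear_in[OF assms(1) bounded_continuous_shift[OF this, of t]] show ?thesis by (simp add: mollify_def)
qed

lemma mollify_slice_continuous:
  assumes u: "field u" and l: "l \<noteq> 0"
  shows "((\<lambda>s. L2_norm M (\<lambda>x. mollify u (scaled spline l) (x, s) - mollify u (scaled spline l) (x, t))) \<longlongrightarrow> 0) (at t within S)"
proof -
  let ?\<rho> = "scaled spline l"
  have k: "C11_kernel ?\<rho> (\<lambda>s. spline' (s / l) / (l * \<bar>l\<bar>))" by (rule C11_scaled_spline[OF l])
  have bc: "?\<rho> \<in> bounded_continuous" using k by (simp add: C11_kernel_def)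
  obtain K L where KL: "0 \<le> K" "\<And>s k. \<bar>?\<rho> (s + k) - ?\<rho> s\<bar> \<le> K * \<bar>k\<bar> + L * k\<^sup>2"
    by (rule C11_uniformly_continuous[OF k]) blast
  have le: "L2_norm M (\<lambda>x. mollify u ?\<rho> (x, s) - mollify u ?\<rho> (x, t)) \<le> (K * \<bar>t - s\<bar> + L * (t - s)\<^sup>2) * sqrt T * L2_norm lborel u" for s
  proof -
    let ?d = "\<lambda>r. 1 * ?\<rho> (r - s) + (- 1) * ?\<rho> (r - t)"
    have sh: "(\<lambda>r. ?\<rho> (r - q)) \<in> bounded_continuous" for q by (rule bounded_continuous_shift[OF bc])
    have d: "?d \<in> bounded_continuous" by (rule bounded_continuous_combination[OF sh sh])
    have "L2_norm M (\<lambda>x. mollify u ?\<rho> (x, s) - mollify u ?\<rho> (x, t)) = L2_norm M (smear u ?d)"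
    proof (rule L2_norm_cong_AE)
      show "AE x in M. mollify u ?\<rho> (x, s) - mollify u ?\<rho> (x, t) = smear u ?d x"
        using smear_combination[OF u sh[of s] sh[of t], of 1 "-1"] by eventually_elim (simp add: mollify_def)
    qed (intro L2_diff mollify_slice_in u l smear_in d)+
    also have "\<dots> \<le> (K * \<bar>t - s\<bar> + L * (t - s)\<^sup>2) * sqrt T * L2_norm lborel u"
    proof (rule smear_norm_le[OF u d])
      fix r
      show "\<bar>?d r\<bar> \<le> K * \<bar>t - s\<bar> + L * (t - s)\<^sup>2" using KL(2)[of "r - t" "t - s"] by simp
    qed
    finally show ?thesis .
  qed
  have "((\<lambda>s. (K * \<bar>t - s\<bar> + L * (t - s)\<^sup>2) * sqrt T * L2_norm lborel u) \<longlongrightarrow> (K * \<bar>t - t\<bar> + L * (t - t)\<^sup>2) * sqrt T * L2_norm lborel u) (at t within S)"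
    by (intro tendsto_intros)
  then have lim: "((\<lambda>s. (K * \<bar>t - s\<bar> + L * (t - s)\<^sup>2) * sqrt T * L2_norm lborel u) \<longlongrightarrow> 0) (at t within S)" by simp
  show ?thesis
    by (rule tendsto_sandwich[OF _ _ tendsto_const lim]) (use le in auto)
qed

text \<open>
  Kernels of width at most \<open>T / 3\<close> stay inside the time interval when they look forward from a time up
  to \<open>2 T / 3\<close> or backward from a time after \<open>T / 3\<close>.
\<close>

definition step :: "nat \<Rightarrow> real" where "step n = T / (3 * (real n + 1))"

lemma step_bounds: "0 < step n" "step n \<le> T / 3"
proof -
  show "0 < step n" using T_pos by (simp add: step_def)
  show "step n \<le> T / 3" unfolding step_def by (rule divide_left_mono) (use T_pos in auto)
qed

lemma step_tendsto: "step \<longlonglongrightarrow> 0"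
proof -
  have "(\<lambda>n. (T / 3) * inverse (real (Suc n))) \<longlonglongrightarrow> (T / 3) * 0" by (intro tendsto_intros LIMSEQ_inverse_real_of_nat)
  then show ?thesis by (simp add: step_def[abs_def] field_simps)
qed

lemma forward_kernel_zero:
  assumes "t \<in> {0..2 * T / 3}"
  shows "scaled spline (step n) (- t) = 0 \<and> scaled spline (step n) (T - t) = 0"
proof -
  have "- t / step n \<le> 0" using assms step_bounds(1)[of n] by simp
  moreover have "1 \<le> (T - t) / step n" using assms step_bounds[of n] by (simp add: le_divide_eq)
  ultimately show ?thesis
    using spline_support[of "- t / step n"] spline_support[of "(T - t) / step n"] by (simp add: scaled_def)
qed

lemma backward_kernel_zero:
  assumes "t \<in> {T / 3..T}"
  shows "scaled spline (- step n) (- t) = 0 \<and> scaled spline (- step n) (T - t) = 0"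
proof -
  have "1 \<le> t / step n" using assms step_bounds[of n] by (simp add: le_divide_eq)
  moreover have "0 \<le> (T - t) / step n" using assms step_bounds(1)[of n] by simp
  then have "- ((T - t) / step n) \<le> 0" by simp
  ultimately show ?thesis
    using spline_support[of "t / step n"] spline_support[of "- ((T - t) / step n)"] by (simp add: scaled_def)
qed

end

context smeared_maxwell
begin

text \<open>
  The energy estimate is applied to the difference of two kernels.  Its right-hand side is small because
  both mollifications are close to the same field in \<open>L\<^sup>2\<close> of space-time.
\<close>

lemma mollified_fields_uniformly_Cauchy:
  assumes ab: "a < b" and l: "l \<longlonglongrightarrow> 0" "\<And>k. l k \<noteq> 0"
    and zero: "\<And>k t. t \<in> {a..b} \<Longrightarrow> scaled spline (l k) (- t) = 0 \<and> scaled spline (l k) (T - t) = 0"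
    and u: "u \<in> {e, h}" and \<delta>: "0 < \<delta>"
  shows "\<exists>N. \<forall>m\<ge>N. \<forall>n\<ge>N. \<forall>t\<in>{a..b}.
    L2_norm M (\<lambda>x. mollify u (scaled spline (l m)) (x, t) - mollify u (scaled spline (l n)) (x, t)) < \<delta>"
proof -
  let ?\<rho> = "\<lambda>k. scaled spline (l k)" and ?\<rho>' = "\<lambda>k s. spline' (s / l k) / (l k * \<bar>l k\<bar>)"
  obtain C where C: "\<And>\<theta> \<theta>' t. C11_kernel \<theta> \<theta>' \<Longrightarrow> (\<And>t. t \<in> {a..b} \<Longrightarrow> \<theta> (- t) = 0 \<and> \<theta> (T - t) = 0) \<Longrightarrow>
    mollify e \<theta> \<in> L2 lborel \<Longrightarrow> mollify h \<theta> \<in> L2 lborel \<Longrightarrow> mollify J \<theta> \<in> L2 lborel \<Longrightarrow> t \<in> {a..b} \<Longrightarrow>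
    (L2_norm M (smear e (\<lambda>s. \<theta> (s - t))))\<^sup>2 + (L2_norm M (smear h (\<lambda>s. \<theta> (s - t))))\<^sup>2
    \<le> C * ((L2_norm lborel (mollify e \<theta>))\<^sup>2 + (L2_norm lborel (mollify h \<theta>))\<^sup>2 + (L2_norm lborel (mollify J \<theta>))\<^sup>2)"
    by (rule energy_estimate[OF ab]) blast
  \<comment> \<open>three squared norms of at most \<open>(2 \<gamma>)\<^sup>2\<close>, times \<open>|C|\<close>, have to stay below \<open>\<delta>\<^sup>2\<close>\<close>
  define \<gamma> where "\<gamma> = \<delta> / (4 * sqrt (\<bar>C\<bar> + 1))"
  have \<gamma>: "0 < \<gamma>" using \<delta> by (simp add: \<gamma>_def add_nonneg_pos)
  have "\<forall>\<^sub>F k in sequentially. (mollify e (?\<rho> k) \<in> L2 lborel \<and> L2_norm lborel (\<lambda>z. mollify e (?\<rho> k) z - e z) < \<gamma>) \<and>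
      (mollify h (?\<rho> k) \<in> L2 lborel \<and> L2_norm lborel (\<lambda>z. mollify h (?\<rho> k) z - h z) < \<gamma>) \<and>
      (mollify J (?\<rho> k) \<in> L2 lborel \<and> L2_norm lborel (\<lambda>z. mollify J (?\<rho> k) z - J z) < \<gamma>)"
    by (intro eventually_conj mollify_spline_eventually e h J l \<gamma>)
  then obtain N where N: "\<And>k v. k \<ge> N \<Longrightarrow> v \<in> {e, h, J} \<Longrightarrow> mollify v (?\<rho> k) \<in> L2 lborel"
    "\<And>k v. k \<ge> N \<Longrightarrow> v \<in> {e, h, J} \<Longrightarrow> L2_norm lborel (\<lambda>z. mollify v (?\<rho> k) z - v z) < \<gamma>"
    unfolding eventually_sequentially by blast
  have "L2_norm M (\<lambda>x. mollify u (?\<rho> m) (x, t) - mollify u (?\<rho> n) (x, t)) < \<delta>"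
    if mn: "m \<ge> N" "n \<ge> N" and t: "t \<in> {a..b}" for m n t
  proof -
    define \<theta> where "\<theta> s = 1 * ?\<rho> m s + (- 1) * ?\<rho> n s" for s
    have k: "C11_kernel (?\<rho> k) (?\<rho>' k)" for k by (rule C11_scaled_spline[OF l(2)])
    have bc: "?\<rho> k \<in> bounded_continuous" for k using k[of k] by (simp add: C11_kernel_def)
    have \<theta>: "C11_kernel \<theta> (\<lambda>s. 1 * ?\<rho>' m s + (- 1) * ?\<rho>' n s)"
      unfolding \<theta>_def[abs_def] by (rule C11_kernel_combination[OF k k])
    have fv: "field v" if "v \<in> {e, h, J}" for v using that e h J by auto
    have ae: "AE x in lborel. \<forall>t. smear v (\<lambda>s. \<theta> (s - t)) x = smear v (\<lambda>s. ?\<rho> m (s - t)) x - smear v (\<lambda>s. ?\<rho> n (s - t)) x"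
      if v: "v \<in> {e, h, J}" for v
      using L2_slice_integrable[OF field_L2 field_time, OF fv[OF v] fv[OF v]]
    proof eventually_elim
      case (elim x)
      have i: "integrable lborel (\<lambda>s. ?\<rho> k (s - t) *\<^sub>R v (x, s))" for k t
      proof -
        have b: "(\<lambda>s. ?\<rho> k (s - t)) \<in> bounded_continuous" by (rule bounded_continuous_shift[OF bc])
        then obtain K where "\<And>s. \<bar>?\<rho> k (s - t)\<bar> \<le> K" by (auto simp: bounded_continuous_def)
        then show ?thesis
          by (rule integrable_bounded_scaleR[OF elim, rotated]) (use bounded_continuous_measurable[OF b] in simp)
      qed
      show ?case
        unfolding smear_def \<theta>_def using i by (simp add: scaleR_diff_left)
    qed
    have mol: "mollify v \<theta> \<in> L2 lborel" "L2_norm lborel (mollify v \<theta>) \<le> 2 * \<gamma>" if v: "v \<in> {e, h, J}" for v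
    proof -
      have vL: "v \<in> L2 lborel" by (rule field_L2[OF fv[OF v]])
      have eq: "AE z in lborel. mollify v \<theta> z = mollify v (?\<rho> m) z - mollify v (?\<rho> n) z"
        using AE_lborel_fst[OF ae[OF v]] by eventually_elim (simp add: mollify_def)
      have D: "(\<lambda>z. mollify v (?\<rho> m) z - mollify v (?\<rho> n) z) \<in> L2 lborel"
        by (intro L2_diff N(1) mn v)
      have "\<theta> \<in> bounded_continuous" using \<theta> by (simp add: C11_kernel_def)
      then have m: "mollify v \<theta> \<in> borel_measurable lborel"
        using mollify_measurable[OF vL bounded_continuous_measurable] by simp
      show mol: "mollify v \<theta> \<in> L2 lborel"
        by (rule L2_bound[OF m, of "\<lambda>z. (norm (mollify v (?\<rho> m) z - mollify v (?\<rho> n) z))\<^sup>2"])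
          (use D eq in \<open>auto simp: L2_def elim: eventually_mono\<close>)
      have "L2_norm lborel (mollify v \<theta>) = L2_norm lborel (\<lambda>z. mollify v (?\<rho> m) z - mollify v (?\<rho> n) z)"
        by (rule L2_norm_cong_AE[OF mol D eq])
      also have "\<dots> \<le> L2_norm lborel (\<lambda>z. mollify v (?\<rho> m) z - v z) + L2_norm lborel (\<lambda>z. v z - mollify v (?\<rho> n) z)"
        by (intro L2_norm_triangle_diff N(1) mn v vL)
      also have "L2_norm lborel (\<lambda>z. v z - mollify v (?\<rho> n) z) = L2_norm lborel (\<lambda>z. mollify v (?\<rho> n) z - v z)"
        by (rule L2_norm_minus_commute)
      finally show "L2_norm lborel (mollify v \<theta>) \<le> 2 * \<gamma>" using N(2)[OF mn(1) v] N(2)[OF mn(2) v] by linarith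
    qed
    have sq: "(L2_norm lborel (mollify v \<theta>))\<^sup>2 \<le> 4 * \<gamma>\<^sup>2" if v: "v \<in> {e, h, J}" for v
      using power_mono[OF mol(2)[OF v], of 2] by (simp add: power_mult_distrib)
    have uu: "u \<in> {e, h, J}" using u by auto
    have "(L2_norm M (smear u (\<lambda>s. \<theta> (s - t))))\<^sup>2 \<le> (L2_norm M (smear e (\<lambda>s. \<theta> (s - t))))\<^sup>2 + (L2_norm M (smear h (\<lambda>s. \<theta> (s - t))))\<^sup>2"
      using u by auto
    also have "\<dots> \<le> C * ((L2_norm lborel (mollify e \<theta>))\<^sup>2 + (L2_norm lborel (mollify h \<theta>))\<^sup>2 + (L2_norm lborel (mollify J \<theta>))\<^sup>2)"
      by (rule C[OF \<theta> _ mol(1) mol(1) mol(1) t]) (use zero in \<open>auto simp: \<theta>_def\<close>)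
    also have "\<dots> \<le> \<bar>C\<bar> * (4 * \<gamma>\<^sup>2 + 4 * \<gamma>\<^sup>2 + 4 * \<gamma>\<^sup>2)"
      by (intro mult_mono add_mono sq) auto
    also have "\<dots> < \<delta>\<^sup>2"
    proof -
      have "\<gamma>\<^sup>2 * (16 * (\<bar>C\<bar> + 1)) = \<delta>\<^sup>2"
        by (simp add: \<gamma>_def power_divide power_mult_distrib add_nonneg_eq_0_iff)
      moreover have "\<bar>C\<bar> * (4 * \<gamma>\<^sup>2 + 4 * \<gamma>\<^sup>2 + 4 * \<gamma>\<^sup>2) = \<gamma>\<^sup>2 * (12 * \<bar>C\<bar>)" by simp
      moreover have "\<gamma>\<^sup>2 * (12 * \<bar>C\<bar>) < \<gamma>\<^sup>2 * (16 * (\<bar>C\<bar> + 1))"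
        by (rule mult_strict_left_mono) (use \<gamma> in auto)
      ultimately show ?thesis by linarith
    qed
    finally have "L2_norm M (smear u (\<lambda>s. \<theta> (s - t))) < \<delta>"
      using \<delta> by (meson less_imp_le power2_less_imp_less)
    moreover have "L2_norm M (smear u (\<lambda>s. \<theta> (s - t))) = L2_norm M (\<lambda>x. mollify u (?\<rho> m) (x, t) - mollify u (?\<rho> n) (x, t))"
    proof (rule L2_norm_cong_AE)
      have sh: "(\<lambda>s. \<theta> (s - t)) \<in> bounded_continuous"
        using \<theta> bounded_continuous_shift by (simp add: C11_kernel_def)
      show "smear u (\<lambda>s. \<theta> (s - t)) \<in> L2 M" by (rule smear_in[OF fv[OF uu] sh])
      have slice: "(\<lambda>x. mollify u (?\<rho> k) (x, t)) \<in> L2 M" for k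
        using smear_in[OF fv[OF uu] bounded_continuous_shift[OF bc[of k], of t]] by (simp add: mollify_def)
      show "(\<lambda>x. mollify u (?\<rho> m) (x, t) - mollify u (?\<rho> n) (x, t)) \<in> L2 M" by (rule L2_diff[OF slice slice])
      have "AE x in lborel. x \<in> \<Omega> \<longrightarrow> smear u (\<lambda>s. \<theta> (s - t)) x = mollify u (?\<rho> m) (x, t) - mollify u (?\<rho> n) (x, t)"
        using ae[OF uu] by eventually_elim (simp add: mollify_def)
      then show "AE x in M. smear u (\<lambda>s. \<theta> (s - t)) x = mollify u (?\<rho> m) (x, t) - mollify u (?\<rho> n) (x, t)"
        by (subst AE_lebesgue_on_iff) (use \<Omega>_borel in auto)
    qed
    ultimately show ?thesis by simp
  qed
  then show ?thesis by blast
qed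

text \<open>
  Forward mollifications are controlled on \<open>[0, 2 T / 3]\<close> and backward ones on \<open>[T / 3, T]\<close>.  A partition
  of unity in time joins them to one sequence that is controlled on \<open>[0, T]\<close> and is the forward
  mollification at time \<open>0\<close>.
\<close>

lemma continuous_solution:
  assumes u: "u \<in> {e, h}"
  obtains w where "w \<in> C_H \<Omega> T" "represents \<Omega> T w u"
    "(\<lambda>n. L2_norm M (\<lambda>x. smear u (scaled spline (step n)) x - w 0 x)) \<longlonglongrightarrow> 0"
proof -
  have fu: "field u" using u e h by auto
  \<comment> \<open>equal to 1 up to \<open>T / 3\<close> and to 0 from \<open>2 T / 3\<close> on\<close>
  define \<kappa> where "\<kappa> t = max 0 (min 1 (2 - 3 * t / T))" for t
  have \<kappa>: "0 \<le> \<kappa> t" "\<kappa> t \<le> 1" for t by (auto simp: \<kappa>_def)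
  have \<kappa>_cont: "continuous_on UNIV \<kappa>" unfolding \<kappa>_def[abs_def] using T_pos by (auto intro!: continuous_intros)
  define F where "F n = mollify u (scaled spline (step n))" for n
  define B where "B n = mollify u (scaled spline (- step n))" for n
  define W where "W n z = \<kappa> (snd z) *\<^sub>R F n z + (1 - \<kappa> (snd z)) *\<^sub>R B n z" for n z
  have nz: "step n \<noteq> 0" "- step n \<noteq> 0" for n using step_bounds(1)[of n] by auto
  have bl: "(\<lambda>n. - step n) \<longlonglongrightarrow> 0" using tendsto_minus[OF step_tendsto] by simp
  have FL: "(\<lambda>x. F n (x, t)) \<in> L2 M" and BL: "(\<lambda>x. B n (x, t)) \<in> L2 M" for n t
    unfolding F_def B_def by (rule mollify_slice_in[OF fu nz(1)], rule mollify_slice_in[OF fu nz(2)])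
  have sm: "scaled spline l \<in> borel_measurable borel" for l unfolding scaled_def[abs_def] by measurable
  have Fm: "F n \<in> borel_measurable borel" and Bm: "B n \<in> borel_measurable borel" for n
    unfolding F_def B_def by (intro mollify_measurable[OF field_L2[OF fu] sm])+
  have um: "u \<in> borel_measurable borel" using field_L2[OF fu] by (simp add: L2_def)
  have Wm: "W n \<in> borel_measurable borel" for n
  proof -
    have [measurable]: "\<kappa> \<in> borel_measurable borel" by (rule borel_measurable_continuous_onI[OF \<kappa>_cont])
    have [measurable]: "(snd :: (real^3) \<times> real \<Rightarrow> real) \<in> borel_measurable borel"
      by (intro borel_measurable_continuous_onI continuous_intros)
    note [measurable] = Fm Bm
    show ?thesis unfolding W_def[abs_def] by measurable
  qed
  have ip: "0 < 2 * T / 3" "T / 3 < T" using T_pos by auto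
  show ?thesis
  proof (rule continuous_representative[OF fu Wm])
    show "(\<lambda>x. W n (x, t)) \<in> L2 M" for n t
      unfolding W_def snd_conv by (intro L2_add L2_scaleR FL BL)
  next
    fix n t
    have bound: "L2_norm M (\<lambda>x. W n (x, s) - W n (x, t)) \<le>
       (L2_norm M (\<lambda>x. F n (x, s) - F n (x, t)) + L2_norm M (\<lambda>x. B n (x, s) - B n (x, t))) +
       \<bar>\<kappa> s - \<kappa> t\<bar> * L2_norm M (\<lambda>x. F n (x, t) - B n (x, t))" for s
    proof -
      let ?f = "\<lambda>x. F n (x, s) - F n (x, t)" and ?b = "\<lambda>x. B n (x, s) - B n (x, t)" and ?g = "\<lambda>x. F n (x, t) - B n (x, t)"
      have L: "?f \<in> L2 M" "?b \<in> L2 M" "?g \<in> L2 M" by (intro L2_diff FL BL)+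
      have "L2_norm M (\<lambda>x. W n (x, s) - W n (x, t)) = L2_norm M (\<lambda>x. (\<kappa> s *\<^sub>R ?f x + (1 - \<kappa> s) *\<^sub>R ?b x) + (\<kappa> s - \<kappa> t) *\<^sub>R ?g x)"
        by (simp add: W_def algebra_simps)
      also have "\<dots> \<le> (L2_norm M (\<lambda>x. \<kappa> s *\<^sub>R ?f x) + L2_norm M (\<lambda>x. (1 - \<kappa> s) *\<^sub>R ?b x)) + L2_norm M (\<lambda>x. (\<kappa> s - \<kappa> t) *\<^sub>R ?g x)"
        using L2_norm_triangle[OF L2_add[OF L2_scaleR[OF L(1), of "\<kappa> s"] L2_scaleR[OF L(2), of "1 - \<kappa> s"]] L2_scaleR[OF L(3), of "\<kappa> s - \<kappa> t"]]
          L2_norm_triangle[OF L2_scaleR[OF L(1), of "\<kappa> s"] L2_scaleR[OF L(2), of "1 - \<kappa> s"]] by linarith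
      also have "\<dots> \<le> (L2_norm M ?f + L2_norm M ?b) + \<bar>\<kappa> s - \<kappa> t\<bar> * L2_norm M ?g"
      proof -
        have "\<bar>\<kappa> s\<bar> * L2_norm M ?f \<le> L2_norm M ?f" "\<bar>1 - \<kappa> s\<bar> * L2_norm M ?b \<le> L2_norm M ?b"
          using mult_right_mono[of "\<bar>\<kappa> s\<bar>" 1 "L2_norm M ?f"] mult_right_mono[of "\<bar>1 - \<kappa> s\<bar>" 1 "L2_norm M ?b"] \<kappa>[of s] by simp_all
        then show ?thesis unfolding L2_norm_scaleR by linarith
      qed
      finally show ?thesis .
    qed
    have "((\<lambda>s. (L2_norm M (\<lambda>x. F n (x, s) - F n (x, t)) + L2_norm M (\<lambda>x. B n (x, s) - B n (x, t))) +
       \<bar>\<kappa> s - \<kappa> t\<bar> * L2_norm M (\<lambda>x. F n (x, t) - B n (x, t))) \<longlongrightarrow> (0 + 0) + \<bar>\<kappa> t - \<kappa> t\<bar> * L2_norm M (\<lambda>x. F n (x, t) - B n (x, t))) (at t within {0..T})"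
    proof (intro tendsto_intros)
      show "((\<lambda>s. L2_norm M (\<lambda>x. F n (x, s) - F n (x, t))) \<longlongrightarrow> 0) (at t within {0..T})"
        unfolding F_def by (rule mollify_slice_continuous[OF fu nz(1)])
      show "((\<lambda>s. L2_norm M (\<lambda>x. B n (x, s) - B n (x, t))) \<longlongrightarrow> 0) (at t within {0..T})"
        unfolding B_def by (rule mollify_slice_continuous[OF fu nz(2)])
      have "continuous (at t within {0..T}) \<kappa>"
        using \<kappa>_cont by (simp add: continuous_on_eq_continuous_at continuous_at_imp_continuous_within)
      then show "(\<kappa> \<longlongrightarrow> \<kappa> t) (at t within {0..T})" by (simp add: continuous_within)
    qed
    then have lim: "((\<lambda>s. (L2_norm M (\<lambda>x. F n (x, s) - F n (x, t)) + L2_norm M (\<lambda>x. B n (x, s) - B n (x, t))) +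
       \<bar>\<kappa> s - \<kappa> t\<bar> * L2_norm M (\<lambda>x. F n (x, t) - B n (x, t))) \<longlongrightarrow> 0) (at t within {0..T})" by simp
    show "((\<lambda>s. L2_norm M (\<lambda>x. W n (x, s) - W n (x, t))) \<longlongrightarrow> 0) (at t within {0..T})"
      by (rule tendsto_sandwich[OF _ _ tendsto_const lim]) (use bound in auto)
  next
    fix \<delta> :: real assume \<delta>: "0 < \<delta>"
    then have \<delta>2: "0 < \<delta> / 2" by simp
    obtain N1 where N1: "\<And>m n t. m \<ge> N1 \<Longrightarrow> n \<ge> N1 \<Longrightarrow> t \<in> {0..2 * T / 3} \<Longrightarrow> L2_norm M (\<lambda>x. F m (x, t) - F n (x, t)) < \<delta> / 2"
      unfolding F_def using mollified_fields_uniformly_Cauchy[OF ip(1) step_tendsto nz(1) forward_kernel_zero u \<delta>2] by blast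
    obtain N2 where N2: "\<And>m n t. m \<ge> N2 \<Longrightarrow> n \<ge> N2 \<Longrightarrow> t \<in> {T / 3..T} \<Longrightarrow> L2_norm M (\<lambda>x. B m (x, t) - B n (x, t)) < \<delta> / 2"
      unfolding B_def using mollified_fields_uniformly_Cauchy[OF ip(2) bl nz(2) backward_kernel_zero u \<delta>2] by blast
    have "L2_norm M (\<lambda>x. W m (x, t) - W n (x, t)) < \<delta>" if mn: "m \<ge> max N1 N2" "n \<ge> max N1 N2" and t: "t \<in> {0..T}" for m n t
    proof -
      let ?f = "\<lambda>x. F m (x, t) - F n (x, t)" and ?b = "\<lambda>x. B m (x, t) - B n (x, t)"
      have "L2_norm M (\<lambda>x. W m (x, t) - W n (x, t)) = L2_norm M (\<lambda>x. \<kappa> t *\<^sub>R ?f x + (1 - \<kappa> t) *\<^sub>R ?b x)"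
        by (simp add: W_def algebra_simps)
      also have "\<dots> \<le> L2_norm M (\<lambda>x. \<kappa> t *\<^sub>R ?f x) + L2_norm M (\<lambda>x. (1 - \<kappa> t) *\<^sub>R ?b x)"
        by (intro L2_norm_triangle L2_scaleR L2_diff FL BL)
      also have "\<dots> = \<kappa> t * L2_norm M ?f + (1 - \<kappa> t) * L2_norm M ?b"
        unfolding L2_norm_scaleR using \<kappa>[of t] by simp
      also have "\<dots> \<le> \<kappa> t * (\<delta> / 2) + (1 - \<kappa> t) * (\<delta> / 2)"
      proof (rule add_mono)
        show "\<kappa> t * L2_norm M ?f \<le> \<kappa> t * (\<delta> / 2)"
        proof (cases "t \<le> 2 * T / 3")
          case True
          then show ?thesis using N1[of m n t] mn t \<kappa>(1)[of t] by (intro mult_left_mono) auto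
        next
          case False
          then have "\<kappa> t = 0" using T_pos by (simp add: \<kappa>_def field_simps)
          then show ?thesis by simp
        qed
        show "(1 - \<kappa> t) * L2_norm M ?b \<le> (1 - \<kappa> t) * (\<delta> / 2)"
        proof (cases "T / 3 \<le> t")
          case True
          then show ?thesis using N2[of m n t] mn t \<kappa>(2)[of t] by (intro mult_left_mono) auto
        next
          case False
          then have "\<kappa> t = 1" using T_pos by (simp add: \<kappa>_def field_simps)
          then show ?thesis by simp
        qed
      qed
      also have "\<dots> = \<delta> / 2" by (simp add: field_simps)
      also have "\<dots> < \<delta>" using \<delta> by simp
      finally show ?thesis .
    qed
    then show "\<exists>N. \<forall>m\<ge>N. \<forall>n\<ge>N. \<forall>t\<in>{0..T}. L2_norm M (\<lambda>x. W m (x, t) - W n (x, t)) < \<delta>" by blast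
  next
    let ?n = "\<lambda>G :: (real^3) \<times> real \<Rightarrow> real^3. \<integral>\<^sup>+z. ennreal ((norm (G z - u z))\<^sup>2) \<partial>lborel"
    have conv: "(\<lambda>n. ?n (mollify u (scaled spline (l n)))) \<longlonglongrightarrow> 0" if "l \<longlonglongrightarrow> 0" "\<And>n. l n \<noteq> 0" for l
      by (rule mollify_converges[OF field_L2[OF fu] field_time[OF fu] spline_measurable spline_bound(1) spline_integral _ that])
        (rule spline_support, auto)
    have "(\<lambda>n. 2 * ?n (F n) + 2 * ?n (B n)) \<longlonglongrightarrow> 2 * 0 + 2 * 0"
      unfolding F_def B_def by (intro tendsto_add ennreal_tendsto_cmult conv step_tendsto bl nz) auto
    then have lim: "(\<lambda>n. 2 * ?n (F n) + 2 * ?n (B n)) \<longlonglongrightarrow> 0" by simp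
    have le: "?n (W n) \<le> 2 * ?n (F n) + 2 * ?n (B n)" for n
    proof -
      have "?n (W n) \<le> (\<integral>\<^sup>+z. 2 * ennreal ((norm (F n z - u z))\<^sup>2) + 2 * ennreal ((norm (B n z - u z))\<^sup>2) \<partial>lborel)"
      proof (rule nn_integral_mono)
        fix z :: "(real^3) \<times> real"
        let ?c = "\<kappa> (snd z)"
        have "W n z - u z = ?c *\<^sub>R (F n z - u z) + (1 - ?c) *\<^sub>R (B n z - u z)" by (simp add: W_def algebra_simps)
        then have "(norm (W n z - u z))\<^sup>2 \<le> 2 * (norm (?c *\<^sub>R (F n z - u z)))\<^sup>2 + 2 * (norm ((1 - ?c) *\<^sub>R (B n z - u z)))\<^sup>2"
          using norm_add_sq_le[of "?c *\<^sub>R (F n z - u z)" "(1 - ?c) *\<^sub>R (B n z - u z)"] by simp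
        also have "\<dots> \<le> 2 * (norm (F n z - u z))\<^sup>2 + 2 * (norm (B n z - u z))\<^sup>2"
        proof -
          have "norm (?c *\<^sub>R (F n z - u z)) \<le> norm (F n z - u z)" "norm ((1 - ?c) *\<^sub>R (B n z - u z)) \<le> norm (B n z - u z)"
            using mult_right_mono[of "\<bar>?c\<bar>" 1 "norm (F n z - u z)"] mult_right_mono[of "\<bar>1 - ?c\<bar>" 1 "norm (B n z - u z)"]
              \<kappa>[of "snd z"] by simp_all
          then show ?thesis by (intro add_mono mult_left_mono power_mono) simp_all
        qed
        finally have "ennreal ((norm (W n z - u z))\<^sup>2) \<le> ennreal (2 * (norm (F n z - u z))\<^sup>2 + 2 * (norm (B n z - u z))\<^sup>2)"
          by (rule ennreal_leI)
        then show "ennreal ((norm (W n z - u z))\<^sup>2) \<le> 2 * ennreal ((norm (F n z - u z))\<^sup>2) + 2 * ennreal ((norm (B n z - u z))\<^sup>2)"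
          by (simp add: ennreal_plus ennreal_mult)
      qed
      also have "\<dots> = 2 * ?n (F n) + 2 * ?n (B n)"
        using Fm[of n] Bm[of n] um by (simp add: nn_integral_add nn_integral_cmult)
      finally show ?thesis .
    qed
    show "(\<lambda>n. ?n (W n)) \<longlonglongrightarrow> 0"
      by (rule tendsto_sandwich[OF _ _ tendsto_const lim]) (use le in auto)
  next
    fix w
    assume w: "w \<in> C_H \<Omega> T" "represents \<Omega> T w u"
      and conv: "\<And>t. t \<in> {0..T} \<Longrightarrow> (\<lambda>n. L2_norm M (\<lambda>x. W n (x, t) - w t x)) \<longlonglongrightarrow> 0"
    have "W n (x, 0) = smear u (scaled spline (step n)) x" for n x
      by (simp add: W_def F_def \<kappa>_def mollify_def)
    with conv[of 0] T_pos have "(\<lambda>n. L2_norm M (\<lambda>x. smear u (scaled spline (step n)) x - w 0 x)) \<longlonglongrightarrow> 0" by simp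
    with w show thesis by (rule that)
  qed
qed

end

section \<open>Test functions with separated variables\<close>

context space_time
begin

lemma QT_borel: "QT \<Omega> T \<in> sets borel"
proof -
  have "open (QT \<Omega> T)" unfolding QT_def by (rule open_Times[OF open_\<Omega>]) simp
  then show ?thesis by (rule borel_open)
qed

lemma AE_QT_fst:
  assumes "AE x in M. P x"
  shows "AE z in lebesgue_on (QT \<Omega> T). P (fst z)"
proof -
  have "AE x in lborel. x \<in> \<Omega> \<longrightarrow> P x" using assms AE_lebesgue_on_iff[of \<Omega> P] \<Omega>_borel by auto
  from AE_lborel_fst[OF this]
  have "AE z in (lborel :: ((real^3) \<times> real) measure). z \<in> QT \<Omega> T \<longrightarrow> P (fst z)"
    by eventually_elim (auto simp: QT_def)
  then show ?thesis using AE_lebesgue_on_iff[of "QT \<Omega> T"] QT_borel by auto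
qed

lemma tensor_borel:
  assumes p: "p \<in> borel_measurable borel" and \<eta>: "\<eta> \<in> bounded_continuous"
  shows "(\<lambda>z::(real^3) \<times> real. \<eta> (snd z) *\<^sub>R (p (fst z) :: real^3)) \<in> borel_measurable borel"
proof -
  have [measurable]: "(fst :: (real^3) \<times> real \<Rightarrow> real^3) \<in> borel_measurable borel"
    "(snd :: (real^3) \<times> real \<Rightarrow> real) \<in> borel_measurable borel"
    by (intro borel_measurable_continuous_onI continuous_intros)+
  note [measurable] = p bounded_continuous_measurable[OF \<eta>]
  show ?thesis by measurable
qed

text \<open>
  Lebesgue measure on \<open>S\<close> is complete, so measurability is inherited almost everywhere.
\<close>

lemma AE_lebesgue_on_measurable:
  fixes f g :: "'a::euclidean_space \<Rightarrow> real^3"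
  assumes S: "S \<in> sets borel" and g: "g \<in> borel_measurable borel" and eq: "AE z in lebesgue_on S. f z = g z"
  shows "f \<in> borel_measurable (lebesgue_on S)"
proof -
  let ?f = "\<lambda>z. if z \<in> S then f z else 0" and ?g = "\<lambda>z. if z \<in> S then g z else 0"
  have "?g \<in> borel_measurable borel" using S g by measurable
  then have gl: "?g \<in> borel_measurable lebesgue" by (intro measurable_completion) simp
  have "AE z in lborel. z \<in> S \<longrightarrow> f z = g z" using eq AE_lebesgue_on_iff[of S] S by auto
  then have "AE z in lebesgue. ?g z = ?f z" by (subst AE_completion_iff) (auto elim: eventually_mono)
  from borel_measurable_AE[OF gl this] have "?f \<in> borel_measurable lebesgue" .
  then have "?f \<in> borel_measurable (lebesgue_on S)" by (rule measurable_restrict_space1)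
  then show ?thesis by (rule measurable_cong[THEN iffD1, rotated]) simp
qed

text \<open>
  The indicator confines the product to the time interval, on which bounded functions are
  square-integrable.
\<close>

lemma tensor_integrable:
  assumes p: "p \<in> L2 lborel" and \<eta>: "\<eta> \<in> bounded_continuous"
  shows "(\<lambda>z. (indicator {0<..<T} (snd z) * \<eta> (snd z)) *\<^sub>R (p (fst z) :: real^3)) \<in> L2 (lborel :: ((real^3) \<times> real) measure)"
proof -
  obtain K where K: "\<And>s. \<bar>\<eta> s\<bar> \<le> K" using \<eta> by (auto simp: bounded_continuous_def)
  have pm: "p \<in> borel_measurable borel" using p by (simp add: L2_def)
  have [measurable]: "(snd :: (real^3) \<times> real \<Rightarrow> real) \<in> borel_measurable borel"
    by (intro borel_measurable_continuous_onI continuous_intros)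
  note [measurable] = tensor_borel[OF pm \<eta>]
  have "(\<lambda>z. indicator {0<..<T} (snd z) *\<^sub>R (\<eta> (snd z) *\<^sub>R p (fst z))) \<in> borel_measurable (borel :: ((real^3) \<times> real) measure)"
    by measurable
  then have m: "(\<lambda>z. (indicator {0<..<T} (snd z) * \<eta> (snd z)) *\<^sub>R p (fst z)) \<in> borel_measurable (lborel :: ((real^3) \<times> real) measure)"
    by simp
  have m': "(\<lambda>z. ennreal ((norm ((indicator {0<..<T} (snd z) * \<eta> (snd z)) *\<^sub>R p (fst z)))\<^sup>2)) \<in> borel_measurable ((lborel :: (real^3) measure) \<Otimes>\<^sub>M (lborel :: real measure))"
    unfolding lborel_prod by (rule measurable_compose[OF m]) simp
  have "(\<integral>\<^sup>+z. ennreal ((norm ((indicator {0<..<T} (snd z) * \<eta> (snd z)) *\<^sub>R p (fst z)))\<^sup>2) \<partial>(lborel :: ((real^3) \<times> real) measure))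
    = (\<integral>\<^sup>+x. \<integral>\<^sup>+s. ennreal ((norm ((indicator {0<..<T} s * \<eta> s) *\<^sub>R p x))\<^sup>2) \<partial>lborel \<partial>lborel)"
    using lborel.nn_integral_fst[OF m'] by (simp add: lborel_prod)
  also have "\<dots> \<le> (\<integral>\<^sup>+x. ennreal (K\<^sup>2 * T) * ennreal ((norm (p x))\<^sup>2) \<partial>lborel)"
  proof (rule nn_integral_mono)
    fix x
    have "(\<integral>\<^sup>+s. ennreal ((norm ((indicator {0<..<T} s * \<eta> s) *\<^sub>R p x))\<^sup>2) \<partial>lborel)
      \<le> (\<integral>\<^sup>+s. ennreal (K\<^sup>2 * (norm (p x))\<^sup>2) * indicator {0<..<T} s \<partial>lborel)"
    proof (rule nn_integral_mono)
      fix s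
      have "(\<eta> s)\<^sup>2 \<le> K\<^sup>2" using K[of s] by (simp add: abs_le_square_iff[symmetric])
      then have "(\<eta> s)\<^sup>2 * (norm (p x))\<^sup>2 \<le> K\<^sup>2 * (norm (p x))\<^sup>2" by (rule mult_right_mono) simp
      then show "ennreal ((norm ((indicator {0<..<T} s * \<eta> s) *\<^sub>R p x))\<^sup>2) \<le> ennreal (K\<^sup>2 * (norm (p x))\<^sup>2) * indicator {0<..<T} s"
        by (auto simp: indicator_def power_mult_distrib intro: ennreal_leI)
    qed
    also have "\<dots> = ennreal (K\<^sup>2 * T) * ennreal ((norm (p x))\<^sup>2)"
      by (subst nn_integral_cmult_indicator) (use T_pos in \<open>simp_all add: ennreal_mult mult.commute mult.left_commute\<close>)
    finally show "(\<integral>\<^sup>+s. ennreal ((norm ((indicator {0<..<T} s * \<eta> s) *\<^sub>R p x))\<^sup>2) \<partial>lborel) \<le> ennreal (K\<^sup>2 * T) * ennreal ((norm (p x))\<^sup>2)" .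
  qed
  also have "\<dots> = ennreal (K\<^sup>2 * T) * ennreal ((L2_norm lborel p)\<^sup>2)"
    using pm by (simp add: nn_integral_cmult nn_integral_eq_L2_norm[OF p])
  also have "\<dots> = ennreal (K\<^sup>2 * T * (L2_norm lborel p)\<^sup>2)" using T_pos by (simp add: ennreal_mult)
  finally show ?thesis by (rule L2_norm_le_of_nn_integral(1)[OF m]) (use T_pos in simp)
qed

lemma tensor_L2:
  assumes \<psi>: "\<psi> \<in> L2 M" and \<eta>: "\<eta> \<in> bounded_continuous"
  shows "(\<lambda>z. \<eta> (snd z) *\<^sub>R \<psi> (fst z)) \<in> L2 (lebesgue_on (QT \<Omega> T))"
proof -
  obtain p where p: "p \<in> L2 lborel" "\<forall>x. x \<notin> \<Omega> \<longrightarrow> p x = 0" "AE x in M. \<psi> x = p x"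
    by (rule L2_borel_version[OF \<Omega>_borel \<psi>])
  let ?\<psi> = "\<lambda>z. \<eta> (snd z) *\<^sub>R \<psi> (fst z)" and ?p = "\<lambda>z. (indicator {0<..<T} (snd z) * \<eta> (snd z)) *\<^sub>R p (fst z)"
  have pL: "?p \<in> L2 (lebesgue_on (QT \<Omega> T))" by (rule L2_lebesgue_on[OF QT_borel tensor_integrable[OF p(1) \<eta>]])
  have "AE z in lebesgue_on (QT \<Omega> T). z \<in> QT \<Omega> T" by (rule AE_I2) simp
  with AE_QT_fst[OF p(3)] have eq: "AE z in lebesgue_on (QT \<Omega> T). ?\<psi> z = ?p z"
    by eventually_elim (auto simp: QT_def)
  have "?p \<in> borel_measurable borel" using tensor_integrable[OF p(1) \<eta>] by (simp add: L2_def)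
  from AE_lebesgue_on_measurable[OF QT_borel this eq]
  show ?thesis
  proof (rule L2_bound[OF _ L2D(2)[OF pL]])
    show "AE z in lebesgue_on (QT \<Omega> T). (norm (?\<psi> z))\<^sup>2 \<le> (norm (?p z))\<^sup>2"
      using eq by eventually_elim simp
  qed
qed

text \<open>
  Fubini's theorem for \<open>u\<close> and a Borel representative of \<open>\<psi>\<close>.
\<close>

lemma pairing_tensor:
  assumes u: "field u" and \<psi>: "\<psi> \<in> L2 M" and \<eta>: "\<eta> \<in> bounded_continuous"
  shows "(\<integral>z. u z \<bullet> (\<eta> (snd z) *\<^sub>R \<psi> (fst z)) \<partial>lebesgue_on (QT \<Omega> T)) = L2_inner M (smear u \<eta>) \<psi>"
proof -
  obtain p where p: "p \<in> L2 lborel" "\<forall>x. x \<notin> \<Omega> \<longrightarrow> p x = 0" "AE x in M. \<psi> x = p x"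
    by (rule L2_borel_version[OF \<Omega>_borel \<psi>])
  have uL: "u \<in> L2 lborel" by (rule field_L2[OF u])
  have um: "u \<in> borel_measurable borel" using uL by (simp add: L2_def)
  have uz: "u z = 0" if "z \<notin> QT \<Omega> T" for z using u that unfolding field_def by blast
  let ?\<psi> = "\<lambda>z. \<eta> (snd z) *\<^sub>R \<psi> (fst z)" and ?p = "\<lambda>z. (indicator {0<..<T} (snd z) * \<eta> (snd z)) *\<^sub>R p (fst z)"
  have pL: "?p \<in> L2 lborel" by (rule tensor_integrable[OF p(1) \<eta>])
  then have pm: "?p \<in> borel_measurable borel" by (simp add: L2_def)
  have "(\<integral>z. u z \<bullet> ?\<psi> z \<partial>lebesgue_on (QT \<Omega> T)) = (\<integral>z. u z \<bullet> ?p z \<partial>lebesgue_on (QT \<Omega> T))"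
  proof (rule integral_cong_AE)
    have "AE z in lebesgue_on (QT \<Omega> T). z \<in> QT \<Omega> T" by (rule AE_I2) simp
    with AE_QT_fst[OF p(3)] show "AE z in lebesgue_on (QT \<Omega> T). u z \<bullet> ?\<psi> z = u z \<bullet> ?p z"
      by eventually_elim (auto simp: QT_def)
    show "(\<lambda>z. u z \<bullet> ?\<psi> z) \<in> borel_measurable (lebesgue_on (QT \<Omega> T))"
      by (intro borel_measurable_inner borel_imp_lebesgue_on[OF um] L2D(1)[OF tensor_L2[OF \<psi> \<eta>]])
    show "(\<lambda>z. u z \<bullet> ?p z) \<in> borel_measurable (lebesgue_on (QT \<Omega> T))"
      by (intro borel_measurable_inner borel_imp_lebesgue_on um pm)
  qed
  also have "\<dots> = (\<integral>z. u z \<bullet> ?p z \<partial>lborel)"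
  proof (rule integral_lebesgue_on_borel[OF QT_borel])
    show "(\<lambda>z. u z \<bullet> ?p z) \<in> borel_measurable borel" by (intro borel_measurable_inner um pm)
  qed (simp add: uz)
  also have "\<dots> = (\<integral>x. \<integral>s. u (x, s) \<bullet> ?p (x, s) \<partial>lborel \<partial>lborel)"
  proof -
    have "integrable (lborel \<Otimes>\<^sub>M lborel) (\<lambda>z. u z \<bullet> ?p z)" using L2_inner_integrable[OF uL pL] by (simp add: lborel_prod)
    from lborel_pair.integral_fst'[OF this] show ?thesis by (simp add: lborel_prod)
  qed
  also have "\<dots> = (\<integral>x. smear u \<eta> x \<bullet> p x \<partial>lborel)"
  proof (rule integral_cong_AE)
    have sm: "smear u \<eta> \<in> borel_measurable borel" by (rule smear_measurable[OF uL bounded_continuous_measurable[OF \<eta>]])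
    have ppm: "p \<in> borel_measurable borel" using p(1) by (simp add: L2_def)
    show "(\<lambda>x. smear u \<eta> x \<bullet> p x) \<in> borel_measurable lborel" using sm ppm by simp
    have "(\<lambda>z. u z \<bullet> ?p z) \<in> borel_measurable borel" by (intro borel_measurable_inner um pm)
    then have "(\<lambda>(x, s). u (x, s) \<bullet> ?p (x, s)) \<in> borel_measurable (lborel \<Otimes>\<^sub>M lborel)" by (simp add: lborel_prod split_beta')
    then show "(\<lambda>x. \<integral>s. u (x, s) \<bullet> ?p (x, s) \<partial>lborel) \<in> borel_measurable lborel"
      by (rule lborel.borel_measurable_lebesgue_integral)
    show "AE x in lborel. (\<integral>s. u (x, s) \<bullet> ?p (x, s) \<partial>lborel) = smear u \<eta> x \<bullet> p x"
      using L2_slice_integrable[OF uL field_time[OF u]]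
    proof eventually_elim
      case (elim x)
      obtain K where K: "\<And>s. \<bar>\<eta> s\<bar> \<le> K" using \<eta> by (auto simp: bounded_continuous_def)
      have i: "integrable lborel (\<lambda>s. \<eta> s *\<^sub>R u (x, s))"
        by (rule integrable_bounded_scaleR[OF elim _ K]) (use bounded_continuous_measurable[OF \<eta>] in simp)
      have "(\<integral>s. u (x, s) \<bullet> ?p (x, s) \<partial>lborel) = (\<integral>s. (\<eta> s *\<^sub>R u (x, s)) \<bullet> p x \<partial>lborel)"
      proof (rule Bochner_Integration.integral_cong[OF refl])
        fix s
        show "u (x, s) \<bullet> ?p (x, s) = (\<eta> s *\<^sub>R u (x, s)) \<bullet> p x"
          using field_time[OF u] by (cases "s \<in> {0<..<T}") (auto simp: time_supported_def)
      qed
      also have "\<dots> = smear u \<eta> x \<bullet> p x" unfolding smear_def by (rule integral_inner_left) (rule i)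
      finally show ?case .
    qed
  qed
  also have "\<dots> = (\<integral>x. smear u \<eta> x \<bullet> p x \<partial>M)"
  proof (rule integral_lebesgue_on_borel[symmetric, OF \<Omega>_borel])
    show "(\<lambda>x. smear u \<eta> x \<bullet> p x) \<in> borel_measurable borel"
      using smear_measurable[OF uL bounded_continuous_measurable[OF \<eta>]] p(1) by (auto simp: L2_def)
  qed (use p(2) in simp)
  also have "\<dots> = L2_inner M (smear u \<eta>) \<psi>"
  proof -
    have "AE x in M. p x = \<psi> x" using p(3) by eventually_elim simp
    from L2_inner_cong_AE[OF smear_in[OF u \<eta>] smear_in[OF u \<eta>] L2_lebesgue_on[OF \<Omega>_borel p(1)] \<psi> _ this]
    show ?thesis by (simp add: L2_inner_def)
  qed
  finally show ?thesis .
qed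

lemma test_field_is_field:
  assumes \<theta>: "\<theta> \<in> test_fields (QT \<Omega> T)"
  shows "field \<theta>" "field (\<lambda>z. frechet_derivative \<theta> (at z) (0, 1))"
proof -
  have out: "z \<notin> closure {z. \<theta> z \<noteq> 0}" if "z \<notin> QT \<Omega> T" for z
    by (rule contra_subsetD[OF test_field_support(2)[OF \<theta>] that])
  have b: "(0, 1) \<in> (Basis :: ((real^3) \<times> real) set)" by (simp add: Basis_prod_def)
  show "field \<theta>" unfolding field_def using test_field_L2(1)[OF \<theta>] test_field_outside[OF \<theta> out] by blast
  show "field (\<lambda>z. frechet_derivative \<theta> (at z) (0, 1))"
    unfolding field_def using test_field_L2(2)[OF \<theta> b] test_field_derivative_outside[OF \<theta> out] by blast
qed

text \<open>
  Integration by parts in \<open>t\<close> at fixed \<open>x\<close>; test fields vanish at both ends of the time interval.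
\<close>

lemma smear_time_derivative:
  assumes \<theta>: "\<theta> \<in> test_fields (QT \<Omega> T)" and \<eta>: "\<eta> \<in> bounded_continuous" "\<eta>' \<in> bounded_continuous"
    and deriv: "\<And>s. (\<eta> has_real_derivative \<eta>' s) (at s)"
  shows "smear (\<lambda>z. frechet_derivative \<theta> (at z) (0, 1)) \<eta> x = - smear \<theta> \<eta>' x"
proof -
  let ?d = "\<lambda>z. frechet_derivative \<theta> (at z) (0, 1)"
  let ?f = "\<lambda>s. \<eta> s *\<^sub>R \<theta> (x, s)" and ?f' = "\<lambda>s. \<eta> s *\<^sub>R ?d (x, s) + \<eta>' s *\<^sub>R \<theta> (x, s)"
  have b: "(0, 1) \<in> (Basis :: ((real^3) \<times> real) set)" by (simp add: Basis_prod_def)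
  have z: "\<theta> (x, s) = 0" "?d (x, s) = 0" if "s \<notin> {0<..<T}" for s
    using field_time[OF test_field_is_field(1)[OF \<theta>]] field_time[OF test_field_is_field(2)[OF \<theta>]] that
    unfolding time_supported_def by blast+
  have "((\<lambda>s. \<theta> (x, s)) has_vector_derivative ?d (x, s)) (at s)" for s
  proof -
    have "((\<lambda>s. (x, s)) has_derivative (\<lambda>h. (0, h))) (at s)" by (auto intro!: derivative_eq_intros)
    from has_derivative_compose[OF this test_field_has_derivative[OF \<theta>]]
    have D: "((\<lambda>s. \<theta> (x, s)) has_derivative (\<lambda>h. frechet_derivative \<theta> (at (x, s)) (0, h))) (at s)" .
    have "(\<lambda>h. frechet_derivative \<theta> (at (x, s)) (0, h)) = (\<lambda>h. h *\<^sub>R ?d (x, s))"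
    proof
      fix h
      show "frechet_derivative \<theta> (at (x, s)) (0, h) = h *\<^sub>R ?d (x, s)"
        using linear_scale[OF has_derivative_linear[OF test_field_has_derivative[OF \<theta>]], of "(x, s)" h "(0, 1)"] by simp
    qed
    with D show ?thesis by (simp only: has_vector_derivative_def)
  qed
  then have fd: "(?f has_vector_derivative ?f' s) (at s)" for s
    using deriv by (intro has_vector_derivative_scaleR) auto
  have pc: "continuous_on UNIV (\<lambda>s. (x, s))" by (intro continuous_intros)
  have \<theta>c: "continuous_on UNIV (\<lambda>s. \<theta> (x, s))" "continuous_on UNIV (\<lambda>s. ?d (x, s))"
    using continuous_on_compose2[OF test_field_continuous[OF \<theta>] pc] continuous_on_compose2[OF test_field_derivative_continuous[OF \<theta> b] pc] by auto
  have \<eta>c: "continuous_on UNIV \<eta>" "continuous_on UNIV \<eta>'" using \<eta> by (auto simp: bounded_continuous_def)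
  have K: "compact {0..T}" by simp
  have i: "integrable lborel (\<lambda>s. \<eta> s *\<^sub>R ?d (x, s))" "integrable lborel (\<lambda>s. \<eta>' s *\<^sub>R \<theta> (x, s))"
    by (rule integrable_compact_support[OF _ K]; use z in \<open>auto intro!: continuous_intros \<theta>c \<eta>c\<close>)+
  have hi: "(?f' has_integral (?f T - ?f 0)) {0..T}"
    by (rule fundamental_theorem_of_calculus) (use T_pos fd in \<open>auto intro: has_vector_derivative_at_within\<close>)
  have si: "set_integrable lborel {0..T} ?f'"
    by (rule borel_integrable_atLeastAtMost') (intro continuous_intros continuous_on_subset[OF \<theta>c(1)] continuous_on_subset[OF \<theta>c(2)]
      continuous_on_subset[OF \<eta>c(1)] continuous_on_subset[OF \<eta>c(2)]; simp)
  have "(\<integral>s. ?f' s \<partial>lborel) = (\<integral>s. indicator {0..T} s *\<^sub>R ?f' s \<partial>lborel)"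
    by (rule Bochner_Integration.integral_cong[OF refl]) (use z in \<open>auto simp: indicator_def\<close>)
  also have "\<dots> = ?f T - ?f 0"
    using set_borel_integral_eq_integral(2)[OF si] integral_unique[OF hi] unfolding set_lebesgue_integral_def by simp
  also have "\<dots> = 0" using z(1)[of T] z(1)[of 0] by simp
  finally have "smear ?d \<eta> x + smear \<theta> \<eta>' x = 0" unfolding smear_def using i by simp
  then show ?thesis by (simp add: eq_neg_iff_add_eq_0)
qed

text \<open>
  For strong measurability, \<open>\<eta>\<close> is rounded down to multiples of \<open>1 / (n + 1)\<close>; it takes finitely many
  such values as it is bounded.
\<close>

lemma admissible_tensor:
  assumes W: "W = V \<Omega> \<or> W = V0 \<Omega>" and \<phi>: "\<phi> \<in> W"
    and \<eta>: "\<eta> \<in> bounded_continuous" "\<eta>' \<in> bounded_continuous"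
    and deriv: "\<And>s. (\<eta> has_real_derivative \<eta>' s) (at s)" and end0: "\<eta> T = 0"
  shows "admissible \<Omega> T W (\<lambda>z. \<eta> (snd z) *\<^sub>R \<phi> (fst z)) (\<lambda>z. \<eta>' (snd z) *\<^sub>R \<phi> (fst z))
    (\<lambda>z. \<eta> (snd z) *\<^sub>R weak_curl \<Omega> \<phi> (fst z)) (\<lambda>t x. \<eta> t *\<^sub>R \<phi> x)"
proof -
  have \<phi>V: "\<phi> \<in> V \<Omega>" using W \<phi> by (auto simp: V0_def)
  have \<phi>L: "\<phi> \<in> L2 M" and cL: "weak_curl \<Omega> \<phi> \<in> L2 M" by (rule V_L2[OF \<phi>V])+
  have Wscale: "(\<lambda>x. c *\<^sub>R \<phi> x) \<in> W" for c using W \<phi> V_scaleR[OF open_\<Omega>] V0_scaleR[OF open_\<Omega>] by auto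
  obtain K where K: "\<And>s. \<bar>\<eta> s\<bar> \<le> K" using \<eta>(1) by (auto simp: bounded_continuous_def)
  have \<eta>m: "\<eta> \<in> borel_measurable borel" by (rule bounded_continuous_measurable[OF \<eta>(1)])
  have \<eta>c: "continuous_on UNIV \<eta>" using \<eta>(1) by (simp add: bounded_continuous_def)
  have "(\<lambda>t x. \<eta> t *\<^sub>R \<phi> x) \<in> bochner_L2 T W (V_norm \<Omega>)"
  proof -
    define r where "r n t = real_of_int \<lfloor>real (Suc n) * \<eta> t\<rfloor> / real (Suc n)" for n t
    have rm: "r n \<in> borel_measurable borel" for n unfolding r_def[abs_def] using \<eta>m by measurable
    have fin: "finite (range (r n))" for n
    proof -
      have "\<lfloor>real (Suc n) * \<eta> t\<rfloor> \<in> {\<lfloor>- (real (Suc n) * K)\<rfloor>..\<lfloor>real (Suc n) * K\<rfloor>}" for t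
      proof -
        have "- K \<le> \<eta> t" "\<eta> t \<le> K" using K[of t] by auto
        then have "real (Suc n) * (- K) \<le> real (Suc n) * \<eta> t" "real (Suc n) * \<eta> t \<le> real (Suc n) * K"
          by (intro mult_left_mono; simp)+
        then show ?thesis by (auto intro: floor_mono)
      qed
      then have "range (r n) \<subseteq> (\<lambda>k. real_of_int k / real (Suc n)) ` {\<lfloor>- (real (Suc n) * K)\<rfloor>..\<lfloor>real (Suc n) * K\<rfloor>}"
        unfolding r_def by blast
      then show ?thesis by (rule finite_subset) simp
    qed
    have "simple_curve T W (\<lambda>t x. r n t *\<^sub>R \<phi> x)" for n
      unfolding simple_curve_def
    proof (intro conjI allI)
      have "(\<lambda>t x. r n t *\<^sub>R \<phi> x) ` {0<..<T} \<subseteq> (\<lambda>c x. c *\<^sub>R \<phi> x) ` range (r n)" by auto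
      then show "finite ((\<lambda>t x. r n t *\<^sub>R \<phi> x) ` {0<..<T})" by (rule finite_subset) (simp add: fin)
      show "(\<lambda>t x. r n t *\<^sub>R \<phi> x) ` {0<..<T} \<subseteq> W" using Wscale by auto
      fix w
      have "{t\<in>{0<..<T}. (\<lambda>x. r n t *\<^sub>R \<phi> x) = w} = (\<Union>c\<in>{c\<in>range (r n). (\<lambda>x. c *\<^sub>R \<phi> x) = w}. {0<..<T} \<inter> r n -` {c})"
        by auto
      also have "\<dots> \<in> sets borel"
      proof (rule sets.finite_UN)
        show "finite {c\<in>range (r n). (\<lambda>x. c *\<^sub>R \<phi> x) = w}" using fin by simp
        show "{0<..<T} \<inter> r n -` {c} \<in> sets borel" for c
          using measurable_sets_borel[OF rm, of "{c}"] by simp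
      qed
      finally show "{t\<in>{0<..<T}. (\<lambda>x. r n t *\<^sub>R \<phi> x) = w} \<in> sets lebesgue" by auto
    qed
    moreover have "(\<lambda>n. V_norm \<Omega> (\<lambda>x. r n t *\<^sub>R \<phi> x - \<eta> t *\<^sub>R \<phi> x)) \<longlonglongrightarrow> 0" for t
    proof -
      have r_le: "\<bar>r n t - \<eta> t\<bar> \<le> inverse (real (Suc n))" for n
      proof -
        have "r n t - \<eta> t = (real_of_int \<lfloor>real (Suc n) * \<eta> t\<rfloor> - real (Suc n) * \<eta> t) / real (Suc n)"
          by (simp add: r_def diff_divide_distrib)
        also have "\<bar>\<dots>\<bar> \<le> 1 / real (Suc n)" unfolding abs_divide
          by (intro frac_le) (auto simp: abs_le_iff, linarith+)
        finally show ?thesis by (simp add: inverse_eq_divide)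
      qed
      have "(\<lambda>n. r n t - \<eta> t) \<longlonglongrightarrow> 0"
        by (rule Lim_null_comparison[OF _ LIMSEQ_inverse_real_of_nat]) (use r_le in auto)
      then have "(\<lambda>n. \<bar>r n t - \<eta> t\<bar> * V_norm \<Omega> \<phi>) \<longlonglongrightarrow> \<bar>0\<bar> * V_norm \<Omega> \<phi>" by (intro tendsto_intros)
      moreover have "V_norm \<Omega> (\<lambda>x. r n t *\<^sub>R \<phi> x - \<eta> t *\<^sub>R \<phi> x) = \<bar>r n t - \<eta> t\<bar> * V_norm \<Omega> \<phi>" for n
        using V_norm_scaleR[OF open_\<Omega> \<phi>V, of "r n t - \<eta> t"] by (simp add: scaleR_diff_left)
      ultimately show ?thesis by simp
    qed
    moreover have "integrable (lebesgue_on {0<..<T}) (\<lambda>t. (V_norm \<Omega> (\<lambda>x. \<eta> t *\<^sub>R \<phi> x))\<^sup>2)"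
    proof -
      have "integrable (lebesgue_on {0<..<T}) (\<lambda>t. (\<bar>\<eta> t\<bar> * V_norm \<Omega> \<phi>)\<^sup>2)"
      proof (rule Bochner_Integration.integrable_bound)
        have "finite_measure (lebesgue_on {0<..<T})" by (rule finite_measure_lebesgue_on) simp
        then show "integrable (lebesgue_on {0<..<T}) (\<lambda>t. (K * V_norm \<Omega> \<phi>)\<^sup>2)"
          by (simp add: finite_measure.integrable_const)
        show "(\<lambda>t. (\<bar>\<eta> t\<bar> * V_norm \<Omega> \<phi>)\<^sup>2) \<in> borel_measurable (lebesgue_on {0<..<T})"
          by (rule borel_imp_lebesgue_on) (use \<eta>m in measurable)
        show "AE t in lebesgue_on {0<..<T}. norm ((\<bar>\<eta> t\<bar> * V_norm \<Omega> \<phi>)\<^sup>2) \<le> norm ((K * V_norm \<Omega> \<phi>)\<^sup>2)"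
        proof (rule AE_I2)
          fix t
          have "(\<bar>\<eta> t\<bar>)\<^sup>2 \<le> K\<^sup>2" by (rule power_mono[OF K]) simp
          then show "norm ((\<bar>\<eta> t\<bar> * V_norm \<Omega> \<phi>)\<^sup>2) \<le> norm ((K * V_norm \<Omega> \<phi>)\<^sup>2)"
            by (simp add: power_mult_distrib mult_right_mono)
        qed
      qed
      then show ?thesis by (simp add: V_norm_scaleR[OF open_\<Omega> \<phi>V])
    qed
    ultimately show ?thesis
      unfolding bochner_L2_def using Wscale
      by (intro CollectI conjI exI[of _ "\<lambda>n t x. r n t *\<^sub>R \<phi> x"] allI AE_I2) auto
  qed
  moreover have "has_time_derivative \<Omega> T (\<lambda>z. \<eta> (snd z) *\<^sub>R \<phi> (fst z)) (\<lambda>z. \<eta>' (snd z) *\<^sub>R \<phi> (fst z))"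
    unfolding has_time_derivative_def
  proof (intro conjI ballI tensor_L2[OF \<phi>L \<eta>(2)])
    fix \<theta> assume \<theta>: "\<theta> \<in> test_fields (QT \<Omega> T)"
    let ?d = "\<lambda>z. frechet_derivative \<theta> (at z) (0, 1)"
    have "(\<integral>z. (\<eta> (snd z) *\<^sub>R \<phi> (fst z)) \<bullet> ?d z \<partial>lebesgue_on (QT \<Omega> T)) = L2_inner M (smear ?d \<eta>) \<phi>"
      using pairing_tensor[OF test_field_is_field(2)[OF \<theta>] \<phi>L \<eta>(1)] by (simp add: inner_commute)
    also have "\<dots> = - L2_inner M (smear \<theta> \<eta>') \<phi>"
      by (simp add: L2_inner_def smear_time_derivative[OF \<theta> \<eta> deriv])
    also have "\<dots> = - (\<integral>z. (\<eta>' (snd z) *\<^sub>R \<phi> (fst z)) \<bullet> \<theta> z \<partial>lebesgue_on (QT \<Omega> T))"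
      using pairing_tensor[OF test_field_is_field(1)[OF \<theta>] \<phi>L \<eta>(2)] by (simp add: inner_commute)
    finally show "(\<integral>z. (\<eta> (snd z) *\<^sub>R \<phi> (fst z)) \<bullet> ?d z \<partial>lebesgue_on (QT \<Omega> T))
      = - (\<integral>z. (\<eta>' (snd z) *\<^sub>R \<phi> (fst z)) \<bullet> \<theta> z \<partial>lebesgue_on (QT \<Omega> T))" .
  qed
  moreover have "represents \<Omega> T (\<lambda>t. weak_curl \<Omega> (\<lambda>x. \<eta> t *\<^sub>R \<phi> x)) (\<lambda>z. \<eta> (snd z) *\<^sub>R weak_curl \<Omega> \<phi> (fst z))"
    unfolding represents_def using weak_curl_scaleR[OF open_\<Omega> \<phi>V] by simp
  moreover have "(\<lambda>t x. \<eta> t *\<^sub>R \<phi> x) \<in> C_H \<Omega> T"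
    unfolding C_H_def
  proof (intro CollectI conjI ballI L2_scaleR \<phi>L)
    fix t
    have "continuous (at t within {0..T}) \<eta>"
      using \<eta>c by (simp add: continuous_on_eq_continuous_at continuous_at_imp_continuous_within)
    then have "(\<eta> \<longlongrightarrow> \<eta> t) (at t within {0..T})" by (simp add: continuous_within)
    then have "((\<lambda>s. \<bar>\<eta> s - \<eta> t\<bar> * L2_norm M \<phi>) \<longlongrightarrow> \<bar>\<eta> t - \<eta> t\<bar> * L2_norm M \<phi>) (at t within {0..T})"
      by (intro tendsto_intros)
    moreover have "L2_norm M (\<lambda>x. \<eta> s *\<^sub>R \<phi> x - \<eta> t *\<^sub>R \<phi> x) = \<bar>\<eta> s - \<eta> t\<bar> * L2_norm M \<phi>" for s
      using L2_norm_scaleR[of M "\<eta> s - \<eta> t" \<phi>] by (simp add: scaleR_diff_left)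
    ultimately show "((\<lambda>s. L2_norm M (\<lambda>x. \<eta> s *\<^sub>R \<phi> x - \<eta> t *\<^sub>R \<phi> x)) \<longlongrightarrow> 0) (at t within {0..T})" by simp
  qed
  moreover have "represents \<Omega> T (\<lambda>t x. \<eta> t *\<^sub>R \<phi> x) (\<lambda>z. \<eta> (snd z) *\<^sub>R \<phi> (fst z))"
    unfolding represents_def by simp
  ultimately show ?thesis
    unfolding admissible_def using tensor_L2[OF \<phi>L \<eta>(1)] tensor_L2[OF cL \<eta>(1)] end0 by simp
qed

end

section \<open>The balance law and the initial values\<close>

lemma bounded_continuous_uminus: "\<alpha> \<in> bounded_continuous \<Longrightarrow> (\<lambda>s. - \<alpha> s) \<in> bounded_continuous"
  using bounded_continuous_combination[of \<alpha> \<alpha> "-1" 0] by simp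

lemma smear_uminus: "smear u (\<lambda>s. - \<alpha> s) = (\<lambda>x. - smear u \<alpha> x)"
  by (simp add: smear_def fun_eq_iff)

lemma L2_inner_tendsto:
  assumes "\<And>n. f n \<in> L2 M" "g \<in> L2 M" "\<psi> \<in> L2 M" and lim: "(\<lambda>n. L2_norm M (\<lambda>x. f n x - g x)) \<longlonglongrightarrow> 0"
  shows "(\<lambda>n. L2_inner M (f n) \<psi>) \<longlonglongrightarrow> L2_inner M g \<psi>"
proof (rule LIM_zero_cancel, rule Lim_null_comparison)
  show "\<forall>\<^sub>F n in sequentially. norm (L2_inner M (f n) \<psi> - L2_inner M g \<psi>) \<le> L2_norm M (\<lambda>x. f n x - g x) * L2_norm M \<psi>"
    using L2_Cauchy_Schwarz[OF L2_diff[OF assms(1,2)] assms(3)] assms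
    by (intro always_eventually allI) (simp add: L2_inner_diff_left)
  show "(\<lambda>n. L2_norm M (\<lambda>x. f n x - g x) * L2_norm M \<psi>) \<longlonglongrightarrow> 0"
    using tendsto_mult_right[OF lim, of "L2_norm M \<psi>"] by simp
qed

lemma spline_primitive_bounded: "\<exists>K. \<forall>s. \<bar>1 - spline_primitive s\<bar> \<le> K"
proof -
  have c: "continuous_on UNIV spline_primitive"
    unfolding spline_primitive_def[abs_def] by (intro continuous_intros)
  have "compact ((\<lambda>s. 1 - spline_primitive s) ` {0..1})"
    by (intro compact_continuous_image continuous_intros continuous_on_subset[OF c]) auto
  then obtain K where K: "\<And>s. s \<in> {0..1} \<Longrightarrow> \<bar>1 - spline_primitive s\<bar> \<le> K"
    using compact_imp_bounded bounded_iff by (metis imageI real_norm_def)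
  have "\<bar>1 - spline_primitive s\<bar> \<le> max K 1" for s
    using K[of s] spline_primitive_values[of s] by (cases "s \<le> 0"; cases "1 \<le> s") (auto simp: le_max_iff_disj)
  then show ?thesis by blast
qed

context space_time
begin

lemma AE_QT_slices:
  assumes "AE z in lebesgue_on (QT \<Omega> T). P z"
  shows "AE t in lebesgue_on {0<..<T}. AE x in M. P (x, t)"
proof -
  have "AE z in lborel. z \<in> QT \<Omega> T \<longrightarrow> P z" using assms AE_lebesgue_on_iff[of "QT \<Omega> T"] QT_borel by auto
  then obtain N where N: "{z. \<not> (z \<in> QT \<Omega> T \<longrightarrow> P z)} \<subseteq> N" "N \<in> sets borel" "emeasure lborel N = 0"
    by (auto elim!: AE_E)
  have Nm: "N \<in> sets (lborel \<Otimes>\<^sub>M lborel)" unfolding lborel_prod using N(2) by simp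
  have "emeasure (lborel \<Otimes>\<^sub>M lborel) N = (\<integral>\<^sup>+t. emeasure lborel ((\<lambda>x. (x, t)) -` N) \<partial>lborel)"
    by (rule lborel_pair.emeasure_pair_measure_alt2[OF Nm])
  then have "(\<integral>\<^sup>+t. emeasure lborel ((\<lambda>x. (x, t)) -` N) \<partial>lborel) = 0" using N(3) by (simp add: lborel_prod)
  then have "AE t in lborel. emeasure lborel ((\<lambda>x. (x, t)) -` N) = 0"
    using nn_integral_0_iff_AE[OF lborel_pair.measurable_emeasure_Pair2[OF Nm]] by simp
  then have "AE t in lborel. t \<in> {0<..<T} \<longrightarrow> (AE x in M. P (x, t))"
  proof eventually_elim
    case (elim t)
    show ?case
    proof
      assume t: "t \<in> {0<..<T}"
      have "(\<lambda>x. (x, t)) -` N \<in> sets lborel" using sets_Pair2[OF Nm, of t] by simp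
      with elim have "(\<lambda>x. (x, t)) -` N \<in> null_sets lborel" by (simp add: null_sets_def)
      from AE_not_in[OF this] have "AE x in lborel. x \<in> \<Omega> \<longrightarrow> P (x, t)"
      proof eventually_elim
        case (elim x)
        then have "\<not> (x, t) \<in> {z. \<not> (z \<in> QT \<Omega> T \<longrightarrow> P z)}" using N(1) by blast
        then show ?case using t by (simp add: QT_def)
      qed
      then show "AE x in M. P (x, t)" using AE_lebesgue_on_iff[of \<Omega> "\<lambda>x. P (x, t)"] \<Omega>_borel by auto
    qed
  qed
  then show ?thesis by (subst AE_lebesgue_on_iff) auto
qed

lemma represents_cong:
  assumes w: "represents \<Omega> T w u" and eq: "AE z in lebesgue_on (QT \<Omega> T). u z = v z"
  shows "represents \<Omega> T w v"
  using w AE_QT_slices[OF eq] unfolding represents_def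
proof eventually_elim
  case (elim t)
  then show ?case by eventually_elim simp
qed

text \<open>
  For a simple function in place of \<open>u\<close> the composite is pieced together from finitely many measurable
  functions.  Continuity in \<open>\<xi>\<close> carries this over to limits almost everywhere.
\<close>

lemma caratheodory_measurable:
  assumes f: "caratheodory \<Omega> T f" and u: "u \<in> borel_measurable (lebesgue_on (QT \<Omega> T))"
  shows "(\<lambda>z. f z (u z)) \<in> borel_measurable (lebesgue_on (QT \<Omega> T))"
proof -
  let ?Q = "lebesgue_on (QT \<Omega> T)"
  obtain F where F: "\<And>i. simple_function ?Q (F i)" "\<And>z. z \<in> space ?Q \<Longrightarrow> (\<lambda>i. F i z) \<longlonglongrightarrow> u z"
    using borel_measurable_implies_sequence_metric[OF u, of 0] by blast
  have Fm: "(\<lambda>z. f z (F i z)) \<in> borel_measurable ?Q" for i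
  proof -
    let ?I = "F i ` space ?Q"
    have fin: "finite ?I" by (rule simple_functionD(1)[OF F(1)])
    have Fi: "F i \<in> measurable ?Q (count_space ?I)"
      by (subst measurable_count_space_eq_countable)
        (use fin simple_functionD(2)[OF F(1)] in \<open>auto intro: countable_finite\<close>)
    have f\<xi>: "(\<lambda>z. f z \<xi>) \<in> borel_measurable ?Q" for \<xi> using f by (simp add: caratheodory_def)
    show ?thesis
      by (rule measurable_compose_countable'[where f="\<lambda>\<xi> z. f z \<xi>", OF f\<xi> Fi countable_finite[OF fin]])
  qed
  define g where "g z = lim (\<lambda>i. f z (F i z))" for z
  have gm: "g \<in> borel_measurable ?Q" unfolding g_def by (rule borel_measurable_lim_metric) (rule Fm)
  obtain g' where g': "g' \<in> borel_measurable borel" "AE z in ?Q. g z = g' z"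
    by (rule borel_version[OF QT_borel gm])
  have "AE z in ?Q. continuous_on UNIV (f z)" using f by (simp add: caratheodory_def)
  moreover have "AE z in ?Q. (\<lambda>i. F i z) \<longlonglongrightarrow> u z" by (rule AE_I2) (rule F(2))
  ultimately have "AE z in ?Q. f z (u z) = g' z" using g'(2)
  proof eventually_elim
    case (elim z)
    have "(\<lambda>i. f z (F i z)) \<longlonglongrightarrow> f z (u z)"
      using continuous_on_tendsto_compose[OF elim(1,2)] by simp
    then have "g z = f z (u z)" unfolding g_def by (rule limI)
    with elim(3) show ?case by simp
  qed
  from AE_lebesgue_on_measurable[OF QT_borel g'(1) this] show ?thesis .
qed

lemma field_version:
  assumes "u \<in> L2 (lebesgue_on (QT \<Omega> T))"
  obtains v where "field v" "AE z in lebesgue_on (QT \<Omega> T). u z = v z"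
proof -
  obtain v where "v \<in> L2 lborel" "\<forall>z. z \<notin> QT \<Omega> T \<longrightarrow> v z = 0" "AE z in lebesgue_on (QT \<Omega> T). u z = v z"
    by (rule L2_borel_version[OF QT_borel assms])
  then show ?thesis using that unfolding field_def by blast
qed

lemma pairing_version:
  assumes u: "u \<in> L2 (lebesgue_on (QT \<Omega> T))" and v: "field v" "AE z in lebesgue_on (QT \<Omega> T). u z = v z"
    and \<psi>: "\<psi> \<in> L2 M" and \<eta>: "\<eta> \<in> bounded_continuous"
  shows "(\<integral>z. u z \<bullet> (\<eta> (snd z) *\<^sub>R \<psi> (fst z)) \<partial>lebesgue_on (QT \<Omega> T)) = L2_inner M (smear v \<eta>) \<psi>"
    and "integrable (lebesgue_on (QT \<Omega> T)) (\<lambda>z. u z \<bullet> (\<eta> (snd z) *\<^sub>R \<psi> (fst z)))"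
proof -
  note t = tensor_L2[OF \<psi> \<eta>]
  show "integrable (lebesgue_on (QT \<Omega> T)) (\<lambda>z. u z \<bullet> (\<eta> (snd z) *\<^sub>R \<psi> (fst z)))"
    by (rule L2_inner_integrable[OF u t])
  have vL: "v \<in> L2 (lebesgue_on (QT \<Omega> T))" by (rule L2_lebesgue_on[OF QT_borel field_L2[OF v(1)]])
  show "(\<integral>z. u z \<bullet> (\<eta> (snd z) *\<^sub>R \<psi> (fst z)) \<partial>lebesgue_on (QT \<Omega> T)) = L2_inner M (smear v \<eta>) \<psi>"
    using L2_inner_cong_AE[OF u vL t t v(2)] pairing_tensor[OF v(1) \<psi> \<eta>] by (simp add: L2_inner_def)
qed

text \<open>
  Symmetry moves the matrix from the unknown to the test field, where it leaves the product form intact.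
\<close>

lemma pairing_matrix:
  assumes A: "bounded_measurable_entries \<Omega> A" "\<forall>x\<in>\<Omega>. transpose (A x) = A x"
    and u: "u \<in> L2 (lebesgue_on (QT \<Omega> T))" and v: "field v" "AE z in lebesgue_on (QT \<Omega> T). u z = v z"
    and \<psi>: "\<psi> \<in> L2 M" and \<eta>: "\<eta> \<in> bounded_continuous"
  shows "(\<integral>z. (A (fst z) *v u z) \<bullet> (\<eta> (snd z) *\<^sub>R \<psi> (fst z)) \<partial>lebesgue_on (QT \<Omega> T))
    = L2_inner M (\<lambda>x. A x *v smear v \<eta> x) \<psi>"
proof -
  have "(\<integral>z. (A (fst z) *v u z) \<bullet> (\<eta> (snd z) *\<^sub>R \<psi> (fst z)) \<partial>lebesgue_on (QT \<Omega> T))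
    = (\<integral>z. u z \<bullet> (\<eta> (snd z) *\<^sub>R (A (fst z) *v \<psi> (fst z))) \<partial>lebesgue_on (QT \<Omega> T))"
  proof (rule Bochner_Integration.integral_cong[OF refl])
    fix z assume "z \<in> space (lebesgue_on (QT \<Omega> T))"
    then have "transpose (A (fst z)) = A (fst z)" using A(2) by (auto simp: QT_def)
    then have "(A (fst z) *v u z) \<bullet> \<psi> (fst z) = u z \<bullet> (A (fst z) *v \<psi> (fst z))"
      by (metis dot_lmul_matrix transpose_matrix_vector)
    then show "(A (fst z) *v u z) \<bullet> (\<eta> (snd z) *\<^sub>R \<psi> (fst z)) = u z \<bullet> (\<eta> (snd z) *\<^sub>R (A (fst z) *v \<psi> (fst z)))"
      by simp
  qed
  also have "\<dots> = L2_inner M (smear v \<eta>) (\<lambda>x. A x *v \<psi> x)"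
    using pairing_version(1)[OF u v L2_matrix_mult[OF A(1) \<psi>] \<eta>] .
  also have "\<dots> = L2_inner M (\<lambda>x. A x *v smear v \<eta> x) \<psi>" by (rule L2_inner_matrix_sym[OF A(2), symmetric])
  finally show ?thesis .
qed

text \<open>
  Test fields determine \<open>A w\<close> almost everywhere, and coercivity makes \<open>A\<close> injective at every point.
\<close>

lemma equal_of_weighted_pairings:
  assumes A: "coefficient \<Omega> A c" and w: "w \<in> L2 M" "w' \<in> L2 M"
    and eq: "\<And>\<phi>. \<phi> \<in> test_fields \<Omega> \<Longrightarrow> L2_inner M (\<lambda>x. A x *v w x) \<phi> = L2_inner M (\<lambda>x. A x *v w' x) \<phi>"
  shows "AE x in M. w x = w' x"
proof -
  have Ab: "bounded_measurable_entries \<Omega> A" using A by (simp add: coefficient_def)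
  note L = L2_matrix_mult[OF Ab w(1)] L2_matrix_mult[OF Ab w(2)]
  have "AE x in M. A x *v w x - A x *v w' x = 0"
  proof (rule L2_orthogonal_test_fields[OF open_\<Omega> L2_diff[OF L]])
    fix \<phi> assume \<phi>: "\<phi> \<in> test_fields \<Omega>"
    show "(\<integral>x. (A x *v w x - A x *v w' x) \<bullet> \<phi> x \<partial>M) = 0"
      using L2_inner_diff_left[OF L test_field_L2_on[OF open_\<Omega> \<phi>]] eq[OF \<phi>] by (simp add: L2_inner_def)
  qed
  moreover have "AE x in M. x \<in> \<Omega>" by (rule AE_I2) simp
  ultimately show ?thesis
  proof eventually_elim
    case (elim x)
    have "c * (norm (w x - w' x))\<^sup>2 \<le> (A x *v (w x - w' x)) \<bullet> (w x - w' x)" using A elim(2) by (simp add: coefficient_def)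
    also have "\<dots> = 0" using elim(1) by (simp add: matrix_vector_mult_diff_distrib)
    finally show ?case using A by (simp add: coefficient_def mult_le_0_iff)
  qed
qed

text \<open>
  Falls from \<open>1\<close> at time \<open>0\<close> to \<open>0\<close> at time \<open>step n\<close>; its derivative is minus the forward kernel.
\<close>

definition cutoff :: "nat \<Rightarrow> real \<Rightarrow> real" where "cutoff n s = 1 - spline_primitive (s / step n)"

lemma
  shows cutoff_bounded_continuous: "cutoff n \<in> bounded_continuous"
    and scaled_bounded_continuous: "scaled spline (step n) \<in> bounded_continuous"
    and cutoff_derivative: "(cutoff n has_real_derivative - scaled spline (step n) s) (at s)"
    and cutoff_0: "cutoff n 0 = 1" and cutoff_T: "cutoff n T = 0"
proof -
  have st: "0 < step n" "step n \<le> T / 3" by (rule step_bounds)+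
  show D: "(cutoff n has_real_derivative - scaled spline (step n) s) (at s)" for s
  proof -
    have "((\<lambda>s. s / step n) has_real_derivative 1 / step n) (at s)" using st by (auto intro!: derivative_eq_intros)
    from DERIV_chain2[OF DERIV_spline_primitive[of "s / step n"] this]
    have "((\<lambda>s. spline_primitive (s / step n)) has_real_derivative spline (s / step n) * (1 / step n)) (at s)" .
    from DERIV_diff[OF DERIV_const[of 1] this] show ?thesis
      using st by (simp add: cutoff_def[abs_def] scaled_def)
  qed
  have "continuous_on UNIV (cutoff n)"
    by (rule DERIV_continuous_on[where D="\<lambda>s. - scaled spline (step n) s"]) (use D in auto)
  then show "cutoff n \<in> bounded_continuous"
    using spline_primitive_bounded by (auto simp: bounded_continuous_def cutoff_def)
  show "scaled spline (step n) \<in> bounded_continuous"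
    using C11_scaled_spline[of "step n"] st by (simp add: C11_kernel_def)
  show "cutoff n 0 = 1" by (simp add: cutoff_def spline_primitive_values)
  have "1 \<le> T / step n" using st T_pos by (simp add: le_divide_eq)
  then show "cutoff n T = 0" by (simp add: cutoff_def spline_primitive_values)
qed

text \<open>
  On the time interval the cutoff lives on \<open>[0, step n]\<close>, so its norm in \<open>L\<^sup>2\<close> is of order \<open>sqrt (step n)\<close>.
\<close>

lemma smear_cutoff_tendsto_0:
  assumes u: "field u"
  shows "(\<lambda>n. L2_norm M (smear u (cutoff n))) \<longlonglongrightarrow> 0"
proof -
  obtain K where K: "\<And>s. \<bar>1 - spline_primitive s\<bar> \<le> K" using spline_primitive_bounded by blast
  have le: "L2_norm M (smear u (cutoff n)) \<le> sqrt (K\<^sup>2 * step n * (L2_norm lborel u)\<^sup>2)" for n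
  proof -
    have st: "0 < step n" by (rule step_bounds)
    have "(\<integral>\<^sup>+s. indicator {0<..<T} s * ennreal ((cutoff n s)\<^sup>2) \<partial>lborel)
      \<le> (\<integral>\<^sup>+s. ennreal (K\<^sup>2) * indicator {0..step n} s \<partial>lborel)"
    proof (rule nn_integral_mono)
      fix s
      show "indicator {0<..<T} s * ennreal ((cutoff n s)\<^sup>2) \<le> ennreal (K\<^sup>2) * indicator {0..step n} s"
      proof (cases "s \<in> {0..step n}")
        case True
        have "(cutoff n s)\<^sup>2 \<le> K\<^sup>2" using K[of "s / step n"] by (simp add: cutoff_def abs_le_square_iff[symmetric])
        then show ?thesis using True by (auto simp: indicator_def intro: ennreal_leI)
      next
        case False
        then have "s \<in> {0<..<T} \<Longrightarrow> 1 \<le> s / step n" using st by (simp add: le_divide_eq)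
        then show ?thesis using spline_primitive_values(2)[of "s / step n"] by (auto simp: indicator_def cutoff_def)
      qed
    qed
    also have "\<dots> = ennreal (K\<^sup>2 * step n)" using st by (simp add: nn_integral_cmult_indicator ennreal_mult)
    finally have "(L2_norm lborel (smear u (cutoff n)))\<^sup>2 \<le> K\<^sup>2 * step n * (L2_norm lborel u)\<^sup>2"
      using st by (intro smear_L2_nn(2)[OF field_L2[OF u] field_time[OF u] bounded_continuous_measurable[OF cutoff_bounded_continuous]]) auto
    then show ?thesis unfolding smear_norm_eq[OF u cutoff_bounded_continuous] by (rule real_le_rsqrt)
  qed
  have "(\<lambda>n. sqrt (K\<^sup>2 * step n * (L2_norm lborel u)\<^sup>2)) \<longlonglongrightarrow> sqrt (K\<^sup>2 * 0 * (L2_norm lborel u)\<^sup>2)"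
    by (intro tendsto_intros step_tendsto)
  then have lim: "(\<lambda>n. sqrt (K\<^sup>2 * step n * (L2_norm lborel u)\<^sup>2)) \<longlonglongrightarrow> 0" by simp
  show ?thesis by (rule tendsto_sandwich[OF _ _ tendsto_const lim]) (use le in auto)
qed

lemma cutoff_pairing_tendsto_0:
  assumes u: "field u" and \<psi>: "\<psi> \<in> L2 M"
  shows "(\<lambda>n. L2_inner M (smear u (cutoff n)) \<psi>) \<longlonglongrightarrow> 0"
  using L2_inner_tendsto[OF smear_in[OF u cutoff_bounded_continuous] L2_zero \<psi>, of] smear_cutoff_tendsto_0[OF u]
  by (simp add: L2_inner_def)

text \<open>
  The first pairing in the equation is that of the forward mollification at time \<open>0\<close>, which tends to \<open>w\<close>;
  the term \<open>r\<close> collects the curl and current terms.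
\<close>

lemma initial_value:
  assumes A: "coefficient \<Omega> A c" and u: "field u" and w: "w \<in> L2 M" "w\<^sub>0 \<in> L2 M"
    and lim: "(\<lambda>n. L2_norm M (\<lambda>x. smear u (scaled spline (step n)) x - w x)) \<longlonglongrightarrow> 0"
    and eq: "\<And>\<phi> n. \<phi> \<in> test_fields \<Omega> \<Longrightarrow>
      - L2_inner M (\<lambda>x. A x *v smear u (\<lambda>s. - scaled spline (step n) s) x) \<phi> + r \<phi> n = L2_inner M (\<lambda>x. A x *v w\<^sub>0 x) \<phi>"
    and r: "\<And>\<phi>. \<phi> \<in> test_fields \<Omega> \<Longrightarrow> r \<phi> \<longlonglongrightarrow> 0"
  shows "AE x in M. w x = w\<^sub>0 x"
proof (rule equal_of_weighted_pairings[OF A w])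
  fix \<phi> assume \<phi>: "\<phi> \<in> test_fields \<Omega>"
  have Ab: "bounded_measurable_entries \<Omega> A" and As: "\<forall>x\<in>\<Omega>. transpose (A x) = A x" using A by (auto simp: coefficient_def)
  have \<phi>L: "\<phi> \<in> L2 M" by (rule test_field_L2_on[OF open_\<Omega> \<phi>])
  have neg: "- L2_inner M (\<lambda>x. A x *v smear u (\<lambda>s. - scaled spline (step n) s) x) \<phi>
    = L2_inner M (smear u (scaled spline (step n))) (\<lambda>x. A x *v \<phi> x)" for n
    unfolding L2_inner_matrix_sym[OF As] by (simp add: smear_uminus L2_inner_def)
  have "(\<lambda>n. L2_inner M (smear u (scaled spline (step n))) (\<lambda>x. A x *v \<phi> x)) \<longlonglongrightarrow> L2_inner M w (\<lambda>x. A x *v \<phi> x)"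
    by (rule L2_inner_tendsto[OF smear_in[OF u scaled_bounded_continuous] w(1) L2_matrix_mult[OF Ab \<phi>L] lim])
  from tendsto_add[OF this r[OF \<phi>]]
  have "(\<lambda>n. L2_inner M (smear u (scaled spline (step n))) (\<lambda>x. A x *v \<phi> x) + r \<phi> n) \<longlonglongrightarrow> L2_inner M w (\<lambda>x. A x *v \<phi> x)" by simp
  then have "(\<lambda>n::nat. L2_inner M (\<lambda>x. A x *v w\<^sub>0 x) \<phi>) \<longlonglongrightarrow> L2_inner M w (\<lambda>x. A x *v \<phi> x)"
    using eq[OF \<phi>] unfolding neg by simp
  then show "L2_inner M (\<lambda>x. A x *v w x) \<phi> = L2_inner M (\<lambda>x. A x *v w\<^sub>0 x) \<phi>"
    by (simp add: LIMSEQ_const_iff L2_inner_matrix_sym[OF As])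
qed

end

theorem theorem3p1:
  fixes \<Omega> :: "(real^3) set" and T :: real
    and \<epsilon> \<mu> :: "real^3 \<Rightarrow> real^3^3" and eps_lb mu_lb c\<^sub>1 :: real
    and j j\<^sub>1 :: "(real^3) \<times> real \<Rightarrow> real^3 \<Rightarrow> real^3" and j\<^sub>0 :: "(real^3) \<times> real \<Rightarrow> real^3"
    and e\<^sub>0 h\<^sub>0 :: "real^3 \<Rightarrow> real^3" and e h :: "(real^3) \<times> real \<Rightarrow> real^3"
  assumes "open \<Omega>" and "0 < T"
    and "bounded_measurable_entries \<Omega> \<epsilon>" and "bounded_measurable_entries \<Omega> \<mu>"
    and "\<forall>x\<in>\<Omega>. transpose (\<epsilon> x) = \<epsilon> x" and "\<forall>x\<in>\<Omega>. transpose (\<mu> x) = \<mu> x"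
    and "eps_lb > 0" and "\<forall>x\<in>\<Omega>. \<forall>\<xi>. (\<epsilon> x *v \<xi>) \<bullet> \<xi> \<ge> eps_lb * (norm \<xi>)\<^sup>2"
    and "mu_lb > 0" and "\<forall>x\<in>\<Omega>. \<forall>\<xi>. (\<mu> x *v \<xi>) \<bullet> \<xi> \<ge> mu_lb * (norm \<xi>)\<^sup>2"
    and "\<forall>z\<in>QT \<Omega> T. \<forall>\<xi>. j z \<xi> = j\<^sub>0 z + j\<^sub>1 z \<xi>"
    and "j\<^sub>0 \<in> L2 (lebesgue_on (QT \<Omega> T))"
    and "caratheodory \<Omega> T j\<^sub>1"
    and "c\<^sub>1 > 0" and "\<forall>z\<in>QT \<Omega> T. \<forall>\<xi>. norm (j\<^sub>1 z \<xi>) \<le> c\<^sub>1 * norm \<xi>"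
    and "e\<^sub>0 \<in> L2 (lebesgue_on \<Omega>)" and "h\<^sub>0 \<in> L2 (lebesgue_on \<Omega>)"
    and "weak_solution \<Omega> T \<epsilon> \<mu> j e\<^sub>0 h\<^sub>0 e h"
  shows "\<exists>ee hh. ee \<in> C_H \<Omega> T \<and> hh \<in> C_H \<Omega> T \<and>
     represents \<Omega> T ee e \<and> represents \<Omega> T hh h \<and>
     (AE x in lebesgue_on \<Omega>. ee 0 x = e\<^sub>0 x) \<and> (AE x in lebesgue_on \<Omega>. hh 0 x = h\<^sub>0 x)"
proof -
  interpret space_time \<Omega> T using assms(1,2) by unfold_locales
  let ?Q = "lebesgue_on (QT \<Omega> T)"
  have \<epsilon>: "coefficient \<Omega> \<epsilon> eps_lb" and \<mu>: "coefficient \<Omega> \<mu> mu_lb"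
    using assms(3-10) by (simp_all add: coefficient_def)
  note sol = assms(18)[unfolded weak_solution_def]
  have eL: "e \<in> L2 ?Q" and hL: "h \<in> L2 ?Q" using sol by auto
  let ?J = "\<lambda>z. j z (e z)"
  have JL: "?J \<in> L2 ?Q"
  proof -
    have jm: "(\<lambda>z. j\<^sub>1 z (e z)) \<in> borel_measurable ?Q" by (rule caratheodory_measurable[OF assms(13) L2D(1)[OF eL]])
    have j1L: "(\<lambda>z. j\<^sub>1 z (e z)) \<in> L2 ?Q"
    proof (rule L2_bound[OF jm])
      show "integrable ?Q (\<lambda>z. c\<^sub>1\<^sup>2 * (norm (e z))\<^sup>2)" using L2D(2)[OF eL] by simp
      show "AE z in ?Q. (norm (j\<^sub>1 z (e z)))\<^sup>2 \<le> c\<^sub>1\<^sup>2 * (norm (e z))\<^sup>2"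
      proof (rule AE_I2)
        fix z assume "z \<in> space ?Q"
        then have "norm (j\<^sub>1 z (e z)) \<le> c\<^sub>1 * norm (e z)" using assms(15) by simp
        then have "(norm (j\<^sub>1 z (e z)))\<^sup>2 \<le> (c\<^sub>1 * norm (e z))\<^sup>2" by (rule power_mono) simp
        then show "(norm (j\<^sub>1 z (e z)))\<^sup>2 \<le> c\<^sub>1\<^sup>2 * (norm (e z))\<^sup>2" by (simp add: power_mult_distrib)
      qed
    qed
    have S: "(\<lambda>z. j\<^sub>0 z + j\<^sub>1 z (e z)) \<in> L2 ?Q" by (rule L2_add[OF assms(12) j1L])
    have eq: "?J z = j\<^sub>0 z + j\<^sub>1 z (e z)" if "z \<in> space ?Q" for z using assms(11) that by simp
    have "?J \<in> borel_measurable ?Q"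
      by (rule measurable_cong[OF eq, THEN iffD2, OF _ L2D(1)[OF S]])
    then show ?thesis by (rule L2_bound[OF _ L2D(2)[OF S]]) (rule AE_I2, simp only: eq order_refl)
  qed
  obtain be where be: "field be" "AE z in ?Q. e z = be z" by (rule field_version[OF eL])
  obtain bh where bh: "field bh" "AE z in ?Q. h z = bh z" by (rule field_version[OF hL])
  obtain bJ where bJ: "field bJ" "AE z in ?Q. ?J z = bJ z" by (rule field_version[OF JL])
  \<comment> \<open>the two weak equations, tested with \<open>\<phi>(x) \<eta>(t)\<close> and written with pairings\<close>
  have weak1: "- L2_inner M (\<lambda>x. \<epsilon> x *v smear be \<eta>' x) \<phi> + (- L2_inner M (smear bh \<eta>) (weak_curl \<Omega> \<phi>) + L2_inner M (smear bJ \<eta>) \<phi>)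
      = \<eta> 0 * L2_inner M (\<lambda>x. \<epsilon> x *v e\<^sub>0 x) \<phi>"
    if \<phi>: "\<phi> \<in> V0 \<Omega>" and \<eta>: "\<eta> \<in> bounded_continuous" "\<eta>' \<in> bounded_continuous"
      "\<And>s. (\<eta> has_real_derivative \<eta>' s) (at s)" "\<eta> T = 0" for \<phi> \<eta> \<eta>'
  proof -
    have \<phi>V: "\<phi> \<in> V \<Omega>" using \<phi> by (simp add: V0_def)
    have \<phi>L: "\<phi> \<in> L2 M" and cL: "weak_curl \<Omega> \<phi> \<in> L2 M" by (rule V_L2[OF \<phi>V])+
    have "- (\<integral>z. (\<epsilon> (fst z) *v e z) \<bullet> (\<eta>' (snd z) *\<^sub>R \<phi> (fst z)) \<partial>?Q)
        + (\<integral>z. - (h z \<bullet> (\<eta> (snd z) *\<^sub>R weak_curl \<Omega> \<phi> (fst z))) + ?J z \<bullet> (\<eta> (snd z) *\<^sub>R \<phi> (fst z)) \<partial>?Q)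
        = (\<integral>x. (\<epsilon> x *v e\<^sub>0 x) \<bullet> (\<eta> 0 *\<^sub>R \<phi> x) \<partial>M)"
      using sol admissible_tensor[OF disjI2[OF refl] \<phi> \<eta>] by blast
    moreover have "(\<integral>z. - (h z \<bullet> (\<eta> (snd z) *\<^sub>R weak_curl \<Omega> \<phi> (fst z))) + ?J z \<bullet> (\<eta> (snd z) *\<^sub>R \<phi> (fst z)) \<partial>?Q)
      = - L2_inner M (smear bh \<eta>) (weak_curl \<Omega> \<phi>) + L2_inner M (smear bJ \<eta>) \<phi>"
      using pairing_version[OF hL bh cL \<eta>(1)] pairing_version[OF JL bJ \<phi>L \<eta>(1)] by simp
    moreover note pairing_matrix[OF assms(3,5) eL be \<phi>L \<eta>(2)]
    ultimately show ?thesis by (simp add: L2_inner_def)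
  qed
  have weak2: "- L2_inner M (\<lambda>x. \<mu> x *v smear bh \<eta>' x) \<psi> + L2_inner M (smear be \<eta>) (weak_curl \<Omega> \<psi>)
      = \<eta> 0 * L2_inner M (\<lambda>x. \<mu> x *v h\<^sub>0 x) \<psi>"
    if \<psi>: "\<psi> \<in> V \<Omega>" and \<eta>: "\<eta> \<in> bounded_continuous" "\<eta>' \<in> bounded_continuous"
      "\<And>s. (\<eta> has_real_derivative \<eta>' s) (at s)" "\<eta> T = 0" for \<psi> \<eta> \<eta>'
  proof -
    have \<psi>L: "\<psi> \<in> L2 M" and cL: "weak_curl \<Omega> \<psi> \<in> L2 M" by (rule V_L2[OF \<psi>])+
    have "- (\<integral>z. (\<mu> (fst z) *v h z) \<bullet> (\<eta>' (snd z) *\<^sub>R \<psi> (fst z)) \<partial>?Q)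
        + (\<integral>z. e z \<bullet> (\<eta> (snd z) *\<^sub>R weak_curl \<Omega> \<psi> (fst z)) \<partial>?Q)
        = (\<integral>x. (\<mu> x *v h\<^sub>0 x) \<bullet> (\<eta> 0 *\<^sub>R \<psi> x) \<partial>M)"
      using sol admissible_tensor[OF disjI1[OF refl] \<psi> \<eta>] by blast
    moreover note pairing_matrix[OF assms(4,6) hL bh \<psi>L \<eta>(2)] pairing_version(1)[OF eL be cL \<eta>(1)]
    ultimately show ?thesis by (simp add: L2_inner_def)
  qed
  interpret smeared_maxwell \<Omega> T \<epsilon> \<mu> eps_lb mu_lb be bh bJ
  proof unfold_locales
    fix \<eta> \<eta>' :: "real \<Rightarrow> real"
    assume \<eta>: "\<eta> \<in> bounded_continuous" "\<eta>' \<in> bounded_continuous" "\<And>s. (\<eta> has_real_derivative \<eta>' s) (at s)"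
      and ends: "\<eta> 0 = 0" "\<eta> T = 0"
    let ?e = "smear be \<eta>" and ?G = "\<lambda>x. \<mu> x *v smear bh \<eta>' x"
    have eM: "?e \<in> L2 M" by (rule smear_in[OF be(1) \<eta>(1)])
    have hM: "smear bh \<eta> \<in> L2 M" by (rule smear_in[OF bh(1) \<eta>(1)])
    have GL: "?G \<in> L2 M" by (intro L2_matrix_mult[OF assms(4)] smear_in bh \<eta>)
    \<comment> \<open>the second equation both yields the weak curl of \<open>?e\<close> and places \<open>?e\<close> in \<open>V0 \<Omega>\<close>\<close>
    have dual: "L2_inner M ?e (weak_curl \<Omega> \<psi>) = L2_inner M ?G \<psi>" if "\<psi> \<in> V \<Omega>" for \<psi>
      using weak2[OF that \<eta> ends(2)] ends(1) by simp
    have "has_weak_curl \<Omega> ?e ?G"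
      unfolding has_weak_curl_def
    proof (intro conjI ballI GL)
      fix \<phi> assume \<phi>: "\<phi> \<in> test_fields \<Omega>"
      note \<phi>V = test_fields_V[OF open_\<Omega> \<phi>]
      have "(\<integral>x. ?e x \<bullet> curl \<phi> x \<partial>M) = L2_inner M ?e (weak_curl \<Omega> \<phi>)"
      proof -
        have "AE x in M. curl \<phi> x = weak_curl \<Omega> \<phi> x" using \<phi>V(2) by eventually_elim simp
        from L2_inner_cong_AE[OF eM eM L2_lebesgue_on[OF \<Omega>_borel curl_test_field_L2[OF \<phi>]] V_L2(2)[OF \<phi>V(1)] _ this]
        show ?thesis by (simp add: L2_inner_def)
      qed
      also have "\<dots> = (\<integral>x. ?G x \<bullet> \<phi> x \<partial>M)" using dual[OF \<phi>V(1)] by (simp add: L2_inner_def)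
      finally show "(\<integral>x. ?e x \<bullet> curl \<phi> x \<partial>M) = (\<integral>x. ?G x \<bullet> \<phi> x \<partial>M)" .
    qed
    note eV = has_weak_curl_imp[OF open_\<Omega> eM this]
    have curl_e: "L2_inner M (weak_curl \<Omega> ?e) \<psi> = L2_inner M ?G \<psi>" if "\<psi> \<in> L2 M" for \<psi>
      by (rule L2_inner_cong_AE[OF V_L2(2)[OF eV(1)] GL that that eV(2)]) simp
    have "?e \<in> V0 \<Omega>"
      using eV(1) curl_e dual V_L2(1) by (auto simp: V0_def L2_inner_def)
    from weak1[OF this \<eta> ends(2)] ends(1)
    show "weighted \<epsilon> be \<eta>' \<eta> + weighted \<mu> bh \<eta>' \<eta> = L2_inner M (smear bJ \<eta>) (smear be \<eta>)"
      using curl_e[OF hM] by (simp add: weighted_def L2_inner_commute[of M "smear bh \<eta>"])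
  qed (rule \<epsilon> \<mu> be(1) bh(1) bJ(1))+
  obtain ee where ee: "ee \<in> C_H \<Omega> T" "represents \<Omega> T ee be"
    "(\<lambda>n. L2_norm M (\<lambda>x. smear be (scaled spline (step n)) x - ee 0 x)) \<longlonglongrightarrow> 0"
    by (rule continuous_solution[of be]) auto
  obtain hh where hh: "hh \<in> C_H \<Omega> T" "represents \<Omega> T hh bh"
    "(\<lambda>n. L2_norm M (\<lambda>x. smear bh (scaled spline (step n)) x - hh 0 x)) \<longlonglongrightarrow> 0"
    by (rule continuous_solution[of bh]) auto
  have L0: "ee 0 \<in> L2 M" "hh 0 \<in> L2 M" using ee(1) hh(1) T_pos by (auto simp: C_H_def)
  note cut = cutoff_bounded_continuous bounded_continuous_uminus[OF scaled_bounded_continuous] cutoff_derivative cutoff_T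
  have "AE x in M. ee 0 x = e\<^sub>0 x"
  proof (rule initial_value[OF \<epsilon> be(1) L0(1) assms(16) ee(3)])
    fix \<phi> assume \<phi>: "\<phi> \<in> test_fields \<Omega>"
    let ?r = "\<lambda>\<phi> n. - L2_inner M (smear bh (cutoff n)) (weak_curl \<Omega> \<phi>) + L2_inner M (smear bJ (cutoff n)) \<phi>"
    show "- L2_inner M (\<lambda>x. \<epsilon> x *v smear be (\<lambda>s. - scaled spline (step n) s) x) \<phi> + ?r \<phi> n
      = L2_inner M (\<lambda>x. \<epsilon> x *v e\<^sub>0 x) \<phi>" for n
      using weak1[OF test_fields_V0[OF open_\<Omega> \<phi>] cut, of n] by (simp add: cutoff_0)
    have "?r \<phi> \<longlonglongrightarrow> - 0 + 0"
      by (intro tendsto_intros cutoff_pairing_tendsto_0 bh(1) bJ(1) test_field_L2_on[OF open_\<Omega> \<phi>] V_L2(2)[OF test_fields_V(1)[OF open_\<Omega> \<phi>]])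
    then show "?r \<phi> \<longlonglongrightarrow> 0" by simp
  qed
  moreover have "AE x in M. hh 0 x = h\<^sub>0 x"
  proof (rule initial_value[OF \<mu> bh(1) L0(2) assms(17) hh(3)])
    fix \<phi> assume \<phi>: "\<phi> \<in> test_fields \<Omega>"
    let ?r = "\<lambda>\<phi> n. L2_inner M (smear be (cutoff n)) (weak_curl \<Omega> \<phi>)"
    show "- L2_inner M (\<lambda>x. \<mu> x *v smear bh (\<lambda>s. - scaled spline (step n) s) x) \<phi> + ?r \<phi> n
      = L2_inner M (\<lambda>x. \<mu> x *v h\<^sub>0 x) \<phi>" for n
      using weak2[OF test_fields_V(1)[OF open_\<Omega> \<phi>] cut, of n] by (simp add: cutoff_0)
    show "?r \<phi> \<longlonglongrightarrow> 0"
      by (intro cutoff_pairing_tendsto_0 be(1) V_L2(2)[OF test_fields_V(1)[OF open_\<Omega> \<phi>]])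
  qed
  moreover have "AE z in ?Q. be z = e z" "AE z in ?Q. bh z = h z"
    using be(2) bh(2) by (auto elim: eventually_mono)
  then have "represents \<Omega> T ee e" "represents \<Omega> T hh h"
    using represents_cong ee(2) hh(2) by auto
  ultimately show ?thesis using ee(1) hh(1) by blast
qed

end
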